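(* Let $\Delta$ be an almost surely terminating pBPA with stack alphabet $\Gamma$, let $X_0\in\Gamma$ be such that $X_0$ depends on every $X\in\Gamma\setminus\{X_0\}$, and let $p_{\min}$ be the least rule probability of $\Delta$. Then one of the following holds: (1) $\mathcal{P}(\mathbf{T}_{X_0}\ge 2^{|\Gamma|})=0$. (2) $E[X_0]$ is finite and for all $n\in\mathbb{N}$ with $n\ge 2E[X_0]$, \[p_{\min}^n\le\mathcal{P}(\mathbf{T}_{X_0}\ge n)\le\exp\!\left(1-\frac{n}{8E_{\max}^2}\right),\] where $E_{\max}=\max_{X\in\Gamma}E[X]$. (3) $E[X_0]$ is infinite and there are $n_0\in\mathbb{N}$ and a constant $c>0$ (depending on $\Delta$) such that for all $n\ge n_0$, \[\frac{c}{n^{1/2}}\le\mathcal{P}(\mathbf{T}_{X_0}\ge n)\le\frac{d_1}{n^{d_2}},\] where $d_1=18h|\Gamma|/p_{\min}^{3|\Gamma|}$, $d_2=1/(2^{h+1}-2)$, and $h$ is the height of the DAG of strongly connected components of the dependence relation.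
   Context: A pBPA consists of a finite stack alphabet $\Gamma$ and a finite set of rules $X\overset{p}{\hookrightarrow}\alpha$ with $X\in\Gamma$, $\alpha\in\Gamma^*$, $|\alpha|\le 2$, $p\in(0,1]$, such that for each $X$ the probabilities of the rules with left side $X$ sum to $1$. It induces a Markov chain on $\Gamma^*$: $X\beta\to\alpha\beta$ with probability $p$ for each rule $X\overset{p}{\hookrightarrow}\alpha$, and $\varepsilon\to\varepsilon$ with probability $1$. Runs are infinite paths, with the standard probability measure $\mathcal{P}$ on runs from a given start configuration. For $\alpha\in\Gamma^*$, $\mathbf{T}_\alpha(w)$ is the least $n\ge0$ with $w(n)=\varepsilon$ for a run $w$ from $\alpha$ (or $\infty$), and $E[\alpha]$ is its expectation. The pBPA is almost surely terminating if $\mathcal{P}(\mathbf{T}_X<\infty)=1$ for every $X\in\Gamma$. $X$ depends directly on $Y$ if some rule $X\hookrightarrow\alpha$ has $Y$ occurring in $\alpha$; "depends on" is the transitive closure of this relation. The height $h$ of the DAG of strongly connected components (SCCs) of the dependence graph is the longest distance between a top SCC and a bottom SCC plus $1$ (so $h=1$ if there is only one SCC). *)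

theory Defs
  imports "HOL-Probability.Probability"
begin

text \<open>
  A pBPA is given by its stack alphabet \<open>\<Gamma>\<close> and, for every stack symbol \<open>X\<close>, the probability mass
  function \<open>\<delta> X\<close> on right-hand sides: \<open>X \<hookrightarrow> \<alpha>\<close> is a rule of probability \<open>p\<close> iff
  \<open>p = pmf (\<delta> X) \<alpha>\<close> and \<open>p > 0\<close>. The rule probabilities of each \<open>X\<close> thus lie in \<open>(0,1]\<close> and sum
  to \<open>1\<close> by construction. Values of \<open>\<delta>\<close> outside \<open>\<Gamma>\<close> are irrelevant.
\<close>

definition pBPA :: "'a set \<Rightarrow> ('a \<Rightarrow> 'a list pmf) \<Rightarrow> bool" where
  "pBPA \<Gamma> \<delta> \<longleftrightarrow> finite \<Gamma> \<and> (\<forall>X\<in>\<Gamma>. \<forall>\<alpha>\<in>set_pmf (\<delta> X). \<alpha> \<in> lists \<Gamma> \<and> length \<alpha> \<le> 2)"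

definition rules :: "'a set \<Rightarrow> ('a \<Rightarrow> 'a list pmf) \<Rightarrow> ('a \<times> 'a list) set" where
  "rules \<Gamma> \<delta> = {(X, \<alpha>). X \<in> \<Gamma> \<and> \<alpha> \<in> set_pmf (\<delta> X)}"

definition p_min :: "'a set \<Rightarrow> ('a \<Rightarrow> 'a list pmf) \<Rightarrow> real" where
  "p_min \<Gamma> \<delta> = Min ((\<lambda>(X, \<alpha>). pmf (\<delta> X) \<alpha>) ` rules \<Gamma> \<delta>)"

fun step :: "('a \<Rightarrow> 'a list pmf) \<Rightarrow> 'a list \<Rightarrow> 'a list pmf" where
  "step \<delta> [] = return_pmf []"
| "step \<delta> (X # \<beta>) = map_pmf (\<lambda>\<alpha>. \<alpha> @ \<beta>) (\<delta> X)"

text \<open>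
  Conditional law of the \<open>i\<close>-th configuration given the configurations at positions \<open>< i\<close>,
  in the form required by the Ionescu-Tulcea theorem.
\<close>

definition run_kernel ::
  "('a \<Rightarrow> 'a list pmf) \<Rightarrow> 'a list \<Rightarrow> nat \<Rightarrow> (nat \<Rightarrow> 'a list) \<Rightarrow> 'a list measure" where
  "run_kernel \<delta> \<alpha> i w = measure_pmf (if i = 0 then return_pmf \<alpha> else step \<delta> (w (i - 1)))"

lemma Ionescu_Tulcea_run_kernel: "Ionescu_Tulcea (run_kernel \<delta> \<alpha>) (\<lambda>_. count_space UNIV)"
proof (rule Ionescu_Tulcea.intro)
  show "run_kernel \<delta> \<alpha> i \<in> PiM {0..<i} (\<lambda>_. count_space UNIV) \<rightarrow>\<^sub>M subprob_algebra (count_space UNIV)" for i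
  proof (cases "i = 0")
    case True
    then show ?thesis
      by (simp add: run_kernel_def[abs_def] measure_pmf_in_subprob_algebra)
  next
    case False
    have "(\<lambda>w. measure_pmf (step \<delta> (w (i - 1))))
        \<in> PiM {0..<i} (\<lambda>_. count_space UNIV) \<rightarrow>\<^sub>M subprob_algebra (count_space UNIV)"
    proof (rule measurable_compose[of "\<lambda>w. w (i - 1)" _ "count_space UNIV"])
      show "(\<lambda>w. w (i - 1)) \<in> PiM {0..<i} (\<lambda>_. count_space UNIV) \<rightarrow>\<^sub>M count_space UNIV"
        using False by (intro measurable_component_singleton) auto
    qed (simp add: measure_pmf_in_subprob_algebra)
    with False show ?thesis
      by (simp add: run_kernel_def[abs_def])
  qed
qed (simp add: run_kernel_def measure_pmf.prob_space_axioms)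

interpretation chain: Ionescu_Tulcea "run_kernel \<delta> \<alpha>" "\<lambda>_. count_space UNIV" for \<delta> \<alpha>
  by (rule Ionescu_Tulcea_run_kernel)

definition run_measure :: "('a \<Rightarrow> 'a list pmf) \<Rightarrow> 'a list \<Rightarrow> (nat \<Rightarrow> 'a list) measure" where
  "run_measure \<delta> \<alpha> = chain.PF.lim \<delta> \<alpha>"

lemma sets_run_measure:
  "sets (run_measure \<delta> \<alpha>) = sets (PiM UNIV (\<lambda>_. count_space UNIV))"
  by (simp add: run_measure_def)

lemma space_run_measure: "space (run_measure \<delta> \<alpha>) = UNIV"
  by (simp add: run_measure_def space_PiM)

text \<open>
  \<open>run_measure \<delta> \<alpha>\<close> lives on all sequences of configurations, but by the following formula it is
  the standard measure on the paths of the Markov chain that start in \<open>\<alpha>\<close>.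
\<close>

lemma emeasure_run_measure_cylinder:
  "emeasure (run_measure \<delta> \<alpha>) {w. \<forall>i\<le>n. w i = v i} =
     (if v 0 = \<alpha> then ennreal (\<Prod>i<n. pmf (step \<delta> (v i)) (v (Suc i))) else 0)"
proof -
  let ?M = "\<lambda>_::nat. count_space (UNIV :: 'a list set)"
  have sp: "restrict v J \<in> space (PiM J ?M)" for J
    by (auto simp: space_PiM)
  have sing: "{restrict v J} \<in> sets (PiM J ?M)" if "finite J" for J
  proof -
    have "PiE J (\<lambda>i. {v i}) \<in> sets (PiM J ?M)"
      using that by (intro sets_PiM_I_finite) auto
    also have "PiE J (\<lambda>i. {v i}) = {restrict v J}"
      by (auto simp: PiE_iff extensional_def fun_eq_iff)
    finally show ?thesis .
  qed
  have C: "emeasure (chain.C \<delta> \<alpha> 0 (Suc n) (\<lambda>_. undefined)) {restrict v {0..<Suc n}} =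
     (if v 0 = \<alpha> then ennreal (\<Prod>i<n. pmf (step \<delta> (v i)) (v (Suc i))) else 0)" for n
  proof -
    have eP: "emeasure (chain.eP \<delta> \<alpha> k w) {restrict v {0..<Suc k}} =
        indicator {restrict v {0..<k}} w *
          ennreal (pmf (if k = 0 then return_pmf \<alpha> else step \<delta> (v (k - 1))) (v k))"
      if w: "w \<in> space (PiM {0..<k} ?M)" for k w
    proof -
      have "(\<lambda>x. w(k := x)) -` {restrict v {0..<Suc k}} =
          (if w = restrict v {0..<k} then {v k} else {})"
      proof -
        have "w(k := x) = restrict v {0..<Suc k} \<longleftrightarrow> w = restrict v {0..<k} \<and> x = v k" for x
        proof
          assume *: "w(k := x) = restrict v {0..<Suc k}"
          have "w i = restrict v {0..<k} i" for i
            using fun_cong[OF *, of i] w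
            by (cases "i = k") (auto simp: space_PiM PiE_iff extensional_def less_Suc_eq)
          moreover have "x = v k"
            using fun_cong[OF *, of k] by simp
          ultimately show "w = restrict v {0..<k} \<and> x = v k"
            by blast
        next
          assume "w = restrict v {0..<k} \<and> x = v k"
          then show "w(k := x) = restrict v {0..<Suc k}"
            by (auto simp: less_Suc_eq)
        qed
        then show ?thesis
          by (simp add: vimage_def)
      qed
      then show ?thesis
        using w by (auto simp: chain.emeasure_eP sing run_kernel_def emeasure_pmf_single)
    qed
    have step: "emeasure (chain.C \<delta> \<alpha> 0 (Suc k) (\<lambda>_. undefined)) {restrict v {0..<Suc k}} =
        emeasure (chain.C \<delta> \<alpha> 0 k (\<lambda>_. undefined)) {restrict v {0..<k}} *
          ennreal (pmf (if k = 0 then return_pmf \<alpha> else step \<delta> (v (k - 1))) (v k))" for k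
    proof -
      have [simp]: "(\<lambda>_. undefined) \<in> space (PiM {0..<0} ?M)"
        by (simp add: space_PiM)
      have S: "sets (chain.C \<delta> \<alpha> 0 k (\<lambda>_. undefined)) = sets (PiM {0..<k} ?M)"
        using chain.sets_C[of "\<lambda>_. undefined" 0 \<delta> \<alpha> k] by simp
      have sp': "space (chain.C \<delta> \<alpha> 0 k (\<lambda>_. undefined)) = space (PiM {0..<k} ?M)"
        using S by (rule sets_eq_imp_space_eq)
      have ne: "space (chain.C \<delta> \<alpha> 0 k (\<lambda>_. undefined)) \<noteq> {}"
        using sp'  sp[of "{0..<k}"] by auto
      have m: "chain.eP \<delta> \<alpha> k \<in> chain.C \<delta> \<alpha> 0 k (\<lambda>_. undefined) \<rightarrow>\<^sub>M
          subprob_algebra (PiM {0..<Suc k} ?M)"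
        using chain.measurable_eP[of \<delta> \<alpha> k] by (simp add: measurable_cong_sets[OF S refl])
      have "emeasure (chain.C \<delta> \<alpha> 0 (Suc k) (\<lambda>_. undefined)) {restrict v {0..<Suc k}} =
          (\<integral>\<^sup>+w. emeasure (chain.eP \<delta> \<alpha> k w) {restrict v {0..<Suc k}}
             \<partial>chain.C \<delta> \<alpha> 0 k (\<lambda>_. undefined))"
        by (simp add: emeasure_bind[OF ne m] sing)
      also have "\<dots> = (\<integral>\<^sup>+w. ennreal (pmf (if k = 0 then return_pmf \<alpha> else step \<delta> (v (k - 1))) (v k)) *
            indicator {restrict v {0..<k}} w \<partial>chain.C \<delta> \<alpha> 0 k (\<lambda>_. undefined))"
        by (intro nn_integral_cong) (simp add: sp' eP mult.commute)
      also have "\<dots> = emeasure (chain.C \<delta> \<alpha> 0 k (\<lambda>_. undefined)) {restrict v {0..<k}} *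
          ennreal (pmf (if k = 0 then return_pmf \<alpha> else step \<delta> (v (k - 1))) (v k))"
        by (subst nn_integral_cmult_indicator) (simp_all only: S sing finite_atLeastLessThan mult.commute)
      finally show ?thesis .
    qed
    show ?thesis
    proof (induction n)
      case 0
      have "emeasure (chain.C \<delta> \<alpha> 0 0 (\<lambda>_. undefined)) {restrict v {0..<0}} = 1"
        using sing[of "{0..<0}"] by (auto simp: indicator_def restrict_def)
      then show ?case
        by (subst step) (simp add: indicator_def)
    next
      case (Suc n)
      show ?case
        by (subst step, subst Suc.IH)
          (simp add: ennreal_mult' prod_nonneg del: chain.C.simps)
    qed
  qed
  let ?X = "{restrict v {0..<Suc n}}"
  have "{w. \<forall>i\<le>n. w i = v i} = prod_emb UNIV ?M {0..<Suc n} ?X"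
    by (auto simp: prod_emb_def space_PiM restrict_def fun_eq_iff less_Suc_eq_le) metis
  then have "emeasure (run_measure \<delta> \<alpha>) {w. \<forall>i\<le>n. w i = v i} =
      emeasure (chain.CI \<delta> \<alpha> {0..<Suc n}) ?X"
    using chain.lim[of "{0..<Suc n}" ?X \<delta> \<alpha>] sing by (simp add: run_measure_def)
  also have "\<dots> = emeasure (chain.C \<delta> \<alpha> 0 (Suc n) (\<lambda>_. undefined)) ?X"
  proof -
    have "prod_emb {0..<Suc n} ?M {0..<Suc n} ?X = ?X"
      by (intro prod_emb_id) (auto simp: PiE_iff)
    then show ?thesis
      using chain.emeasure_CI[of "{0..<Suc n}" "Suc n" ?X \<delta> \<alpha>] sing by simp
  qed
  finally show ?thesis
    by (simp only: C)
qed

definition term_time :: "(nat \<Rightarrow> 'a list) \<Rightarrow> enat" where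
  "term_time w = (if \<exists>n. w n = [] then enat (LEAST n. w n = []) else \<infinity>)"

definition prob_term_ge :: "('a \<Rightarrow> 'a list pmf) \<Rightarrow> 'a list \<Rightarrow> nat \<Rightarrow> real" where
  "prob_term_ge \<delta> \<alpha> n = measure (run_measure \<delta> \<alpha>) {w. enat n \<le> term_time w}"

definition expected_time :: "('a \<Rightarrow> 'a list pmf) \<Rightarrow> 'a list \<Rightarrow> ennreal" where
  "expected_time \<delta> \<alpha> = (\<integral>\<^sup>+w. ennreal_of_enat (term_time w) \<partial>run_measure \<delta> \<alpha>)"

definition E_max :: "'a set \<Rightarrow> ('a \<Rightarrow> 'a list pmf) \<Rightarrow> ennreal" where
  "E_max \<Gamma> \<delta> = Max ((\<lambda>X. expected_time \<delta> [X]) ` \<Gamma>)"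

definition as_terminating :: "'a set \<Rightarrow> ('a \<Rightarrow> 'a list pmf) \<Rightarrow> bool" where
  "as_terminating \<Gamma> \<delta> \<longleftrightarrow>
     (\<forall>X\<in>\<Gamma>. measure (run_measure \<delta> [X]) {w. term_time w < \<infinity>} = 1)"

definition direct_dep :: "'a set \<Rightarrow> ('a \<Rightarrow> 'a list pmf) \<Rightarrow> ('a \<times> 'a) set" where
  "direct_dep \<Gamma> \<delta> = {(X, Y). \<exists>\<alpha>. (X, \<alpha>) \<in> rules \<Gamma> \<delta> \<and> Y \<in> set \<alpha>}"

definition depends_on :: "'a set \<Rightarrow> ('a \<Rightarrow> 'a list pmf) \<Rightarrow> ('a \<times> 'a) set" where
  "depends_on \<Gamma> \<delta> = (direct_dep \<Gamma> \<delta>)\<^sup>+"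

text \<open>
  Reflexivity on \<open>\<Gamma>\<close> makes a symbol that does not depend on itself a (trivial) component.
\<close>

definition sccs :: "'a set \<Rightarrow> ('a \<Rightarrow> 'a list pmf) \<Rightarrow> 'a set set" where
  "sccs \<Gamma> \<delta> = \<Gamma> // {(X, Y). X \<in> \<Gamma> \<and> Y \<in> \<Gamma> \<and>
     (X, Y) \<in> (direct_dep \<Gamma> \<delta>)\<^sup>* \<and> (Y, X) \<in> (direct_dep \<Gamma> \<delta>)\<^sup>*}"

definition scc_edge :: "'a set \<Rightarrow> ('a \<Rightarrow> 'a list pmf) \<Rightarrow> ('a set \<times> 'a set) set" where
  "scc_edge \<Gamma> \<delta> = {(C, D). C \<in> sccs \<Gamma> \<delta> \<and> D \<in> sccs \<Gamma> \<delta> \<and> C \<noteq> D \<and>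
     (\<exists>X\<in>C. \<exists>Y\<in>D. (X, Y) \<in> direct_dep \<Gamma> \<delta>)}"

definition top_scc :: "'a set \<Rightarrow> ('a \<Rightarrow> 'a list pmf) \<Rightarrow> 'a set \<Rightarrow> bool" where
  "top_scc \<Gamma> \<delta> C \<longleftrightarrow> C \<in> sccs \<Gamma> \<delta> \<and> (\<nexists>D. (D, C) \<in> scc_edge \<Gamma> \<delta>)"

definition bottom_scc :: "'a set \<Rightarrow> ('a \<Rightarrow> 'a list pmf) \<Rightarrow> 'a set \<Rightarrow> bool" where
  "bottom_scc \<Gamma> \<delta> C \<longleftrightarrow> C \<in> sccs \<Gamma> \<delta> \<and> (\<nexists>D. (C, D) \<in> scc_edge \<Gamma> \<delta>)"

text \<open>
  The height is the length (number of edges) of a longest path from a top to a bottom component,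
  plus one. The set of path lengths is finite since the component graph is a finite DAG.
\<close>

definition scc_height :: "'a set \<Rightarrow> ('a \<Rightarrow> 'a list pmf) \<Rightarrow> nat" where
  "scc_height \<Gamma> \<delta> =
     Max {k. \<exists>C D. top_scc \<Gamma> \<delta> C \<and> bottom_scc \<Gamma> \<delta> D \<and> (C, D) \<in> scc_edge \<Gamma> \<delta> ^^ k} + 1"

end

theory Submission
  imports Defs "HOL-Real_Asymp.Real_Asymp"
begin

text \<open>
  Everything is read off the survival probabilities \<open>surv\<close>, which satisfy a first-step recursion.
  If no dependence path has \<open>card \<Gamma>\<close> edges, derivation trees have fewer than \<open>2 ^ card \<Gamma>\<close> nodes;
  otherwise some symbol reachable from \<open>X0\<close> depends on itself and every number of steps is
  survived with probability at least \<open>p_min ^ n\<close>. If the expectation is finite, total expected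
  remaining time plus elapsed time is a supermartingale with bounded increments, and Hoeffding's
  lemma gives the exponential tail.

  If the expectation is infinite, there is a nonzero nonnegative \<open>u\<close> on symbols whose additive
  extension to configurations is a submartingale. It reaches a level of order \<open>sqrt n\<close> with
  probability of order \<open>1 / sqrt n\<close>, and from there \<open>n\<close> steps are survived with probability at
  least \<open>1 / 2\<close>. For the upper bound let \<open>q X\<close> be the probability that a geometric clock with
  parameter \<open>1 - s\<close> rings before termination from \<open>X\<close>. Since
  \<open>q (Y Z) = q Y + q Z - q Y * q Z\<close>, comparing \<open>q\<close> on a component with a positive superharmonic
  vector leaves only the quadratic term and yields \<open>(q X)\<^sup>2 \<le> K * ((1 - s) + q (lower symbols))\<close>.
  Going up the components gives \<open>q X = O ((1 - s) powr (1 / 2 ^ h))\<close>. For \<open>h \<ge> 2\<close> this exponent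
  exceeds the claimed \<open>1 / (2 ^ (h + 1) - 2)\<close>, so constants matter only for \<open>h = 1\<close>.
\<close>

text \<open>The termination time of \<open>\<alpha> @ \<beta>\<close> is a sum of two independent
  times. Sums are awkward for tails but easy for a memoryless clock, under which
  \<open>1 - q\<close> is multiplicative; \<open>s = 1 - 1 / n\<close> converts back to a tail at
  the cost of a factor 2. The obstacle is a critical component: there the linear part of the
  recursion for \<open>q\<close> gives no bound, and only the quadratic term pulls \<open>q\<close>
  down. It is isolated by a superharmonic vector that touches \<open>q\<close> from above at one
  symbol. The gap is 0 at that symbol, grows by a bounded factor along each dependence edge, and
  controls the quadratic term everywhere. Perron-Frobenius theory would supply such a vector. Here
  both it (up to a small error) and the submartingale vector \<open>u\<close> come from
  \<open>q\<close> itself at parameters near 1, where products of its values are negligible against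
  the values. If no rule puts two symbols of the component on the stack, the quadratic term is
  absent and a rule leaving the component takes its place. In
  \<open>p_min ^ (3 * card \<Gamma>)\<close>, two of the three factors pay for comparing values of
  \<open>q\<close> inside a component, the third for propagating the gap.\<close>

text \<open>
  Meant for symbols in \<open>\<Gamma>\<close>: for a right-hand side distribution of infinite support the sum is \<open>0\<close>.
\<close>

definition avg :: "('a \<Rightarrow> 'a list pmf) \<Rightarrow> 'a \<Rightarrow> ('a list \<Rightarrow> real) \<Rightarrow> real" where
  "avg \<delta> X f = (\<Sum>\<alpha>\<in>set_pmf (\<delta> X). pmf (\<delta> X) \<alpha> * f \<alpha>)"

text \<open>The probability of T > n, so the event T >= n corresponds to index \<open>n - 1\<close>.
  The recursive form turns estimates into inductions on \<open>n\<close> that never touch the run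
  measure.\<close>

fun surv :: "('a \<Rightarrow> 'a list pmf) \<Rightarrow> nat \<Rightarrow> 'a list \<Rightarrow> real" where
  "surv \<delta> 0 \<alpha> = (if \<alpha> = [] then 0 else 1)"
| "surv \<delta> (Suc n) [] = 0"
| "surv \<delta> (Suc n) (X # \<beta>) = avg \<delta> X (\<lambda>\<alpha>. surv \<delta> n (\<alpha> @ \<beta>))"

lemma surv_Nil [simp]: "surv \<delta> n [] = 0"
  by (cases n) auto

lemma avg_add: "avg \<delta> X (\<lambda>\<alpha>. f \<alpha> + g \<alpha>) = avg \<delta> X f + avg \<delta> X g"
  by (simp add: avg_def algebra_simps sum.distrib)

lemma avg_diff: "avg \<delta> X (\<lambda>\<alpha>. f \<alpha> - g \<alpha>) = avg \<delta> X f - avg \<delta> X g"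
  by (simp add: avg_def algebra_simps sum_subtractf)

lemma avg_cmult: "avg \<delta> X (\<lambda>\<alpha>. c * f \<alpha>) = c * avg \<delta> X f"
  unfolding avg_def sum_distrib_left by (intro sum.cong) auto

lemma avg_mult_right: "avg \<delta> X (\<lambda>\<alpha>. f \<alpha> * c) = avg \<delta> X f * c"
  unfolding avg_def sum_distrib_right by (intro sum.cong) auto

lemma avg_sum: "avg \<delta> X (\<lambda>\<alpha>. \<Sum>i\<in>I. f i \<alpha>) = (\<Sum>i\<in>I. avg \<delta> X (f i))"
  unfolding avg_def by (subst sum.swap) (simp add: sum_distrib_left)

lemma avg_mono:
  assumes "\<And>\<alpha>. \<alpha> \<in> set_pmf (\<delta> X) \<Longrightarrow> f \<alpha> \<le> g \<alpha>"
  shows "avg \<delta> X f \<le> avg \<delta> X g"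
  unfolding avg_def by (intro sum_mono mult_left_mono assms) auto

lemma avg_nonneg: "(\<And>\<alpha>. \<alpha> \<in> set_pmf (\<delta> X) \<Longrightarrow> 0 \<le> f \<alpha>) \<Longrightarrow> 0 \<le> avg \<delta> X f"
  unfolding avg_def by (intro sum_nonneg mult_nonneg_nonneg) auto

lemma avg_cong: "(\<And>\<alpha>. \<alpha> \<in> set_pmf (\<delta> X) \<Longrightarrow> f \<alpha> = g \<alpha>) \<Longrightarrow> avg \<delta> X f = avg \<delta> X g"
  unfolding avg_def by (intro sum.cong) auto

section \<open>Survival probabilities and dependence paths\<close>

locale pbpa =
  fixes \<Gamma> :: "'a set" and \<delta> :: "'a \<Rightarrow> 'a list pmf"
  assumes pBPA: "pBPA \<Gamma> \<delta>"
begin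

abbreviation pm :: real where "pm \<equiv> p_min \<Gamma> \<delta>"

lemma finite_\<Gamma>: "finite \<Gamma>"
  using pBPA by (simp add: pBPA_def)

lemma rhs_lists: "X \<in> \<Gamma> \<Longrightarrow> \<alpha> \<in> set_pmf (\<delta> X) \<Longrightarrow> \<alpha> \<in> lists \<Gamma>"
  using pBPA unfolding pBPA_def by blast

lemma rhs_length: "X \<in> \<Gamma> \<Longrightarrow> \<alpha> \<in> set_pmf (\<delta> X) \<Longrightarrow> length \<alpha> \<le> 2"
  using pBPA unfolding pBPA_def by blast

lemma rhs_cases:
  assumes "X \<in> \<Gamma>" "\<alpha> \<in> set_pmf (\<delta> X)"
  obtains "\<alpha> = []" | Y where "Y \<in> \<Gamma>" "\<alpha> = [Y]" | Y Z where "Y \<in> \<Gamma>" "Z \<in> \<Gamma>" "\<alpha> = [Y, Z]"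
proof (cases \<alpha>)
  case (Cons Y \<beta>)
  then show ?thesis using that rhs_lists[OF assms] rhs_length[OF assms]
    by (cases \<beta>) auto
qed (use that in blast)

lemma finite_rhs: "X \<in> \<Gamma> \<Longrightarrow> finite (set_pmf (\<delta> X))"
  by (rule finite_subset[OF _ finite_lists_length_le[OF finite_\<Gamma>, of 2]])
    (use rhs_lists rhs_length in \<open>auto simp: subset_iff\<close>)

lemma sum_pmf_rhs: "X \<in> \<Gamma> \<Longrightarrow> (\<Sum>\<alpha>\<in>set_pmf (\<delta> X). pmf (\<delta> X) \<alpha>) = 1"
  by (rule sum_pmf_eq_1) (auto simp: finite_rhs)

lemma avg_const: "X \<in> \<Gamma> \<Longrightarrow> avg \<delta> X (\<lambda>_. c) = c"
  by (simp add: avg_def sum_pmf_rhs flip: sum_distrib_right)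

lemma avg_le_const: "X \<in> \<Gamma> \<Longrightarrow> (\<And>\<alpha>. \<alpha> \<in> set_pmf (\<delta> X) \<Longrightarrow> f \<alpha> \<le> c) \<Longrightarrow> avg \<delta> X f \<le> c"
  using avg_mono[of \<delta> X f "\<lambda>_. c"] by (simp add: avg_const)

lemma avg_ge_const: "X \<in> \<Gamma> \<Longrightarrow> (\<And>\<alpha>. \<alpha> \<in> set_pmf (\<delta> X) \<Longrightarrow> c \<le> f \<alpha>) \<Longrightarrow> c \<le> avg \<delta> X f"
  using avg_mono[of \<delta> X "\<lambda>_. c" f] by (simp add: avg_const)

lemma avg_ge_single:
  assumes "X \<in> \<Gamma>" "\<alpha> \<in> set_pmf (\<delta> X)" "\<And>\<beta>. \<beta> \<in> set_pmf (\<delta> X) \<Longrightarrow> 0 \<le> f \<beta>"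
  shows "pmf (\<delta> X) \<alpha> * f \<alpha> \<le> avg \<delta> X f"
  unfolding avg_def
  by (rule member_le_sum) (use assms finite_rhs in auto)

lemma finite_rules: "finite (rules \<Gamma> \<delta>)"
proof -
  have "rules \<Gamma> \<delta> = (SIGMA X:\<Gamma>. set_pmf (\<delta> X))"
    by (auto simp: rules_def)
  then show ?thesis
    using finite_\<Gamma> finite_rhs by auto
qed

lemma pm_le:
  assumes "X \<in> \<Gamma>" "\<alpha> \<in> set_pmf (\<delta> X)"
  shows "pm \<le> pmf (\<delta> X) \<alpha>"
proof -
  have "pmf (\<delta> X) \<alpha> \<in> (\<lambda>(X, \<alpha>). pmf (\<delta> X) \<alpha>) ` rules \<Gamma> \<delta>"
    using assms by (auto simp: rules_def)
  then show ?thesis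
    unfolding p_min_def by (rule Min_le[rotated]) (simp add: finite_rules)
qed

lemma pm_le_1:
  assumes "X \<in> \<Gamma>"
  shows "pm \<le> 1"
proof -
  obtain \<alpha> where "\<alpha> \<in> set_pmf (\<delta> X)"
    using set_pmf_not_empty[of "\<delta> X"] by auto
  then have "pm \<le> pmf (\<delta> X) \<alpha>"
    by (rule pm_le[OF assms])
  also have "\<dots> \<le> 1"
    by (rule pmf_le_1)
  finally show ?thesis .
qed

lemma pm_pos:
  assumes "X \<in> \<Gamma>"
  shows "0 < pm"
proof -
  obtain \<alpha> where "\<alpha> \<in> set_pmf (\<delta> X)"
    using set_pmf_not_empty[of "\<delta> X"] by auto
  with assms have "rules \<Gamma> \<delta> \<noteq> {}"
    by (auto simp: rules_def)
  then have "pm \<in> (\<lambda>(X, \<alpha>). pmf (\<delta> X) \<alpha>) ` rules \<Gamma> \<delta>"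
    unfolding p_min_def by (intro Min_in) (auto simp: finite_rules)
  then show ?thesis
    by (auto simp: rules_def pmf_positive)
qed

lemma avg_ge_pm:
  assumes "X \<in> \<Gamma>" "\<alpha> \<in> set_pmf (\<delta> X)" "\<And>\<beta>. \<beta> \<in> set_pmf (\<delta> X) \<Longrightarrow> 0 \<le> f \<beta>"
  shows "pm * f \<alpha> \<le> avg \<delta> X f"
proof -
  have "pm * f \<alpha> \<le> pmf (\<delta> X) \<alpha> * f \<alpha>"
    using assms by (intro mult_right_mono pm_le) auto
  also have "\<dots> \<le> avg \<delta> X f"
    using assms by (rule avg_ge_single)
  finally show ?thesis .
qed

lemma surv_nonneg: "0 \<le> surv \<delta> n \<alpha>"
  by (induction \<delta> n \<alpha> rule: surv.induct) (auto intro: avg_nonneg)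

lemma app_lists: "X \<in> \<Gamma> \<Longrightarrow> \<alpha> \<in> set_pmf (\<delta> X) \<Longrightarrow> \<beta> \<in> lists \<Gamma> \<Longrightarrow> \<alpha> @ \<beta> \<in> lists \<Gamma>"
  using rhs_lists by simp

lemma surv_le_1: "\<alpha> \<in> lists \<Gamma> \<Longrightarrow> surv \<delta> n \<alpha> \<le> 1"
proof (induction n arbitrary: \<alpha>)
  case (Suc n)
  show ?case
  proof (cases \<alpha>)
    case (Cons X \<beta>)
    with Suc.prems have "avg \<delta> X (\<lambda>\<alpha>. surv \<delta> n (\<alpha> @ \<beta>)) \<le> 1"
      by (intro avg_le_const Suc.IH app_lists) auto
    with Cons show ?thesis by simp
  qed simp
qed simp

lemma surv_Suc_le: "\<alpha> \<in> lists \<Gamma> \<Longrightarrow> surv \<delta> (Suc n) \<alpha> \<le> surv \<delta> n \<alpha>"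
proof (induction n arbitrary: \<alpha>)
  case 0
  then show ?case
    using surv_le_1[of \<alpha> "Suc 0"] by (cases "\<alpha> = []") auto
next
  case (Suc n)
  show ?case
  proof (cases \<alpha>)
    case (Cons X \<beta>)
    with Suc.prems have "avg \<delta> X (\<lambda>\<alpha>. surv \<delta> (Suc n) (\<alpha> @ \<beta>)) \<le> avg \<delta> X (\<lambda>\<alpha>. surv \<delta> n (\<alpha> @ \<beta>))"
      by (intro avg_mono Suc.IH app_lists) auto
    with Cons show ?thesis by simp
  qed simp
qed

lemma surv_antimono: "\<alpha> \<in> lists \<Gamma> \<Longrightarrow> m \<le> n \<Longrightarrow> surv \<delta> n \<alpha> \<le> surv \<delta> m \<alpha>"
  by (rule lift_Suc_antimono_le[of "\<lambda>n. surv \<delta> n \<alpha>"]) (auto intro: surv_Suc_le)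

lemma surv_append_left:
  "\<alpha> \<in> lists \<Gamma> \<Longrightarrow> \<beta> \<in> lists \<Gamma> \<Longrightarrow> surv \<delta> n \<alpha> \<le> surv \<delta> n (\<alpha> @ \<beta>)"
proof (induction n arbitrary: \<alpha>)
  case (Suc n)
  show ?case
  proof (cases \<alpha>)
    case Nil
    then show ?thesis using surv_nonneg by simp
  next
    case (Cons X \<alpha>')
    have "avg \<delta> X (\<lambda>\<gamma>. surv \<delta> n (\<gamma> @ \<alpha>')) \<le> avg \<delta> X (\<lambda>\<gamma>. surv \<delta> n ((\<gamma> @ \<alpha>') @ \<beta>))"
      using Suc.prems Cons by (intro avg_mono Suc.IH app_lists) auto
    then show ?thesis using Cons by simp
  qed
qed simp

lemma surv_append_right:
  "\<alpha> \<in> lists \<Gamma> \<Longrightarrow> \<beta> \<in> lists \<Gamma> \<Longrightarrow> surv \<delta> n \<beta> \<le> surv \<delta> n (\<alpha> @ \<beta>)"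
proof (induction n arbitrary: \<alpha>)
  case (Suc n)
  show ?case
  proof (cases \<alpha>)
    case (Cons X \<alpha>')
    with Suc.prems have X: "X \<in> \<Gamma>" and \<alpha>': "\<alpha>' \<in> lists \<Gamma>" by auto
    \<comment> \<open>The step is spent on \<open>X\<close>, so \<open>\<beta>\<close> has only
      \<open>n\<close> steps left to survive.\<close>
    have "surv \<delta> (Suc n) \<beta> \<le> surv \<delta> n \<beta>"
      using Suc.prems by (intro surv_Suc_le)
    also have "\<dots> \<le> avg \<delta> X (\<lambda>\<gamma>. surv \<delta> n ((\<gamma> @ \<alpha>') @ \<beta>))"
      using X \<alpha>' Suc.prems by (intro avg_ge_const Suc.IH app_lists) auto
    finally show ?thesis using Cons by simp
  qed simp
qed auto

lemma surv_ge_mem: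
  assumes "\<alpha> \<in> lists \<Gamma>" "Y \<in> set \<alpha>"
  shows "surv \<delta> n [Y] \<le> surv \<delta> n \<alpha>"
proof -
  obtain \<alpha>1 \<alpha>2 where \<alpha>: "\<alpha> = \<alpha>1 @ Y # \<alpha>2"
    using assms(2) by (meson split_list)
  have "surv \<delta> n [Y] \<le> surv \<delta> n ([Y] @ \<alpha>2)"
    using assms \<alpha> by (intro surv_append_left) auto
  also have "\<dots> \<le> surv \<delta> n (\<alpha>1 @ [Y] @ \<alpha>2)"
    using assms \<alpha> by (intro surv_append_right) auto
  finally show ?thesis using \<alpha> by simp
qed

text \<open>Union bound: if the sum of two termination times exceeds \<open>m + n\<close>, the first
  exceeds \<open>m\<close> or the second exceeds \<open>n\<close>.\<close>

lemma surv_append_le: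
  "\<alpha> \<in> lists \<Gamma> \<Longrightarrow> \<beta> \<in> lists \<Gamma> \<Longrightarrow> surv \<delta> (m + n) (\<alpha> @ \<beta>) \<le> surv \<delta> m \<alpha> + surv \<delta> n \<beta>"
proof (induction m arbitrary: \<alpha>)
  case 0
  then show ?case
    using surv_le_1[of "\<alpha> @ \<beta>" n] surv_nonneg[of n \<beta>] by (cases "\<alpha> = []") auto
next
  case (Suc m)
  show ?case
  proof (cases \<alpha>)
    case Nil
    then show ?thesis using Suc.prems surv_antimono[of \<beta> n "Suc (m + n)"] by simp
  next
    case (Cons X \<alpha>')
    with Suc.prems have X: "X \<in> \<Gamma>" by simp
    have "avg \<delta> X (\<lambda>\<gamma>. surv \<delta> (m + n) ((\<gamma> @ \<alpha>') @ \<beta>))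
        \<le> avg \<delta> X (\<lambda>\<gamma>. surv \<delta> m (\<gamma> @ \<alpha>') + surv \<delta> n \<beta>)"
      using Suc.prems Cons by (intro avg_mono Suc.IH app_lists) auto
    then show ?thesis
      using Cons X by (simp add: avg_add avg_const)
  qed
qed

lemma direct_dep_\<Gamma>: "(X, Y) \<in> direct_dep \<Gamma> \<delta> \<Longrightarrow> X \<in> \<Gamma> \<and> Y \<in> \<Gamma>"
  using rhs_lists[of X] unfolding direct_dep_def rules_def in_lists_conv_set by blast

lemma surv_direct_dep:
  assumes "(X, Y) \<in> direct_dep \<Gamma> \<delta>"
  shows "pm * surv \<delta> n [Y] \<le> surv \<delta> (Suc n) [X]"
proof -
  obtain \<alpha> where X: "X \<in> \<Gamma>" and \<alpha>: "\<alpha> \<in> set_pmf (\<delta> X)" "Y \<in> set \<alpha>"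
    using assms by (auto simp: direct_dep_def rules_def)
  have "pm * surv \<delta> n [Y] \<le> pm * surv \<delta> n \<alpha>"
    using X \<alpha> rhs_lists pm_pos[OF X] by (intro mult_left_mono surv_ge_mem) auto
  also have "\<dots> \<le> avg \<delta> X (surv \<delta> n)"
    using X \<alpha> by (intro avg_ge_pm surv_nonneg) auto
  finally show ?thesis by simp
qed

text \<open>Each edge of the path takes one step and is followed with probability at least
  \<open>pm\<close>; the rest of the stack can only delay termination.\<close>

lemma surv_relpow:
  assumes "(X, Y) \<in> direct_dep \<Gamma> \<delta> ^^ k"
  shows "pm ^ k * surv \<delta> n [Y] \<le> surv \<delta> (k + n) [X]"
  using assms
proof (induction k arbitrary: X)
  case (Suc k)
  then obtain Z where Z: "(X, Z) \<in> direct_dep \<Gamma> \<delta>" "(Z, Y) \<in> direct_dep \<Gamma> \<delta> ^^ k"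
    by (meson relpow_Suc_E2)
  have "pm * (pm ^ k * surv \<delta> n [Y]) \<le> pm * surv \<delta> (k + n) [Z]"
    using Suc.IH[OF Z(2)] pm_pos[of X] direct_dep_\<Gamma>[OF Z(1)] by (intro mult_left_mono) auto
  also have "\<dots> \<le> surv \<delta> (Suc (k + n)) [X]"
    using Z(1) by (rule surv_direct_dep)
  finally show ?case by (simp add: mult.assoc)
qed auto

text \<open>The termination time is the number of nodes of a derivation tree. Without paths of
  \<open>k\<close> edges this tree is binary with at most \<open>k\<close> levels, hence has at most
  \<open>2 ^ k - 1\<close> nodes.\<close>

lemma surv_eq_0_no_path:
  assumes "X \<in> \<Gamma>" "\<And>Y. (X, Y) \<notin> direct_dep \<Gamma> \<delta> ^^ k"
  shows "surv \<delta> (2 ^ k - 1) [X] = 0"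
  using assms
proof (induction k arbitrary: X)
  case 0
  then show ?case by auto
next
  case (Suc k)
  define m :: nat where "m = 2 ^ k - 1"
  have m: "2 ^ Suc k - 1 = Suc (m + m)"
  proof -
    have "(1::nat) \<le> 2 ^ k" by simp
    then show ?thesis
      unfolding m_def power_Suc mult_2 by linarith
  qed
  have IH: "surv \<delta> m [Y] = 0" if "\<alpha> \<in> set_pmf (\<delta> X)" "Y \<in> set \<alpha>" for \<alpha> Y
    unfolding m_def
  proof (rule Suc.IH)
    have XY: "(X, Y) \<in> direct_dep \<Gamma> \<delta>"
      using that Suc.prems(1) by (auto simp: direct_dep_def rules_def)
    then show "Y \<in> \<Gamma>"
      using direct_dep_\<Gamma> by blast
    show "(Y, Z) \<notin> direct_dep \<Gamma> \<delta> ^^ k" for Z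
      using XY Suc.prems(2)[of Z] by (meson relpow_Suc_I2)
  qed
  have "surv \<delta> (m + m) \<alpha> = 0" if \<alpha>: "\<alpha> \<in> set_pmf (\<delta> X)" for \<alpha>
    using Suc.prems(1) \<alpha>
  proof (cases rule: rhs_cases)
    case (2 Y)
    then have "surv \<delta> (m + m) \<alpha> \<le> surv \<delta> m [Y]"
      by (auto intro: surv_antimono)
    with IH[of \<alpha> Y] 2 \<alpha> show ?thesis
      using surv_nonneg[of "m + m" \<alpha>] by simp
  next
    case (3 Y Z)
    then have "surv \<delta> (m + m) ([Y] @ [Z]) \<le> surv \<delta> m [Y] + surv \<delta> m [Z]"
      by (intro surv_append_le) auto
    with IH[of \<alpha>] 3 \<alpha> show ?thesis
      using surv_nonneg[of "m + m" \<alpha>] by simp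
  qed simp
  then have "avg \<delta> X (surv \<delta> (m + m)) = 0"
    by (simp add: avg_def)
  then show ?case
    by (simp only: m surv.simps append_Nil2)
qed

text \<open>Pigeonhole: \<open>card \<Gamma>\<close> edges visit one symbol twice. The cycle between
  the two visits is repeated \<open>n\<close> times, and the resulting path is cut after
  \<open>n\<close> edges.\<close>

lemma long_path:
  assumes "X \<in> \<Gamma>" "(X, Y) \<in> direct_dep \<Gamma> \<delta> ^^ card \<Gamma>"
  shows "\<exists>Z. (X, Z) \<in> direct_dep \<Gamma> \<delta> ^^ n"
proof -
  let ?R = "direct_dep \<Gamma> \<delta>"
  obtain f where f: "f 0 = X" "\<And>i. i < card \<Gamma> \<Longrightarrow> (f i, f (Suc i)) \<in> ?R"
    using assms(2) unfolding relpow_fun_conv by blast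
  have "f i \<in> \<Gamma>" if "i \<le> card \<Gamma>" for i
    using that f assms(1) direct_dep_\<Gamma> by (cases i) (auto dest: Suc_le_lessD)
  then have "f ` {..card \<Gamma>} \<subseteq> \<Gamma>"
    by auto
  then have "card (f ` {..card \<Gamma>}) \<le> card \<Gamma>"
    by (intro card_mono finite_\<Gamma>)
  then have "\<not> inj_on f {..card \<Gamma>}"
    using card_image[of f "{..card \<Gamma>}"] by auto
  then obtain i j where ij: "i < j" "j \<le> card \<Gamma>" "f i = f j"
    unfolding inj_on_def by (metis atMost_iff linorder_neqE_nat)
  have seg: "(f a, f (a + b)) \<in> ?R ^^ b" if "a + b \<le> card \<Gamma>" for a b
    using that by (auto simp: relpow_fun_conv intro!: exI[of _ "\<lambda>i. f (a + i)"] f(2))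
  have "(f i, f i) \<in> ?R ^^ ((j - i) * k)" for k
  proof (induction k)
    case (Suc k)
    have "(f i, f i) \<in> ?R ^^ (j - i)"
      using seg[of i "j - i"] ij by simp
    with Suc show ?case
      by (auto simp: relpow_add)
  qed simp
  moreover have "(X, f i) \<in> ?R ^^ i"
    using seg[of 0 i] ij f(1) by simp
  ultimately have "(X, f i) \<in> ?R ^^ (i + (j - i) * n)"
    by (auto simp: relpow_add)
  moreover have "n \<le> i + (j - i) * n"
  proof -
    have "1 * n \<le> (j - i) * n"
      using ij(1) by (intro mult_right_mono) auto
    then show ?thesis by linarith
  qed
  ultimately have "(X, f i) \<in> ?R ^^ (n + (i + (j - i) * n - n))"
    by simp
  then show ?thesis
    unfolding relpow_add by blast
qed

lemma surv_ge_power: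
  assumes "X \<in> \<Gamma>" "surv \<delta> (2 ^ card \<Gamma> - 1) [X] \<noteq> 0"
  shows "pm ^ n \<le> surv \<delta> n [X]"
proof -
  obtain Y where "(X, Y) \<in> direct_dep \<Gamma> \<delta> ^^ card \<Gamma>"
    using surv_eq_0_no_path[OF assms(1), of "card \<Gamma>"] assms(2) by metis
  then obtain Z where "(X, Z) \<in> direct_dep \<Gamma> \<delta> ^^ n"
    using long_path[OF assms(1), of Y n] by metis
  from surv_relpow[OF this, of 0] show ?thesis
    by simp
qed

end

section \<open>Survival probabilities and the run measure\<close>

fun paths :: "('a \<Rightarrow> 'a list pmf) \<Rightarrow> nat \<Rightarrow> 'a list \<Rightarrow> 'a list list set" where
  "paths \<delta> 0 \<alpha> = {[\<alpha>]}"
| "paths \<delta> (Suc n) \<alpha> = (\<Union>\<beta>\<in>set_pmf (step \<delta> \<alpha>). (#) \<alpha> ` paths \<delta> n \<beta>)"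

definition path_weight :: "('a \<Rightarrow> 'a list pmf) \<Rightarrow> 'a list list \<Rightarrow> real" where
  "path_weight \<delta> xs = (\<Prod>i<length xs - 1. pmf (step \<delta> (xs ! i)) (xs ! Suc i))"

lemma length_paths: "xs \<in> paths \<delta> n \<alpha> \<Longrightarrow> length xs = Suc n"
  by (induction n arbitrary: \<alpha> xs) auto

lemma paths_hd: "xs \<in> paths \<delta> n \<alpha> \<Longrightarrow> xs ! 0 = \<alpha>"
  by (cases n) auto

lemma path_weight_Cons:
  assumes "xs \<in> paths \<delta> n \<beta>"
  shows "path_weight \<delta> (\<alpha> # xs) = pmf (step \<delta> \<alpha>) \<beta> * path_weight \<delta> xs"
  using length_paths[OF assms] paths_hd[OF assms]
  by (simp add: path_weight_def prod.lessThan_Suc_shift del: prod.lessThan_Suc)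

text \<open>The whole space is the cylinder over the empty index set, so the projective limit
  formula gives its mass.\<close>

lemma prob_space_run_measure: "prob_space (run_measure \<delta> \<alpha>)"
proof
  let ?M = "\<lambda>_::nat. count_space (UNIV :: 'a list set)"
  have "emeasure (run_measure \<delta> \<alpha>) (prod_emb UNIV ?M {} (space (PiM {} ?M)))
      = emeasure (chain.CI \<delta> \<alpha> {}) (space (PiM {} ?M))"
    unfolding run_measure_def by (rule chain.lim) auto
  also have "space (PiM {} ?M) = space (chain.CI \<delta> \<alpha> {})"
    by (simp add: chain.PF.space_P)
  also have "emeasure (chain.CI \<delta> \<alpha> {}) \<dots> = 1"
    by (intro prob_space.emeasure_space_1 chain.PF.prob_space_P) auto
  also have "prod_emb UNIV ?M {} (space (chain.CI \<delta> \<alpha> {})) = space (run_measure \<delta> \<alpha>)"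
    by (auto simp: prod_emb_def space_PiM space_run_measure chain.PF.space_P)
  finally show "emeasure (run_measure \<delta> \<alpha>) (space (run_measure \<delta> \<alpha>)) = 1" .
qed

lemma measurable_run [measurable]: "(\<lambda>w. w i) \<in> run_measure \<delta> \<alpha> \<rightarrow>\<^sub>M count_space UNIV"
  unfolding measurable_cong_sets[OF sets_run_measure refl]
  by (rule measurable_component_singleton) simp

lemma le_term_time_iff: "enat n \<le> term_time w \<longleftrightarrow> (\<forall>k<n. w k \<noteq> [])"
proof (cases "\<exists>n. w n = []")
  case True
  let ?m = "LEAST n. w n = []"
  have "w k \<noteq> []" if "n \<le> ?m" "k < n" for k
    using not_less_Least[of k "\<lambda>n. w n = []"] that by linarith
  moreover have "n \<le> ?m" if "\<forall>k<n. w k \<noteq> []"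
  proof (rule ccontr)
    assume "\<not> n \<le> ?m"
    then have "w ?m \<noteq> []" by (intro that[rule_format]) (simp only: not_le)
    with LeastI_ex[OF True] show False by contradiction
  qed
  moreover have "term_time w = enat ?m"
    unfolding term_time_def using True by (rule if_P)
  ultimately show ?thesis
    by (metis enat_ord_simps(1))
qed (simp add: term_time_def)

lemma measurable_term_time [measurable]: "term_time \<in> run_measure \<delta> \<alpha> \<rightarrow>\<^sub>M count_space UNIV"
  unfolding term_time_def by measurable

lemma sets_le_term_time: "{w. enat n \<le> term_time w} \<in> sets (run_measure \<delta> \<alpha>)"
proof -
  have "{w \<in> space (run_measure \<delta> \<alpha>). enat n \<le> term_time w} \<in> sets (run_measure \<delta> \<alpha>)"
    by measurable
  then show ?thesis by (simp add: space_run_measure)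
qed

context pbpa
begin

lemma finite_step: "\<alpha> \<in> lists \<Gamma> \<Longrightarrow> finite (set_pmf (step \<delta> \<alpha>))"
  by (cases \<alpha>) (auto simp: finite_rhs)

lemma step_lists: "\<alpha> \<in> lists \<Gamma> \<Longrightarrow> \<beta> \<in> set_pmf (step \<delta> \<alpha>) \<Longrightarrow> \<beta> \<in> lists \<Gamma>"
proof (cases \<alpha>)
  case (Cons X \<gamma>)
  assume "\<alpha> \<in> lists \<Gamma>" "\<beta> \<in> set_pmf (step \<delta> \<alpha>)"
  with Cons obtain \<alpha>' where "\<alpha>' \<in> set_pmf (\<delta> X)" "\<beta> = \<alpha>' @ \<gamma>" "X \<in> \<Gamma>" "\<gamma> \<in> lists \<Gamma>"
    by auto
  then show ?thesis
    using app_lists[of X \<alpha>' \<gamma>] by simp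
qed auto

lemma finite_paths: "\<alpha> \<in> lists \<Gamma> \<Longrightarrow> finite (paths \<delta> n \<alpha>)"
proof (induction n arbitrary: \<alpha>)
  case (Suc n)
  then show ?case
    using finite_step step_lists[OF Suc.prems] by auto
qed simp

lemma sum_paths_Suc:
  assumes "\<alpha> \<in> lists \<Gamma>"
  shows "(\<Sum>xs\<in>paths \<delta> (Suc n) \<alpha>. f xs) =
    (\<Sum>\<beta>\<in>set_pmf (step \<delta> \<alpha>). \<Sum>xs\<in>paths \<delta> n \<beta>. f (\<alpha> # xs))"
proof -
  have fin: "finite (paths \<delta> n \<beta>)" if "\<beta> \<in> set_pmf (step \<delta> \<alpha>)" for \<beta>
    using that assms step_lists finite_paths by blast
  have "(\<Sum>xs\<in>paths \<delta> (Suc n) \<alpha>. f xs) =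
      (\<Sum>\<beta>\<in>set_pmf (step \<delta> \<alpha>). sum f ((#) \<alpha> ` paths \<delta> n \<beta>))"
    unfolding paths.simps
  proof (rule sum.UNION_disjoint)
    show "\<forall>\<beta>\<in>set_pmf (step \<delta> \<alpha>). \<forall>\<beta>'\<in>set_pmf (step \<delta> \<alpha>). \<beta> \<noteq> \<beta>' \<longrightarrow>
        (#) \<alpha> ` paths \<delta> n \<beta> \<inter> (#) \<alpha> ` paths \<delta> n \<beta>' = {}"
      by (auto dest: paths_hd)
  qed (use assms finite_step fin in auto)
  then show ?thesis
    by (simp add: sum.reindex)
qed

lemma sum_path_weight: "\<alpha> \<in> lists \<Gamma> \<Longrightarrow> (\<Sum>xs\<in>paths \<delta> n \<alpha>. path_weight \<delta> xs) = 1"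
proof (induction n arbitrary: \<alpha>)
  case 0
  then show ?case by (simp add: path_weight_def)
next
  case (Suc n)
  have "(\<Sum>xs\<in>paths \<delta> (Suc n) \<alpha>. path_weight \<delta> xs) =
      (\<Sum>\<beta>\<in>set_pmf (step \<delta> \<alpha>). pmf (step \<delta> \<alpha>) \<beta> * (\<Sum>xs\<in>paths \<delta> n \<beta>. path_weight \<delta> xs))"
    by (simp add: sum_paths_Suc[OF Suc.prems] path_weight_Cons sum_distrib_left del: paths.simps)
  also have "\<dots> = (\<Sum>\<beta>\<in>set_pmf (step \<delta> \<alpha>). pmf (step \<delta> \<alpha>) \<beta>)"
    using Suc.IH step_lists[OF Suc.prems] by simp
  also have "\<dots> = 1"
    using finite_step[OF Suc.prems] by (intro sum_pmf_eq_1) auto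
  finally show ?case .
qed

text \<open>Appending the fixed rest \<open>\<gamma>\<close> is injective, so distinct right-hand
  sides are not merged by \<open>map_pmf\<close>.\<close>

lemma sum_step_Cons:
  "(\<Sum>\<beta>\<in>set_pmf (step \<delta> (X # \<gamma>)). pmf (step \<delta> (X # \<gamma>)) \<beta> * f \<beta>) = avg \<delta> X (\<lambda>\<alpha>. f (\<alpha> @ \<gamma>))"
proof -
  have inj: "inj (\<lambda>\<alpha>. \<alpha> @ \<gamma>)"
    by (simp add: inj_def)
  show ?thesis
    by (simp add: avg_def sum.reindex[OF inj_on_subset[OF inj]] pmf_map_inj'[OF inj])
qed

lemma sum_alive_path_weight:
  "\<alpha> \<in> lists \<Gamma> \<Longrightarrow>
    (\<Sum>xs\<in>paths \<delta> n \<alpha>. if [] \<in> set xs then 0 else path_weight \<delta> xs) = surv \<delta> n \<alpha>"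
proof (induction n arbitrary: \<alpha>)
  case 0
  then show ?case by (simp add: path_weight_def)
next
  case (Suc n)
  show ?case
  proof (cases \<alpha>)
    case Nil
    have "[] \<in> set xs" if "xs \<in> paths \<delta> (Suc n) \<alpha>" for xs
      using that Nil by auto
    then show ?thesis
      unfolding Nil by (intro trans[OF sum.neutral]) auto
  next
    case (Cons X \<gamma>)
    have "(\<Sum>xs\<in>paths \<delta> (Suc n) \<alpha>. if [] \<in> set xs then 0 else path_weight \<delta> xs) =
        (\<Sum>\<beta>\<in>set_pmf (step \<delta> \<alpha>). \<Sum>xs\<in>paths \<delta> n \<beta>.
           pmf (step \<delta> \<alpha>) \<beta> * (if [] \<in> set xs then 0 else path_weight \<delta> xs))"
      unfolding sum_paths_Suc[OF Suc.prems]
      using Cons by (intro sum.cong refl) (auto simp: path_weight_Cons simp del: paths.simps step.simps)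
    also have "\<dots> = (\<Sum>\<beta>\<in>set_pmf (step \<delta> \<alpha>). pmf (step \<delta> \<alpha>) \<beta> * surv \<delta> n \<beta>)"
      using Suc.IH step_lists[OF Suc.prems] by (simp flip: sum_distrib_left)
    also have "\<dots> = surv \<delta> (Suc n) \<alpha>"
      unfolding Cons sum_step_Cons by simp
    finally show ?thesis .
  qed
qed

text \<open>The finitely many cylinders of paths with positive weight are disjoint. Those avoiding
  \<open>[]\<close> bound the event from below, the others its complement; the weights add up to 1,
  so both bounds are equalities and sequences that are no paths need no separate treatment.\<close>

lemma measure_alive:
  assumes \<alpha>: "\<alpha> \<in> lists \<Gamma>"
  shows "measure (run_measure \<delta> \<alpha>) {w. \<forall>k<Suc n. w k \<noteq> []} = surv \<delta> n \<alpha>"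
proof -
  interpret prob_space "run_measure \<delta> \<alpha>"
    by (rule prob_space_run_measure)
  let ?A = "{w. \<forall>k<Suc n. w k \<noteq> []}"
  define cyl where "cyl xs = {w. \<forall>i\<le>n. w i = xs ! i}" for xs :: "'a list list"
  have A_sets: "?A \<in> events"
    using sets_le_term_time[of "Suc n" \<delta> \<alpha>] by (simp add: le_term_time_iff)
  have cyl_sets: "cyl xs \<in> events" for xs
  proof -
    have "{w \<in> space (run_measure \<delta> \<alpha>). \<forall>i\<le>n. w i = xs ! i} \<in> events"
      by measurable
    then show ?thesis by (simp add: cyl_def space_run_measure)
  qed
  have weight: "prob (cyl xs) = path_weight \<delta> xs" if "xs \<in> paths \<delta> n \<alpha>" for xs
    using emeasure_run_measure_cylinder[of \<delta> \<alpha> n "\<lambda>i. xs ! i"] paths_hd[OF that] length_paths[OF that]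
    by (simp add: cyl_def path_weight_def measure_def prod_nonneg)
  have disj: "disjoint_family_on cyl P" if "P \<subseteq> paths \<delta> n \<alpha>" for P
  proof -
    have "xs = ys" if "xs \<in> paths \<delta> n \<alpha>" "ys \<in> paths \<delta> n \<alpha>" "w \<in> cyl xs" "w \<in> cyl ys" for xs ys w
      using that by (intro nth_equalityI) (auto simp: cyl_def length_paths)
    then show ?thesis
      using that unfolding disjoint_family_on_def by blast
  qed
  have sub: "sum (path_weight \<delta>) P \<le> prob B"
    if "P \<subseteq> paths \<delta> n \<alpha>" "B \<in> events" "\<And>xs. xs \<in> P \<Longrightarrow> cyl xs \<subseteq> B" for P B
  proof -
    have "finite P"
      using that(1) finite_paths[OF \<alpha>] finite_subset by blast
    then have "prob (\<Union>xs\<in>P. cyl xs) = (\<Sum>xs\<in>P. prob (cyl xs))"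
      using cyl_sets disj[OF that(1)] by (intro finite_measure_finite_Union) auto
    also have "\<dots> = sum (path_weight \<delta>) P"
      using that(1) weight by (intro sum.cong) auto
    finally show ?thesis
      using finite_measure_mono[of "\<Union>xs\<in>P. cyl xs" B] that(2,3) by auto
  qed
  have fin: "finite (paths \<delta> n \<alpha>)"
    by (rule finite_paths[OF \<alpha>])
  let ?P = "paths \<delta> n \<alpha> \<inter> {xs. [] \<notin> set xs}" and ?Q = "paths \<delta> n \<alpha> \<inter> {xs. [] \<in> set xs}"
  have P: "sum (path_weight \<delta>) ?P = surv \<delta> n \<alpha>"
    unfolding sum_alive_path_weight[OF \<alpha>, of n, symmetric] sum.inter_restrict[OF fin]
    by (intro sum.cong) auto
  have "sum (path_weight \<delta>) (?P \<union> ?Q) = sum (path_weight \<delta>) ?P + sum (path_weight \<delta>) ?Q"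
    using fin by (intro sum.union_disjoint) auto
  moreover have "?P \<union> ?Q = paths \<delta> n \<alpha>"
    by auto
  ultimately have Q: "sum (path_weight \<delta>) ?Q = 1 - surv \<delta> n \<alpha>"
    using P sum_path_weight[OF \<alpha>, of n] by simp
  have "sum (path_weight \<delta>) ?P \<le> prob ?A"
  proof (rule sub)
    fix xs assume "xs \<in> ?P"
    then show "cyl xs \<subseteq> ?A"
      using length_paths[of xs \<delta> n \<alpha>] by (auto simp: cyl_def in_set_conv_nth less_Suc_eq_le)
  qed (use A_sets in auto)
  moreover have "sum (path_weight \<delta>) ?Q \<le> prob (space (run_measure \<delta> \<alpha>) - ?A)"
  proof (rule sub)
    fix xs assume "xs \<in> ?Q"
    then show "cyl xs \<subseteq> space (run_measure \<delta> \<alpha>) - ?A"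
      using length_paths[of xs \<delta> n \<alpha>]
      by (auto simp: cyl_def in_set_conv_nth less_Suc_eq_le space_run_measure)
  qed (use A_sets in auto)
  ultimately show ?thesis
    using P Q prob_compl[OF A_sets] by simp
qed

lemma prob_term_ge_Suc:
  "\<alpha> \<in> lists \<Gamma> \<Longrightarrow> prob_term_ge \<delta> \<alpha> (Suc n) = surv \<delta> n \<alpha>"
  unfolding prob_term_ge_def le_term_time_iff by (rule measure_alive)

lemma prob_term_ge_eq:
  assumes "\<alpha> \<in> lists \<Gamma>" "0 < n"
  shows "prob_term_ge \<delta> \<alpha> n = surv \<delta> (n - 1) \<alpha>"
  using prob_term_ge_Suc[OF assms(1), of "n - 1"] assms(2) by simp

lemma prob_term_ge_0: "prob_term_ge \<delta> \<alpha> 0 = 1"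
  using prob_space.prob_space[OF prob_space_run_measure]
  by (simp add: prob_term_ge_def le_term_time_iff space_run_measure)

lemma expected_time_eq:
  assumes "\<alpha> \<in> lists \<Gamma>"
  shows "expected_time \<delta> \<alpha> = (\<Sum>n. ennreal (surv \<delta> n \<alpha>))"
proof -
  interpret prob_space "run_measure \<delta> \<alpha>"
    by (rule prob_space_run_measure)
  have "expected_time \<delta> \<alpha> = (\<Sum>n. emeasure (run_measure \<delta> \<alpha>) {w. enat n < term_time w})"
    unfolding expected_time_def
    by (subst nn_integral_enat_function) (auto simp: space_run_measure)
  also have "\<dots> = (\<Sum>n. ennreal (surv \<delta> n \<alpha>))"
  proof (rule suminf_cong)
    fix n
    have "{w. enat n < term_time w} = {w. \<forall>k<Suc n. w k \<noteq> ([] :: 'a list)}"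
      by (simp add: Suc_ile_eq flip: le_term_time_iff)
    then show "emeasure (run_measure \<delta> \<alpha>) {w. enat n < term_time w} = ennreal (surv \<delta> n \<alpha>)"
      using measure_alive[OF assms, of n] by (simp only: emeasure_eq_measure)
  qed
  finally show ?thesis .
qed

text \<open>Continuity from above: the events T >= n decrease to T = infinity, a null event.\<close>

lemma surv_tendsto_0:
  assumes "as_terminating \<Gamma> \<delta>" "X \<in> \<Gamma>"
  shows "(\<lambda>n. surv \<delta> n [X]) \<longlonglongrightarrow> 0"
proof -
  interpret prob_space "run_measure \<delta> [X]"
    by (rule prob_space_run_measure)
  let ?A = "\<lambda>n. {w. enat n \<le> term_time w}"
  have A: "?A n \<in> events" for n
    by (rule sets_le_term_time)
  have T: "{w. term_time w < \<infinity>} \<in> events"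
  proof -
    have "{w \<in> space (run_measure \<delta> [X]). term_time w < \<infinity>} \<in> events"
      by measurable
    then show ?thesis by (simp add: space_run_measure)
  qed
  have "decseq ?A"
    unfolding decseq_def using order_trans enat_ord_simps(1) by blast
  then have "(\<lambda>n. prob (?A n)) \<longlonglongrightarrow> prob (\<Inter>n. ?A n)"
    using A by (intro finite_Lim_measure_decseq) auto
  moreover have "(\<Inter>n. ?A n) = space (run_measure \<delta> [X]) - {w. term_time w < \<infinity>}"
  proof -
    have "(\<forall>n. enat n \<le> t) \<longleftrightarrow> \<not> t < \<infinity>" for t
    proof (cases t)
      case (enat m)
      then have "\<not> enat (Suc m) \<le> t" by simp
      moreover have "t < \<infinity>" using enat by simp
      ultimately show ?thesis by blast
    qed simp
    then show ?thesis
      unfolding space_run_measure by blast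
  qed
  moreover have "prob (space (run_measure \<delta> [X]) - {w. term_time w < \<infinity>}) = 0"
    using assms prob_compl[OF T] unfolding as_terminating_def by simp
  ultimately have "(\<lambda>n. prob (?A n)) \<longlonglongrightarrow> 0"
    by simp
  then have "(\<lambda>n. prob (?A (Suc n))) \<longlonglongrightarrow> 0"
    by (rule LIMSEQ_Suc)
  moreover have "prob (?A (Suc n)) = surv \<delta> n [X]" for n
    using prob_term_ge_Suc[of "[X]" n] assms(2) unfolding prob_term_ge_def by simp
  ultimately show ?thesis by simp
qed

end

section \<open>Exponential martingale bounds\<close>

context pbpa
begin

lemma avg_eq_expectation: "X \<in> \<Gamma> \<Longrightarrow> measure_pmf.expectation (\<delta> X) f = avg \<delta> X f"
  unfolding avg_def by (subst integral_measure_pmf_real[OF finite_rhs]) (auto simp: mult.commute)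

lemma Hoeffding_avg:
  assumes "X \<in> \<Gamma>" "l > 0" "\<And>\<alpha>. \<alpha> \<in> set_pmf (\<delta> X) \<Longrightarrow> f \<alpha> \<in> {a..b}"
  shows "avg \<delta> X (\<lambda>\<alpha>. exp (l * f \<alpha>)) \<le> exp (l * avg \<delta> X f + l\<^sup>2 * (b - a)\<^sup>2 / 8)"
proof -
  interpret interval_bounded_random_variable "measure_pmf (\<delta> X)" f a b
    by unfold_locales (use assms in \<open>auto simp: AE_measure_pmf_iff\<close>)
  define \<mu> where "\<mu> = avg \<delta> X f"
  have int: "integrable (\<delta> X) (\<lambda>\<alpha>. exp (l * (f \<alpha> - \<mu>)))"
    by (intro integrable_measure_pmf_finite finite_rhs assms)
  have "(\<integral>\<^sup>+\<alpha>. ennreal (exp (l * (f \<alpha> - \<mu>))) \<partial>\<delta> X) \<le> ennreal (exp (l\<^sup>2 * (b - a)\<^sup>2 / 8))"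
    using Hoeffdings_lemma_nn_integral[OF assms(2)] avg_eq_expectation[OF assms(1)]
    by (simp add: \<mu>_def)
  also have "(\<integral>\<^sup>+\<alpha>. ennreal (exp (l * (f \<alpha> - \<mu>))) \<partial>\<delta> X)
      = ennreal (avg \<delta> X (\<lambda>\<alpha>. exp (l * (f \<alpha> - \<mu>))))"
    by (subst nn_integral_eq_integral[OF int]) (auto simp: avg_eq_expectation[OF assms(1)])
  finally have "avg \<delta> X (\<lambda>\<alpha>. exp (l * (f \<alpha> - \<mu>))) \<le> exp (l\<^sup>2 * (b - a)\<^sup>2 / 8)"
    by simp
  then have "exp (l * \<mu>) * avg \<delta> X (\<lambda>\<alpha>. exp (l * (f \<alpha> - \<mu>)))
      \<le> exp (l * \<mu>) * exp (l\<^sup>2 * (b - a)\<^sup>2 / 8)"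
    by (intro mult_left_mono) auto
  also have "exp (l * \<mu>) * avg \<delta> X (\<lambda>\<alpha>. exp (l * (f \<alpha> - \<mu>))) = avg \<delta> X (\<lambda>\<alpha>. exp (l * f \<alpha>))"
    unfolding avg_cmult[symmetric]
    by (intro avg_cong) (simp add: algebra_simps flip: exp_add)
  finally show ?thesis
    by (simp add: exp_add \<mu>_def)
qed

text \<open>One step ranges over an interval of width \<open>2 * M\<close>, which turns the exponent
  \<open>l\<^sup>2 * (b - a)\<^sup>2 / 8\<close> of Hoeffding's lemma into
  \<open>l\<^sup>2 * M\<^sup>2 / 2\<close>.\<close>

lemma rhs_sum_bounds:
  fixes u :: "'a \<Rightarrow> real"
  assumes "\<And>X. X \<in> \<Gamma> \<Longrightarrow> 0 \<le> u X" "\<And>X. X \<in> \<Gamma> \<Longrightarrow> u X \<le> M" "X \<in> \<Gamma>" "\<alpha> \<in> set_pmf (\<delta> X)"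
  shows "(\<Sum>Y\<leftarrow>\<alpha>. u Y) \<in> {0..2 * M}"
  using assms(3,4)
proof (cases rule: rhs_cases)
  case 1
  \<comment> \<open>The empty right-hand side needs \<open>0 \<le> M\<close>, which the two bounds
    at \<open>X\<close> imply.\<close>
  then show ?thesis
    using assms(1,2)[OF assms(3)] by simp
next
  case (2 Y)
  then show ?thesis
    using assms(1,2)[of Y] by simp
next
  case (3 Y Z)
  then show ?thesis
    using assms(1,2)[of Y] assms(1,2)[of Z] by simp
qed

text \<open>Chernoff bound: one step multiplies the mean of exp(l * total) by at most exp(- l + l^2
  M^2 / 2), while on survival the value is still at least 1.\<close>

lemma surv_exp_upper:
  fixes u :: "'a \<Rightarrow> real"
  assumes u: "\<And>X. X \<in> \<Gamma> \<Longrightarrow> 0 \<le> u X" "\<And>X. X \<in> \<Gamma> \<Longrightarrow> u X \<le> M"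
    and drift: "\<And>X. X \<in> \<Gamma> \<Longrightarrow> 1 + avg \<delta> X (\<lambda>\<alpha>. \<Sum>Y\<leftarrow>\<alpha>. u Y) \<le> u X"
    and l: "l > 0"
  shows "\<alpha> \<in> lists \<Gamma> \<Longrightarrow>
    surv \<delta> n \<alpha> \<le> exp (l * (\<Sum>Y\<leftarrow>\<alpha>. u Y) - real n * l + real n * (l\<^sup>2 * M\<^sup>2 / 2))"
proof (induction n arbitrary: \<alpha>)
  case 0
  have "0 \<le> (\<Sum>Y\<leftarrow>\<alpha>. u Y)"
    using 0 u(1) by (intro sum_list_nonneg) auto
  then show ?case
    using l by simp
next
  case (Suc n)
  let ?c = "l\<^sup>2 * M\<^sup>2 / 2"
  show ?case
  proof (cases \<alpha>)
    case (Cons X \<beta>)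
    with Suc.prems have X: "X \<in> \<Gamma>" by simp
    let ?K = "exp (l * (\<Sum>Y\<leftarrow>\<beta>. u Y) - real n * l + real n * ?c)"
    have "surv \<delta> (Suc n) \<alpha> \<le> avg \<delta> X (\<lambda>\<gamma>. exp (l * (\<Sum>Y\<leftarrow>\<gamma> @ \<beta>. u Y) - real n * l + real n * ?c))"
      unfolding Cons surv.simps using Cons Suc.prems by (intro avg_mono Suc.IH app_lists) auto
    also have "\<dots> = ?K * avg \<delta> X (\<lambda>\<gamma>. exp (l * (\<Sum>Y\<leftarrow>\<gamma>. u Y)))"
      unfolding avg_cmult[symmetric] by (intro avg_cong) (simp add: algebra_simps flip: exp_add)
    also have "\<dots> \<le> ?K * exp (l * avg \<delta> X (\<lambda>\<gamma>. \<Sum>Y\<leftarrow>\<gamma>. u Y) + l\<^sup>2 * (2 * M - 0)\<^sup>2 / 8)"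
      using rhs_sum_bounds[of u M X] u X l by (intro mult_left_mono Hoeffding_avg) auto
    also have "\<dots> \<le> ?K * exp (l * (u X - 1) + ?c)"
    proof -
      have "l * avg \<delta> X (\<lambda>\<gamma>. \<Sum>Y\<leftarrow>\<gamma>. u Y) \<le> l * (u X - 1)"
        using drift[OF X] l by (intro mult_left_mono) auto
      then show ?thesis
        by (intro mult_left_mono) (auto simp: power_mult_distrib mult.commute)
    qed
    also have "\<dots> = exp (l * (\<Sum>Y\<leftarrow>\<alpha>. u Y) - real (Suc n) * l + real (Suc n) * ?c)"
      unfolding Cons exp_add[symmetric] by (simp add: algebra_simps add_divide_distrib)
    finally show ?thesis .
  qed simp
qed

text \<open>The same bound for exp(- l * total): its mean grows by at most exp(l^2 M^2 / 2) per step
  and its value at termination is 1, so quick termination from a large total is unlikely.\<close>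

lemma surv_exp_lower:
  fixes u :: "'a \<Rightarrow> real"
  assumes u: "\<And>X. X \<in> \<Gamma> \<Longrightarrow> 0 \<le> u X" "\<And>X. X \<in> \<Gamma> \<Longrightarrow> u X \<le> M"
    and drift: "\<And>X. X \<in> \<Gamma> \<Longrightarrow> u X \<le> avg \<delta> X (\<lambda>\<alpha>. \<Sum>Y\<leftarrow>\<alpha>. u Y)"
    and l: "l > 0"
  shows "\<alpha> \<in> lists \<Gamma> \<Longrightarrow>
    1 - exp (real n * (l\<^sup>2 * M\<^sup>2 / 2) - l * (\<Sum>Y\<leftarrow>\<alpha>. u Y)) \<le> surv \<delta> n \<alpha>"
proof (induction n arbitrary: \<alpha>)
  case (Suc n)
  let ?c = "l\<^sup>2 * M\<^sup>2 / 2"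
  show ?case
  proof (cases \<alpha>)
    case (Cons X \<beta>)
    with Suc.prems have X: "X \<in> \<Gamma>" by simp
    let ?K = "exp (real n * ?c - l * (\<Sum>Y\<leftarrow>\<beta>. u Y))"
    let ?f = "\<lambda>\<gamma>. - (\<Sum>Y\<leftarrow>\<gamma>. u Y)"
    have neg: "avg \<delta> X ?f = - avg \<delta> X (\<lambda>\<gamma>. \<Sum>Y\<leftarrow>\<gamma>. u Y)"
      using avg_cmult[of \<delta> X "- 1" "\<lambda>\<gamma>. \<Sum>Y\<leftarrow>\<gamma>. u Y"] by simp
    have "?K * avg \<delta> X (\<lambda>\<gamma>. exp (l * ?f \<gamma>)) \<le> ?K * exp (l * avg \<delta> X ?f + l\<^sup>2 * (0 - (- 2 * M))\<^sup>2 / 8)"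
      using rhs_sum_bounds[of u M X] u X l by (intro mult_left_mono Hoeffding_avg) auto
    also have "\<dots> \<le> ?K * exp (l * (- u X) + ?c)"
    proof -
      have "l * avg \<delta> X ?f \<le> l * (- u X)"
        using drift[OF X] l neg by (intro mult_left_mono) auto
      then show ?thesis
        by (intro mult_left_mono) (auto simp: power_mult_distrib mult.commute)
    qed
    also have "\<dots> = exp (real (Suc n) * ?c - l * (\<Sum>Y\<leftarrow>\<alpha>. u Y))"
      unfolding Cons exp_add[symmetric] by (simp add: algebra_simps add_divide_distrib)
    finally have "1 - exp (real (Suc n) * ?c - l * (\<Sum>Y\<leftarrow>\<alpha>. u Y))
        \<le> avg \<delta> X (\<lambda>\<gamma>. 1 - ?K * exp (l * ?f \<gamma>))"
      by (simp only: avg_diff avg_cmult avg_const[OF X])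
    also have "\<dots> = avg \<delta> X (\<lambda>\<gamma>. 1 - exp (real n * ?c - l * (\<Sum>Y\<leftarrow>\<gamma> @ \<beta>. u Y)))"
      by (intro avg_cong) (simp add: algebra_simps flip: exp_add)
    also have "\<dots> \<le> surv \<delta> (Suc n) \<alpha>"
      unfolding Cons surv.simps using Cons Suc.prems by (intro avg_mono Suc.IH app_lists) auto
    finally show ?thesis .
  qed simp
qed auto

text \<open>
  Optional stopping: the submartingale \<open>\<Sum>Y\<leftarrow>\<alpha>. u Y\<close> reaches level \<open>L\<close> before termination with
  probability at least its start value divided by \<open>L + 2 M\<close>, the largest value it can jump to.
\<close>

lemma surv_optional_stopping:
  fixes u :: "'a \<Rightarrow> real"
  assumes u: "\<And>X. X \<in> \<Gamma> \<Longrightarrow> 0 \<le> u X" "\<And>X. X \<in> \<Gamma> \<Longrightarrow> u X \<le> M"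
    and drift: "\<And>X. X \<in> \<Gamma> \<Longrightarrow> u X \<le> avg \<delta> X (\<lambda>\<alpha>. \<Sum>Y\<leftarrow>\<alpha>. u Y)"
    and L: "L > 0" and M: "M > 0"
    and high: "\<And>\<alpha>. \<alpha> \<in> lists \<Gamma> \<Longrightarrow> L \<le> (\<Sum>Y\<leftarrow>\<alpha>. u Y) \<Longrightarrow> 1 / 2 \<le> surv \<delta> n \<alpha>"
  shows "\<alpha> \<in> lists \<Gamma> \<Longrightarrow> (\<Sum>Y\<leftarrow>\<alpha>. u Y) \<le> L + 2 * M \<Longrightarrow>
    (\<Sum>Y\<leftarrow>\<alpha>. u Y) / (L + 2 * M) \<le> 2 * surv \<delta> n \<alpha> + surv \<delta> m \<alpha>"
proof (induction m arbitrary: \<alpha>)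
  case 0
  show ?case
  proof (cases "\<alpha> = []")
    case False
    have "(\<Sum>Y\<leftarrow>\<alpha>. u Y) / (L + 2 * M) \<le> 1"
      using 0 L M by (simp add: divide_le_eq)
    with False show ?thesis
      using surv_nonneg[of n \<alpha>] by simp
  qed simp
next
  case (Suc m)
  show ?case
  proof (cases "L \<le> (\<Sum>Y\<leftarrow>\<alpha>. u Y)")
    case True
    have "(\<Sum>Y\<leftarrow>\<alpha>. u Y) / (L + 2 * M) \<le> 1"
      using Suc.prems L M by (simp add: divide_le_eq)
    \<comment> \<open>The left side is at most 1, and \<open>high\<close> already makes
      \<open>2 * surv \<delta> n \<alpha>\<close> at least 1.\<close>
    then show ?thesis
      using high[OF Suc.prems(1) True] surv_nonneg[of "Suc m" \<alpha>] by simp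
  next
    case False
    show ?thesis
    proof (cases \<alpha>)
      case (Cons X \<beta>)
      with Suc.prems have X: "X \<in> \<Gamma>" by simp
      have "(\<Sum>Y\<leftarrow>\<alpha>. u Y) \<le> avg \<delta> X (\<lambda>\<gamma>. \<Sum>Y\<leftarrow>\<gamma> @ \<beta>. u Y)"
        using drift[OF X] Cons X by (simp add: avg_add avg_const)
      then have "(\<Sum>Y\<leftarrow>\<alpha>. u Y) / (L + 2 * M) \<le> avg \<delta> X (\<lambda>\<gamma>. \<Sum>Y\<leftarrow>\<gamma> @ \<beta>. u Y) / (L + 2 * M)"
        using L M by (intro divide_right_mono) auto
      also have "\<dots> = avg \<delta> X (\<lambda>\<gamma>. (\<Sum>Y\<leftarrow>\<gamma> @ \<beta>. u Y) / (L + 2 * M))"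
        unfolding divide_inverse avg_mult_right ..
      also have "\<dots> \<le> avg \<delta> X (\<lambda>\<gamma>. 2 * surv \<delta> n (\<gamma> @ \<beta>) + surv \<delta> m (\<gamma> @ \<beta>))"
      proof (intro avg_mono Suc.IH)
        fix \<gamma> assume \<gamma>: "\<gamma> \<in> set_pmf (\<delta> X)"
        show "\<gamma> @ \<beta> \<in> lists \<Gamma>"
          using Suc.prems(1) Cons \<gamma> by (intro app_lists) auto
        show "(\<Sum>Y\<leftarrow>\<gamma> @ \<beta>. u Y) \<le> L + 2 * M"
        proof -
          have "(\<Sum>Y\<leftarrow>\<gamma>. u Y) \<le> 2 * M"
            using rhs_sum_bounds[of u M X \<gamma>] u X \<gamma> by simp
          moreover have "(\<Sum>Y\<leftarrow>\<beta>. u Y) < L"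
            using False Cons u(1)[OF X] by simp
          ultimately show ?thesis by simp
        qed
      qed
      also have "\<dots> = 2 * surv \<delta> (Suc n) \<alpha> + surv \<delta> (Suc m) \<alpha>"
        unfolding Cons by (simp add: avg_add avg_cmult)
      \<comment> \<open>Only the index \<open>m\<close> counts down; \<open>n\<close> is restored by
        antitonicity, so the level may be reached at any time.\<close>
      also have "\<dots> \<le> 2 * surv \<delta> n \<alpha> + surv \<delta> (Suc m) \<alpha>"
        using surv_Suc_le[OF Suc.prems(1), of n] by simp
      finally show ?thesis .
    qed simp
  qed
qed

lemma surv_sqrt_lower:
  fixes u :: "'a \<Rightarrow> real"
  assumes u: "\<And>X. X \<in> \<Gamma> \<Longrightarrow> 0 \<le> u X" "\<And>X. X \<in> \<Gamma> \<Longrightarrow> u X \<le> M"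
    and drift: "\<And>X. X \<in> \<Gamma> \<Longrightarrow> u X \<le> avg \<delta> X (\<lambda>\<alpha>. \<Sum>Y\<leftarrow>\<alpha>. u Y)"
    and M: "M > 0" and X: "X \<in> \<Gamma>" and n: "n > 0"
    and lim: "(\<lambda>m. surv \<delta> m [X]) \<longlonglongrightarrow> 0"
  shows "u X / (8 * M) / sqrt n \<le> surv \<delta> n [X]"
proof -
  \<comment> \<open>Chosen so that \<open>l * L = 4\<close> while \<open>n\<close> steps contribute
    2 to the exponent; the error is then exp(-2), below 1/2. The level is of order
    \<open>sqrt n\<close>, which is the source of the rate.\<close>
  define L where "L = 2 * M * sqrt n"
  define l where "l = 2 / (M * sqrt n)"
  have L: "L > 0" and l: "l > 0"
    using M n by (auto simp: L_def l_def)
  have high: "1 / 2 \<le> surv \<delta> n \<alpha>" if \<alpha>: "\<alpha> \<in> lists \<Gamma>" "L \<le> (\<Sum>Y\<leftarrow>\<alpha>. u Y)" for \<alpha>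
  proof -
    have "l * L = 4"
      using M n by (simp add: l_def L_def)
    moreover have "l * L \<le> l * (\<Sum>Y\<leftarrow>\<alpha>. u Y)"
      using l \<alpha> by (intro mult_left_mono) auto
    moreover have "real n * (l\<^sup>2 * M\<^sup>2 / 2) = 2"
      using M n by (simp add: l_def power_divide power_mult_distrib)
    ultimately have "exp (real n * (l\<^sup>2 * M\<^sup>2 / 2) - l * (\<Sum>Y\<leftarrow>\<alpha>. u Y)) \<le> exp (- 2)"
      by simp
    also have "exp (- 2 :: real) \<le> 1 / 2"
      using exp_ge_add_one_self[of 2] by (simp add: exp_minus field_simps)
    finally show ?thesis
      using surv_exp_lower[of u M l \<alpha> n] u drift l \<alpha>(1) by fastforce
  qed
  have "u X / (L + 2 * M) \<le> 2 * surv \<delta> n [X] + surv \<delta> m [X]" for m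
    using surv_optional_stopping[of u M L n "[X]" m] u drift L M high X u(2)[OF X] by fastforce
  \<comment> \<open>Letting \<open>m\<close> grow removes the runs that neither reach the level nor
    terminate within \<open>m\<close> steps.\<close>
  moreover have "(\<lambda>m. 2 * surv \<delta> n [X] + surv \<delta> m [X]) \<longlonglongrightarrow> 2 * surv \<delta> n [X] + 0"
    by (intro tendsto_intros lim)
  ultimately have "u X / (L + 2 * M) \<le> 2 * surv \<delta> n [X]"
    using LIMSEQ_le_const by fastforce
  moreover have "u X / (4 * M * sqrt n) \<le> u X / (L + 2 * M)"
  proof (rule divide_left_mono)
    have "M * 1 \<le> M * sqrt n"
      using M n by (intro mult_left_mono) auto
    then show "L + 2 * M \<le> 4 * M * sqrt n"
      by (simp add: L_def)
  qed (use L M n u(1)[OF X] in \<open>auto intro!: mult_pos_pos add_pos_pos\<close>)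
  ultimately show ?thesis
    by (simp add: field_simps)
qed

section \<open>Finite expectation: additivity of expected times and the exponential tail\<close>

lemma summable_surv_Suc: "summable (\<lambda>n. surv \<delta> n \<alpha>) \<Longrightarrow> summable (\<lambda>n. surv \<delta> (Suc n) \<alpha>)"
  by (subst summable_Suc_iff)

lemma summable_surv_dep:
  assumes "(X, Y) \<in> (direct_dep \<Gamma> \<delta>)\<^sup>*" "summable (\<lambda>n. surv \<delta> n [X])"
  shows "summable (\<lambda>n. surv \<delta> n [Y])"
  using assms
proof (induction rule: rtrancl_induct)
  case (step Y Z)
  have pos: "0 < pm"
    using direct_dep_\<Gamma>[OF step.hyps(2)] pm_pos by blast
  have "summable (\<lambda>n. surv \<delta> (Suc n) [Y] / pm)"
    using step by (intro summable_divide summable_surv_Suc)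
  then show ?case
  proof (rule summable_comparison_test'[where N = 0])
    show "norm (surv \<delta> n [Z]) \<le> surv \<delta> (Suc n) [Y] / pm" for n
      using surv_direct_dep[OF step.hyps(2), of n] pos surv_nonneg[of n "[Z]"]
      by (simp add: field_simps del: surv.simps)
  qed
qed auto

lemma summable_surv_rhs:
  assumes "X \<in> \<Gamma>" "\<alpha> \<in> set_pmf (\<delta> X)" "summable (\<lambda>n. surv \<delta> n [X])"
  shows "summable (\<lambda>n. surv \<delta> n \<alpha>)"
proof -
  have "summable (\<lambda>n. surv \<delta> (Suc n) [X] / pm)"
    using assms(3) by (intro summable_divide summable_surv_Suc)
  then show ?thesis
  proof (rule summable_comparison_test'[where N = 0])
    show "norm (surv \<delta> n \<alpha>) \<le> surv \<delta> (Suc n) [X] / pm" for n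
      using avg_ge_pm[OF assms(1,2), of "surv \<delta> n"] pm_pos[OF assms(1)] surv_nonneg
      by (simp add: field_simps)
  qed
qed

text \<open>A partial sum of \<open>surv\<close> over \<open>k < m\<close> is the mean of min(T, m),
  and \<open>1 - surv \<delta> m \<alpha>\<close> is the probability that \<open>\<alpha>\<close> is
  gone by time \<open>m\<close>. On that event the truncated time of \<open>\<beta>\<close> is
  added.\<close>

lemma sum_surv_append:
  "\<alpha> \<in> lists \<Gamma> \<Longrightarrow> \<beta> \<in> lists \<Gamma> \<Longrightarrow>
    (\<Sum>k<m. surv \<delta> k \<alpha>) + (1 - surv \<delta> m \<alpha>) * (\<Sum>k<j. surv \<delta> k \<beta>)
      \<le> (\<Sum>k<m + j. surv \<delta> k (\<alpha> @ \<beta>))"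
proof (induction m arbitrary: \<alpha>)
  case 0
  then show ?case
    by (auto intro: sum_nonneg surv_nonneg)
next
  case (Suc m)
  let ?B = "\<Sum>k<j. surv \<delta> k \<beta>"
  show ?case
  proof (cases \<alpha>)
    case Nil
    have "?B \<le> (\<Sum>k<Suc m + j. surv \<delta> k \<beta>)"
      by (rule sum_mono2) (auto intro: surv_nonneg)
    with Nil show ?thesis by simp
  next
    case (Cons X \<gamma>)
    with Suc.prems have X: "X \<in> \<Gamma>" by simp
    have split: "(\<Sum>k<Suc i. surv \<delta> k (X # \<gamma>')) = 1 + avg \<delta> X (\<lambda>\<alpha>. \<Sum>k<i. surv \<delta> k (\<alpha> @ \<gamma>'))" for i \<gamma>'
      by (simp add: sum.lessThan_Suc_shift avg_sum del: sum.lessThan_Suc)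
    have "avg \<delta> X (\<lambda>\<alpha>. (\<Sum>k<m. surv \<delta> k (\<alpha> @ \<gamma>)) + (1 - surv \<delta> m (\<alpha> @ \<gamma>)) * ?B)
        \<le> avg \<delta> X (\<lambda>\<alpha>. \<Sum>k<m + j. surv \<delta> k ((\<alpha> @ \<gamma>) @ \<beta>))"
      using Suc.prems Cons by (intro avg_mono Suc.IH app_lists) auto
    also have "avg \<delta> X (\<lambda>\<alpha>. (\<Sum>k<m. surv \<delta> k (\<alpha> @ \<gamma>)) + (1 - surv \<delta> m (\<alpha> @ \<gamma>)) * ?B)
        = avg \<delta> X (\<lambda>\<alpha>. \<Sum>k<m. surv \<delta> k (\<alpha> @ \<gamma>)) + (1 - surv \<delta> (Suc m) \<alpha>) * ?B"
      by (simp add: avg_add avg_mult_right avg_diff avg_const[OF X] Cons)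
    finally show ?thesis
      using split[of \<gamma> m] split[of "\<gamma> @ \<beta>" "m + j"] Cons by simp
  qed
qed

text \<open>In the truncated inequality \<open>m\<close> tends to infinity first, which sends the
  probability of finishing \<open>\<alpha>\<close> to 1, and then \<open>j\<close>. One direction
  suffices, as the drift condition is an inequality.\<close>

lemma suminf_surv_append:
  assumes "\<alpha> \<in> lists \<Gamma>" "\<beta> \<in> lists \<Gamma>"
    and "summable (\<lambda>n. surv \<delta> n \<alpha>)" "summable (\<lambda>n. surv \<delta> n \<beta>)" "summable (\<lambda>n. surv \<delta> n (\<alpha> @ \<beta>))"
  shows "(\<Sum>n. surv \<delta> n \<alpha>) + (\<Sum>n. surv \<delta> n \<beta>) \<le> (\<Sum>n. surv \<delta> n (\<alpha> @ \<beta>))"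
proof -
  let ?S = "\<Sum>n. surv \<delta> n (\<alpha> @ \<beta>)"
  have le: "(\<Sum>k<m. surv \<delta> k \<alpha>) + (1 - surv \<delta> m \<alpha>) * (\<Sum>k<j. surv \<delta> k \<beta>) \<le> ?S" for m j
    by (rule order_trans[OF sum_surv_append[OF assms(1,2)] sum_le_suminf[OF assms(5)]])
      (auto intro: surv_nonneg)
  have "(\<Sum>n. surv \<delta> n \<alpha>) + (\<Sum>k<j. surv \<delta> k \<beta>) \<le> ?S" for j
  proof (rule LIMSEQ_le_const2)
    have "(\<lambda>m. (\<Sum>k<m. surv \<delta> k \<alpha>) + (1 - surv \<delta> m \<alpha>) * (\<Sum>k<j. surv \<delta> k \<beta>))
        \<longlonglongrightarrow> (\<Sum>n. surv \<delta> n \<alpha>) + (1 - 0) * (\<Sum>k<j. surv \<delta> k \<beta>)"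
      using assms(3) by (intro tendsto_intros summable_LIMSEQ summable_LIMSEQ_zero)
    then show "(\<lambda>m. (\<Sum>k<m. surv \<delta> k \<alpha>) + (1 - surv \<delta> m \<alpha>) * (\<Sum>k<j. surv \<delta> k \<beta>))
        \<longlonglongrightarrow> (\<Sum>n. surv \<delta> n \<alpha>) + (\<Sum>k<j. surv \<delta> k \<beta>)"
      by simp
    show "\<exists>N. \<forall>m\<ge>N. (\<Sum>k<m. surv \<delta> k \<alpha>) + (1 - surv \<delta> m \<alpha>) * (\<Sum>k<j. surv \<delta> k \<beta>) \<le> ?S"
      using le by simp
  qed
  moreover have "(\<lambda>j. (\<Sum>n. surv \<delta> n \<alpha>) + (\<Sum>k<j. surv \<delta> k \<beta>))
      \<longlonglongrightarrow> (\<Sum>n. surv \<delta> n \<alpha>) + (\<Sum>n. surv \<delta> n \<beta>)"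
    using assms(4) by (intro tendsto_intros summable_LIMSEQ)
  ultimately show ?thesis
    by (intro LIMSEQ_le_const2[of _ _ ?S]) auto
qed

lemma suminf_surv_drift:
  assumes sm: "\<And>Y. Y \<in> \<Gamma> \<Longrightarrow> summable (\<lambda>n. surv \<delta> n [Y])" and X: "X \<in> \<Gamma>"
  shows "1 + avg \<delta> X (\<lambda>\<alpha>. \<Sum>Y\<leftarrow>\<alpha>. \<Sum>n. surv \<delta> n [Y]) \<le> (\<Sum>n. surv \<delta> n [X])"
proof -
  have rhs: "summable (\<lambda>n. surv \<delta> n \<alpha>)" if "\<alpha> \<in> set_pmf (\<delta> X)" for \<alpha>
    using summable_surv_rhs[OF X that sm[OF X]] .
  have "(\<Sum>Y\<leftarrow>\<alpha>. \<Sum>n. surv \<delta> n [Y]) \<le> (\<Sum>n. surv \<delta> n \<alpha>)" if \<alpha>: "\<alpha> \<in> set_pmf (\<delta> X)" for \<alpha>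
    using X \<alpha>
  proof (cases rule: rhs_cases)
    case (3 Y Z)
    then show ?thesis
      using suminf_surv_append[of "[Y]" "[Z]"] sm rhs[OF \<alpha>] by simp
  qed auto
  then have "1 + avg \<delta> X (\<lambda>\<alpha>. \<Sum>Y\<leftarrow>\<alpha>. \<Sum>n. surv \<delta> n [Y]) \<le> 1 + avg \<delta> X (\<lambda>\<alpha>. \<Sum>n. surv \<delta> n \<alpha>)"
    by (intro add_left_mono avg_mono)
  also have "avg \<delta> X (\<lambda>\<alpha>. \<Sum>n. surv \<delta> n \<alpha>) = (\<Sum>n. avg \<delta> X (surv \<delta> n))"
    unfolding avg_def using rhs
    by (subst suminf_sum) (simp_all add: summable_mult suminf_mult)
  also have "1 + \<dots> = (\<Sum>n. surv \<delta> n [X])"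
    using suminf_split_head[OF sm[OF X]] by simp
  finally show ?thesis .
qed

lemma expected_time_finite:
  assumes "X \<in> \<Gamma>" "expected_time \<delta> [X] < \<infinity>"
  shows "summable (\<lambda>n. surv \<delta> n [X])"
  using assms expected_time_eq[of "[X]"] summable_suminf_not_top[of "\<lambda>n. surv \<delta> n [X]"] surv_nonneg by simp

lemma expected_time_suminf:
  assumes "X \<in> \<Gamma>" "summable (\<lambda>n. surv \<delta> n [X])"
  shows "expected_time \<delta> [X] = ennreal (\<Sum>n. surv \<delta> n [X])"
proof -
  have "[X] \<in> lists \<Gamma>"
    using assms(1) by simp
  then have "expected_time \<delta> [X] = (\<Sum>n. ennreal (surv \<delta> n [X]))"
    by (rule expected_time_eq)
  also have "\<dots> = ennreal (\<Sum>n. surv \<delta> n [X])"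
    using surv_nonneg assms(2) by (rule suminf_ennreal2)
  finally show ?thesis .
qed

lemma finite_expectation_upper:
  assumes fin: "\<And>X. X \<in> \<Gamma> \<Longrightarrow> summable (\<lambda>n. surv \<delta> n [X])" and X: "X \<in> \<Gamma>"
    and n: "0 < n" "2 * expected_time \<delta> [X] \<le> of_nat n"
  shows "surv \<delta> (n - 1) [X] \<le> exp (1 - real n / (8 * (enn2real (E_max \<Gamma> \<delta>))\<^sup>2))"
proof -
  define u where "u Y = (\<Sum>n. surv \<delta> n [Y])" for Y
  define M where "M = enn2real (E_max \<Gamma> \<delta>)"
  \<comment> \<open>With this choice \<open>l\<^sup>2 * M\<^sup>2 / 2 = l / 4\<close>, a net decay
    of \<open>3 * l / 4\<close> per step. The start value costs at most \<open>l * n / 2\<close>, so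
    \<open>l * n / 4 = n / (8 * M\<^sup>2)\<close> remains; the summand 1 in the target absorbs the
    shift to \<open>n - 1\<close>.\<close>
  define l where "l = 1 / (2 * M\<^sup>2)"
  have ET: "expected_time \<delta> [Y] = ennreal (u Y)" if "Y \<in> \<Gamma>" for Y
    using expected_time_suminf[OF that fin[OF that]] by (simp add: u_def)
  have u1: "1 \<le> u Y" if "Y \<in> \<Gamma>" for Y
    using sum_le_suminf[OF fin[OF that], of "{0}"] surv_nonneg by (simp add: u_def)
  \<comment> \<open>The maximum is attained and hence finite; \<open>enn2real\<close> would send
    infinity to 0 and is monotone only below infinity.\<close>
  have "E_max \<Gamma> \<delta> \<in> (\<lambda>X. expected_time \<delta> [X]) ` \<Gamma>"
    unfolding E_max_def using finite_\<Gamma> X by (intro Max_in) auto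
  then obtain Y where "E_max \<Gamma> \<delta> = expected_time \<delta> [Y]" "Y \<in> \<Gamma>"
    by (rule imageE)
  then have Emax: "E_max \<Gamma> \<delta> < top"
    by (simp add: ET)
  have uM: "u Y \<le> M" if "Y \<in> \<Gamma>" for Y
  proof -
    have "expected_time \<delta> [Y] \<le> E_max \<Gamma> \<delta>"
      unfolding E_max_def using finite_\<Gamma> that by (intro Max_ge) auto
    then have "enn2real (expected_time \<delta> [Y]) \<le> M"
      unfolding M_def using Emax by (rule enn2real_mono)
    then show ?thesis
      using ET[OF that] u1[OF that] by simp
  qed
  have M1: "1 \<le> M"
    using u1[OF X] uM[OF X] by simp
  then have M2: "1 \<le> M\<^sup>2"
    by simp
  have l: "0 < l" "l \<le> 1 / 2"
    using M1 M2 by (auto simp: l_def divide_le_eq)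
  have drift: "1 + avg \<delta> Y (\<lambda>\<alpha>. \<Sum>Y\<leftarrow>\<alpha>. u Y) \<le> u Y" if "Y \<in> \<Gamma>" for Y
    unfolding u_def using fin that by (rule suminf_surv_drift)
  have "surv \<delta> (n - 1) [X] \<le> exp (l * (\<Sum>Y\<leftarrow>[X]. u Y) - real (n - 1) * l + real (n - 1) * (l\<^sup>2 * M\<^sup>2 / 2))"
    using order_trans[OF zero_le_one u1] uM drift l(1)
    by (rule surv_exp_upper) (use X in auto)
  also have "(\<Sum>Y\<leftarrow>[X]. u Y) = u X"
    by simp
  also have "exp (l * u X - real (n - 1) * l + real (n - 1) * (l\<^sup>2 * M\<^sup>2 / 2)) \<le> exp (1 - real n / (8 * M\<^sup>2))"
  proof -
    have "2 * ennreal (u X) = ennreal (2 * u X)"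
      using u1[OF X] by (simp add: ennreal_mult)
    then have un: "2 * u X \<le> real n"
      using n(2) ET[OF X] by (simp add: ennreal_of_nat_eq_real_of_nat)
    have lM: "l\<^sup>2 * M\<^sup>2 = l / 2"
      using M1 by (simp add: l_def power2_eq_square)
    have "l * (2 * u X) \<le> l * real n"
      using un l by (intro mult_left_mono) auto
    moreover have "real n / (8 * M\<^sup>2) = l * real n / 4"
      by (simp add: l_def)
    moreover have "l * u X - real (n - 1) * l + real (n - 1) * (l / 2 / 2)
        = l * (2 * u X) / 2 - 3 / 4 * (l * real n) + 3 / 4 * l"
      using n(1) by (simp add: field_simps of_nat_diff)
    ultimately show ?thesis
      using l(2) unfolding lM exp_le_cancel_iff by linarith
  qed
  finally show ?thesis
    by (simp add: M_def)
qed

end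

section \<open>Geometric killing\<close>

text \<open>Bolzano-Weierstrass one coordinate at a time, each new subsequence being taken inside
  the previous one.\<close>

lemma convergent_subsequence_finite:
  fixes v :: "nat \<Rightarrow> 'b \<Rightarrow> real"
  assumes "finite A" "\<And>x j. x \<in> A \<Longrightarrow> v j x \<in> {a..b}"
  shows "\<exists>r u. strict_mono r \<and> (\<forall>x\<in>A. (\<lambda>j. v (r j) x) \<longlonglongrightarrow> u x)"
  using assms
proof (induction A rule: finite_induct)
  case empty
  then show ?case
    by (auto intro: strict_mono_id)
next
  case (insert x A)
  then obtain r u where r: "strict_mono (r :: nat \<Rightarrow> nat)" and u: "\<forall>y\<in>A. (\<lambda>j. v (r j) y) \<longlonglongrightarrow> u y"
    by (metis insertCI)
  have "\<forall>j. v (r j) x \<in> {a..b}"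
    using insert.prems by blast
  then obtain l r' where r': "strict_mono (r' :: nat \<Rightarrow> nat)" and l: "((\<lambda>j. v (r j) x) \<circ> r') \<longlonglongrightarrow> l"
    using compact_imp_seq_compact[OF compact_Icc[of a b]] unfolding seq_compact_def by metis
  have "(\<lambda>j. v ((r \<circ> r') j) y) \<longlonglongrightarrow> (u(x := l)) y" if "y \<in> insert x A" for y
  proof (cases "y = x")
    case True
    then show ?thesis using l by (simp add: o_def)
  next
    case False
    with that u have "(\<lambda>j. v (r j) y) \<longlonglongrightarrow> u y" by simp
    from LIMSEQ_subseq_LIMSEQ[OF this r'] False show ?thesis
      by (simp add: o_def)
  qed
  then show ?case
    using strict_mono_o[OF r r'] by blast
qed

lemma tendsto_sum_list:
  fixes f :: "'b \<Rightarrow> 'c \<Rightarrow> real"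
  assumes "\<And>Y. Y \<in> set \<alpha> \<Longrightarrow> ((\<lambda>j. f j Y) \<longlongrightarrow> g Y) F"
  shows "((\<lambda>j. \<Sum>Y\<leftarrow>\<alpha>. f j Y) \<longlongrightarrow> (\<Sum>Y\<leftarrow>\<alpha>. g Y)) F"
  using assms by (induction \<alpha>) (auto intro: tendsto_add)

text \<open>
  The probability that an independent geometric clock with parameter \<open>1 - s\<close> rings before
  termination, that is, one minus the generating function of the termination time at \<open>s\<close>.
\<close>

definition gsurv :: "('a \<Rightarrow> 'a list pmf) \<Rightarrow> real \<Rightarrow> 'a list \<Rightarrow> real" where
  "gsurv \<delta> s \<alpha> = (1 - s) * (\<Sum>k. s ^ k * surv \<delta> k \<alpha>)"

lemma gsurv_Nil [simp]: "gsurv \<delta> s [] = 0"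
  by (simp add: gsurv_def)

context pbpa
begin

lemma summable_gsurv:
  assumes "\<alpha> \<in> lists \<Gamma>" "0 < s" "s < 1"
  shows "summable (\<lambda>k. s ^ k * surv \<delta> k \<alpha>)"
proof (rule summable_comparison_test'[where N = 0])
  show "summable (\<lambda>k. s ^ k)"
    using assms by (intro summable_geometric) auto
  show "norm (s ^ k * surv \<delta> k \<alpha>) \<le> s ^ k" for k
    using assms surv_nonneg[of k \<alpha>] surv_le_1[OF assms(1), of k]
    by (simp add: abs_mult mult_left_le)
qed

lemma gsurv_nonneg:
  assumes "\<alpha> \<in> lists \<Gamma>" "0 < s" "s < 1"
  shows "0 \<le> gsurv \<delta> s \<alpha>"
  unfolding gsurv_def using assms
  by (intro mult_nonneg_nonneg suminf_nonneg summable_gsurv) (auto intro: surv_nonneg)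

text \<open>Either the clock rings within the first \<open>m\<close> ticks, with probability at most
  \<open>m * (1 - s)\<close>, or ringing before termination requires surviving \<open>m\<close>
  steps.\<close>

lemma gsurv_le:
  assumes "\<alpha> \<in> lists \<Gamma>" "0 < s" "s < 1"
  shows "gsurv \<delta> s \<alpha> \<le> real m * (1 - s) + surv \<delta> m \<alpha>"
proof -
  have geo: "summable (\<lambda>k. s ^ k)"
    using assms by (intro summable_geometric) auto
  have "(\<Sum>k. s ^ k * surv \<delta> k \<alpha>) = (\<Sum>k. s ^ (k + m) * surv \<delta> (k + m) \<alpha>) + (\<Sum>k<m. s ^ k * surv \<delta> k \<alpha>)"
    by (rule suminf_split_initial_segment[OF summable_gsurv[OF assms]])
  also have "(\<Sum>k<m. s ^ k * surv \<delta> k \<alpha>) \<le> (\<Sum>k<m. 1)"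
    using assms surv_le_1[OF assms(1)] surv_nonneg
    by (intro sum_mono mult_le_one power_le_one) auto
  also have "(\<Sum>k. s ^ (k + m) * surv \<delta> (k + m) \<alpha>) \<le> (\<Sum>k. s ^ k * surv \<delta> m \<alpha>)"
  proof (rule suminf_le)
    fix k
    have "s ^ (k + m) \<le> s ^ k"
      using assms by (intro power_decreasing) auto
    then show "s ^ (k + m) * surv \<delta> (k + m) \<alpha> \<le> s ^ k * surv \<delta> m \<alpha>"
      using assms surv_antimono[of \<alpha> m "k + m"] surv_nonneg by (intro mult_mono) auto
  next
    show "summable (\<lambda>k. s ^ (k + m) * surv \<delta> (k + m) \<alpha>)"
      by (rule summable_ignore_initial_segment[OF summable_gsurv[OF assms]])
  qed (intro summable_mult2 geo)
  also have "(\<Sum>k. s ^ k * surv \<delta> m \<alpha>) = surv \<delta> m \<alpha> / (1 - s)"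
    using suminf_mult2[OF geo, of "surv \<delta> m \<alpha>"] assms by (simp add: suminf_geometric)
  finally have "gsurv \<delta> s \<alpha> \<le> (1 - s) * (surv \<delta> m \<alpha> / (1 - s) + real m)"
    unfolding gsurv_def using assms by (intro mult_left_mono) auto
  then show ?thesis
    using assms by (simp add: distrib_left mult.commute)
qed

lemma gsurv_le_1:
  assumes "\<alpha> \<in> lists \<Gamma>" "0 < s" "s < 1"
  shows "gsurv \<delta> s \<alpha> \<le> 1"
  using gsurv_le[OF assms, of 0] surv_le_1[OF assms(1), of 0] by simp

text \<open>The clock rings at the first tick with probability \<open>1 - s\<close>; otherwise one
  step is made and, being memoryless, it starts afresh.\<close>

lemma gsurv_Cons:
  assumes "X \<in> \<Gamma>" "\<beta> \<in> lists \<Gamma>" "0 < s" "s < 1"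
  shows "gsurv \<delta> s (X # \<beta>) = (1 - s) + s * avg \<delta> X (\<lambda>\<alpha>. gsurv \<delta> s (\<alpha> @ \<beta>))"
proof -
  let ?S = "\<lambda>\<alpha>. \<Sum>k. s ^ k * surv \<delta> k (\<alpha> @ \<beta>)"
  have sm: "summable (\<lambda>k. s ^ k * surv \<delta> k (\<alpha> @ \<beta>))" if "\<alpha> \<in> set_pmf (\<delta> X)" for \<alpha>
    using assms that by (intro summable_gsurv app_lists)
  have "(\<Sum>k. s ^ k * surv \<delta> k (X # \<beta>)) = 1 + (\<Sum>k. s ^ Suc k * surv \<delta> (Suc k) (X # \<beta>))"
    using suminf_split_head[OF summable_gsurv[of "X # \<beta>" s]] assms by simp
  also have "(\<Sum>k. s ^ Suc k * surv \<delta> (Suc k) (X # \<beta>))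
      = (\<Sum>k. \<Sum>\<alpha>\<in>set_pmf (\<delta> X). s * pmf (\<delta> X) \<alpha> * (s ^ k * surv \<delta> k (\<alpha> @ \<beta>)))"
    unfolding surv.simps avg_def sum_distrib_left by (intro suminf_cong sum.cong) auto
  also have "\<dots> = (\<Sum>\<alpha>\<in>set_pmf (\<delta> X). s * pmf (\<delta> X) \<alpha> * ?S \<alpha>)"
    using sm by (subst suminf_sum) (simp_all add: summable_mult suminf_mult)
  also have "\<dots> = s * avg \<delta> X ?S"
    by (simp add: avg_def sum_distrib_left mult.assoc)
  finally show ?thesis
    unfolding gsurv_def avg_cmult by (simp add: algebra_simps)
qed

text \<open>
  Both sides solve the same linear recursion with contraction factor \<open>s < 1\<close> in \<open>\<alpha>\<close>.
\<close>

lemma gsurv_append: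
  assumes \<alpha>: "\<alpha> \<in> lists \<Gamma>" and \<beta>: "\<beta> \<in> lists \<Gamma>" and s: "0 < s" "s < 1"
  shows "gsurv \<delta> s (\<alpha> @ \<beta>) = gsurv \<delta> s \<alpha> + gsurv \<delta> s \<beta> - gsurv \<delta> s \<alpha> * gsurv \<delta> s \<beta>"
proof -
  let ?b = "gsurv \<delta> s \<beta>"
  define K where "K \<alpha> = gsurv \<delta> s (\<alpha> @ \<beta>) - gsurv \<delta> s \<alpha> - ?b + gsurv \<delta> s \<alpha> * ?b" for \<alpha>
  have b: "0 \<le> ?b" "?b \<le> 1"
    using gsurv_nonneg gsurv_le_1 \<beta> s by auto
  \<comment> \<open>The 4 counts the terms of \<open>K\<close>, each of absolute value at most 1;
    every step of the recursion contributes a factor \<open>s\<close>.\<close>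
  have "\<bar>K \<alpha>\<bar> \<le> 4 * s ^ n" if "\<alpha> \<in> lists \<Gamma>" for n \<alpha>
    using that
  proof (induction n arbitrary: \<alpha>)
    case 0
    then have "\<alpha> @ \<beta> \<in> lists \<Gamma>"
      using \<beta> by simp
    then have "0 \<le> gsurv \<delta> s (\<alpha> @ \<beta>)" "gsurv \<delta> s (\<alpha> @ \<beta>) \<le> 1" "0 \<le> gsurv \<delta> s \<alpha>" "gsurv \<delta> s \<alpha> \<le> 1"
      using gsurv_nonneg gsurv_le_1 0 s by blast+
    moreover from this b have "0 \<le> gsurv \<delta> s \<alpha> * ?b" "gsurv \<delta> s \<alpha> * ?b \<le> 1"
      by (auto intro: mult_le_one)
    ultimately show ?case
      using b unfolding K_def abs_le_iff power_0 by linarith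
  next
    case (Suc n)
    show ?case
    proof (cases \<alpha>)
      case Nil
      then show ?thesis using s by (simp add: K_def)
    next
      case (Cons X \<gamma>)
      with Suc.prems have X: "X \<in> \<Gamma>" and \<gamma>: "\<gamma> \<in> lists \<Gamma>" by auto
      define P R where "P = avg \<delta> X (\<lambda>\<alpha>'. gsurv \<delta> s (\<alpha>' @ \<gamma>))"
        and "R = avg \<delta> X (\<lambda>\<alpha>'. gsurv \<delta> s (\<alpha>' @ \<gamma> @ \<beta>))"
      have e1: "avg \<delta> X (\<lambda>\<alpha>'. K (\<alpha>' @ \<gamma>)) = R - P - ?b + P * ?b"
        unfolding K_def P_def R_def by (simp add: avg_add avg_diff avg_mult_right avg_const[OF X])
      have e2: "gsurv \<delta> s (X # \<gamma>) = (1 - s) + s * P"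
        unfolding P_def by (rule gsurv_Cons[OF X \<gamma> s])
      have e3: "gsurv \<delta> s (X # \<gamma> @ \<beta>) = (1 - s) + s * R"
        unfolding R_def using \<gamma> \<beta> by (intro gsurv_Cons[OF X _ s]) simp
      have "K \<alpha> = s * avg \<delta> X (\<lambda>\<alpha>'. K (\<alpha>' @ \<gamma>))"
        unfolding Cons K_def[of "X # \<gamma>"] append_Cons e1 e2 e3 by (simp add: algebra_simps)
      moreover have "K (\<alpha>' @ \<gamma>) \<le> 4 * s ^ n" "- (4 * s ^ n) \<le> K (\<alpha>' @ \<gamma>)"
        if "\<alpha>' \<in> set_pmf (\<delta> X)" for \<alpha>'
        using Suc.IH[OF app_lists[OF X that \<gamma>]] by linarith+
      then have "avg \<delta> X (\<lambda>\<alpha>'. K (\<alpha>' @ \<gamma>)) \<le> 4 * s ^ n" "- (4 * s ^ n) \<le> avg \<delta> X (\<lambda>\<alpha>'. K (\<alpha>' @ \<gamma>))"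
        by (intro avg_le_const[OF X] avg_ge_const[OF X]; simp)+
      then have "\<bar>avg \<delta> X (\<lambda>\<alpha>'. K (\<alpha>' @ \<gamma>))\<bar> \<le> 4 * s ^ n"
        by linarith
      then have "s * \<bar>avg \<delta> X (\<lambda>\<alpha>'. K (\<alpha>' @ \<gamma>))\<bar> \<le> s * (4 * s ^ n)"
        using s by (intro mult_left_mono) auto
      ultimately show ?thesis
        using s by (simp add: abs_mult)
    qed
  qed
  then have "\<bar>K \<alpha>\<bar> \<le> 4 * s ^ n" for n
    using \<alpha> by blast
  moreover have "(\<lambda>n. 4 * s ^ n) \<longlonglongrightarrow> 4 * 0"
    using s by (intro tendsto_intros LIMSEQ_realpow_zero) auto
  ultimately have "\<bar>K \<alpha>\<bar> \<le> 0"
    by (intro LIMSEQ_le_const[of "\<lambda>n. 4 * s ^ n" 0]) auto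
  then show ?thesis
    by (simp add: K_def)
qed

lemma gsurv_pair:
  assumes "Y \<in> \<Gamma>" "Z \<in> \<Gamma>" "0 < s" "s < 1"
  shows "gsurv \<delta> s [Y, Z] = gsurv \<delta> s [Y] + gsurv \<delta> s [Z] - gsurv \<delta> s [Y] * gsurv \<delta> s [Z]"
  using gsurv_append[of "[Y]" "[Z]" s] assms by simp

lemma gsurv_ge_mem:
  assumes "\<alpha> \<in> lists \<Gamma>" "Y \<in> set \<alpha>" "0 < s" "s < 1"
  shows "gsurv \<delta> s [Y] \<le> gsurv \<delta> s \<alpha>"
proof -
  have "[Y] \<in> lists \<Gamma>"
    using assms by auto
  then show ?thesis
    unfolding gsurv_def using assms
    by (intro mult_left_mono suminf_le summable_gsurv surv_ge_mem) auto
qed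

lemma gsurv_relpow:
  assumes "(X, Y) \<in> direct_dep \<Gamma> \<delta> ^^ k" "0 < s" "s < 1"
  shows "(s * pm) ^ k * gsurv \<delta> s [Y] \<le> gsurv \<delta> s [X]"
  using assms(1)
proof (induction k arbitrary: X)
  case (Suc k)
  then obtain Z where Z: "(X, Z) \<in> direct_dep \<Gamma> \<delta>" "(Z, Y) \<in> direct_dep \<Gamma> \<delta> ^^ k"
    by (meson relpow_Suc_E2)
  then obtain \<alpha> where X: "X \<in> \<Gamma>" and \<alpha>: "\<alpha> \<in> set_pmf (\<delta> X)" "Z \<in> set \<alpha>"
    by (auto simp: direct_dep_def rules_def)
  have nonneg: "0 \<le> gsurv \<delta> s \<beta>" if "\<beta> \<in> set_pmf (\<delta> X)" for \<beta>
    using X that rhs_lists assms by (intro gsurv_nonneg) auto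
  have "(s * pm) * ((s * pm) ^ k * gsurv \<delta> s [Y]) \<le> (s * pm) * gsurv \<delta> s [Z]"
    using Suc.IH[OF Z(2)] pm_pos[OF X] assms by (intro mult_left_mono) auto
  also have "\<dots> \<le> (s * pm) * gsurv \<delta> s \<alpha>"
    using X \<alpha> rhs_lists pm_pos[OF X] assms by (intro mult_left_mono gsurv_ge_mem) auto
  also have "\<dots> \<le> s * avg \<delta> X (gsurv \<delta> s)"
    using avg_ge_pm[OF X \<alpha>(1), of "gsurv \<delta> s"] nonneg assms by simp
  also have "\<dots> \<le> gsurv \<delta> s [X]"
    using gsurv_Cons[OF X, of "[]" s] assms by simp
  finally show ?case by (simp add: mult.assoc)
qed simp

text \<open>A run that survives \<open>n\<close> steps is counted whenever the clock rings among its
  first \<open>n + 1\<close> ticks, an independent event of probability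
  \<open>1 - s ^ Suc n\<close>.\<close>

lemma surv_le_gsurv:
  assumes "\<alpha> \<in> lists \<Gamma>" "0 < s" "s < 1"
  shows "surv \<delta> n \<alpha> * (1 - s ^ Suc n) \<le> gsurv \<delta> s \<alpha>"
proof -
  have "surv \<delta> n \<alpha> * (\<Sum>k<Suc n. s ^ k) = (\<Sum>k<Suc n. s ^ k * surv \<delta> n \<alpha>)"
    by (simp add: sum_distrib_left mult.commute del: sum.lessThan_Suc)
  also have "\<dots> \<le> (\<Sum>k<Suc n. s ^ k * surv \<delta> k \<alpha>)"
    using assms by (intro sum_mono mult_left_mono surv_antimono) auto
  also have "\<dots> \<le> (\<Sum>k. s ^ k * surv \<delta> k \<alpha>)"
    using assms by (intro sum_le_suminf summable_gsurv) (auto intro!: mult_nonneg_nonneg surv_nonneg)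
  finally have "(1 - s) * (surv \<delta> n \<alpha> * (\<Sum>k<Suc n. s ^ k)) \<le> gsurv \<delta> s \<alpha>"
    unfolding gsurv_def using assms by (intro mult_left_mono) auto
  moreover have "(1 - s) * (\<Sum>k<Suc n. s ^ k) = 1 - s ^ Suc n"
    by (rule one_diff_power_eq[symmetric])
  ultimately show ?thesis
    by (metis mult.left_commute)
qed

lemma gsurv_tendsto_0:
  assumes X: "X \<in> \<Gamma>" and lim: "(\<lambda>m. surv \<delta> m [X]) \<longlonglongrightarrow> 0"
  shows "((\<lambda>s. gsurv \<delta> s [X]) \<longlongrightarrow> 0) (at_left 1)"
proof (rule tendstoI)
  fix e :: real assume e: "0 < e"
  obtain m where m: "surv \<delta> m [X] < e / 2"
    using order_tendstoD(2)[OF lim, of "e / 2"] e by (auto simp: eventually_sequentially)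
  have "((\<lambda>s. real m * (1 - s)) \<longlongrightarrow> real m * (1 - 1)) (at_left (1::real))"
    by (intro tendsto_intros)
  then have "\<forall>\<^sub>F s in at_left (1::real). real m * (1 - s) < e / 2"
    using e by (intro order_tendstoD(2)) auto
  moreover have "\<forall>\<^sub>F s in at_left (1::real). s \<in> {0<..<1}"
    by (rule eventually_at_left_real) simp
  ultimately show "\<forall>\<^sub>F s in at_left 1. dist (gsurv \<delta> s [X]) 0 < e"
  proof eventually_elim
    case (elim s)
    then show ?case
      using gsurv_le[of "[X]" s m] gsurv_nonneg[of "[X]" s] X m by simp
  qed
qed

text \<open>The ratio is the Abel mean of the series for the expectation; any partial sum exceeding
  \<open>Z\<close> is nearly attained for \<open>s\<close> close to 1.\<close>

lemma gsurv_ratio_at_top: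
  assumes X: "X \<in> \<Gamma>" and ns: "\<not> summable (\<lambda>m. surv \<delta> m [X])"
  shows "filterlim (\<lambda>s. gsurv \<delta> s [X] / (1 - s)) at_top (at_left 1)"
  unfolding filterlim_at_top
proof
  fix Z :: real
  have "\<exists>m. Z < (\<Sum>k<m. surv \<delta> k [X])"
  proof (rule ccontr)
    assume "\<nexists>m. Z < (\<Sum>k<m. surv \<delta> k [X])"
    then have "\<And>m. (\<Sum>k<m. surv \<delta> k [X]) \<le> Z"
      by (simp add: not_less)
    then have "summable (\<lambda>m. surv \<delta> m [X])"
      by (rule summableI_nonneg_bounded[OF surv_nonneg])
    with ns show False by simp
  qed
  then obtain m where m: "Z < (\<Sum>k<m. surv \<delta> k [X])" by blast
  have "((\<lambda>s. \<Sum>k<m. s ^ k * surv \<delta> k [X]) \<longlongrightarrow> (\<Sum>k<m. 1 ^ k * surv \<delta> k [X])) (at_left (1::real))"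
    by (intro tendsto_intros)
  then have "\<forall>\<^sub>F s in at_left (1::real). Z < (\<Sum>k<m. s ^ k * surv \<delta> k [X])"
    using m by (intro order_tendstoD(1)) auto
  moreover have "\<forall>\<^sub>F s in at_left (1::real). s \<in> {0<..<1}"
    by (rule eventually_at_left_real) simp
  ultimately show "\<forall>\<^sub>F s in at_left 1. Z \<le> gsurv \<delta> s [X] / (1 - s)"
  proof eventually_elim
    case (elim s)
    have "(\<Sum>k<m. s ^ k * surv \<delta> k [X]) \<le> (\<Sum>k. s ^ k * surv \<delta> k [X])"
      using elim X by (intro sum_le_suminf summable_gsurv) (auto intro!: mult_nonneg_nonneg surv_nonneg)
    with elim show ?case
      by (simp add: gsurv_def)
  qed
qed

lemma gsurv_rhs_le:
  assumes X: "X \<in> \<Gamma>" and \<alpha>: "\<alpha> \<in> set_pmf (\<delta> X)" and s: "0 < s" "s < 1"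
  shows "gsurv \<delta> s \<alpha> \<le> (\<Sum>Y\<leftarrow>\<alpha>. gsurv \<delta> s [Y])"
  using X \<alpha>
proof (cases rule: rhs_cases)
  case (3 Y Z)
  have "0 \<le> gsurv \<delta> s [Y] * gsurv \<delta> s [Z]"
    using 3 s by (intro mult_nonneg_nonneg gsurv_nonneg) auto
  with 3 gsurv_pair[of Y Z s] s show ?thesis by simp
qed auto

text \<open>
  The limit of the normalised vectors \<open>gsurv \<delta> s [X] / gsurv \<delta> s [X0]\<close> as \<open>s\<close> tends to \<open>1\<close>
  is subharmonic, because the defect \<open>(1 - s) / gsurv \<delta> s [X0]\<close> vanishes when the expectation is
  infinite.
\<close>

lemma exists_subharmonic:
  assumes X0: "X0 \<in> \<Gamma>" and dep: "\<And>X. X \<in> \<Gamma> \<Longrightarrow> (X0, X) \<in> (direct_dep \<Gamma> \<delta>)\<^sup>*"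
    and ns: "\<not> summable (\<lambda>m. surv \<delta> m [X0])"
  obtains u :: "'a \<Rightarrow> real" and M where "0 < M" "u X0 = 1"
    "\<And>X. X \<in> \<Gamma> \<Longrightarrow> 0 \<le> u X" "\<And>X. X \<in> \<Gamma> \<Longrightarrow> u X \<le> M"
    "\<And>X. X \<in> \<Gamma> \<Longrightarrow> u X \<le> avg \<delta> X (\<lambda>\<alpha>. \<Sum>Y\<leftarrow>\<alpha>. u Y)"
proof -
  \<comment> \<open>Any sequence tending to 1 from below would do; staying above 1/2 keeps the
    powers of \<open>t j * pm\<close> away from 0 uniformly in \<open>j\<close>.\<close>
  define t :: "nat \<Rightarrow> real" where "t j = 1 - 1 / (real j + 2)" for j
  have t_bounds: "1 / 2 \<le> t j" "0 < t j" "t j < 1" for j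
    by (auto simp: t_def field_simps)
  have t_lim: "t \<longlonglongrightarrow> 1"
    unfolding t_def by real_asymp
  have t_at: "filterlim t (at_left 1) sequentially"
    unfolding filterlim_at using t_lim t_bounds by (auto intro: always_eventually simp: less_imp_neq)
  let ?g = "\<lambda>j X. gsurv \<delta> (t j) [X]"
  have g0: "0 < ?g j X0" for j
    using gsurv_Cons[OF X0, of "[]" "t j"] t_bounds[of j] rhs_lists[OF X0]
    by (auto intro!: add_pos_nonneg mult_nonneg_nonneg avg_nonneg gsurv_nonneg simp del: in_lists_conv_set)
  have g_nonneg: "0 \<le> ?g j X" if "X \<in> \<Gamma>" for j X
    using that t_bounds by (intro gsurv_nonneg) auto
  define v where "v j X = ?g j X / ?g j X0" for j X
  \<comment> \<open>Dependence of \<open>X0\<close> on \<open>X\<close> bounds the normalised values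
    uniformly in \<open>j\<close>, which gives the compactness needed for a limit.\<close>
  have "\<exists>b. \<forall>j. ?g j X \<le> b * ?g j X0" if X: "X \<in> \<Gamma>" for X
  proof -
    obtain k where k: "(X0, X) \<in> direct_dep \<Gamma> \<delta> ^^ k"
      using dep[OF X] rtrancl_imp_relpow by blast
    have "?g j X \<le> 1 / (pm / 2) ^ k * ?g j X0" for j
    proof -
      have "(pm / 2) ^ k * ?g j X \<le> (t j * pm) ^ k * ?g j X"
        using t_bounds[of j] pm_pos[OF X] g_nonneg[OF X]
        by (intro mult_right_mono power_mono) auto
      also have "\<dots> \<le> ?g j X0"
        using gsurv_relpow[OF k] t_bounds by blast
      finally show ?thesis
        using pm_pos[OF X] by (simp add: field_simps)
    qed
    then show ?thesis by blast
  qed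
  then obtain b where b: "\<And>X j. X \<in> \<Gamma> \<Longrightarrow> ?g j X \<le> b X * ?g j X0"
    by metis
  define M where "M = (\<Sum>X\<in>\<Gamma>. \<bar>b X\<bar>) + 1"
  have M: "0 < M"
    by (simp add: M_def sum_nonneg add_nonneg_pos)
  have vM: "v j X \<in> {0..M}" if X: "X \<in> \<Gamma>" for j X
  proof -
    have "v j X \<le> b X"
      using b[OF X, of j] g0[of j] by (simp add: v_def divide_le_eq)
    also have "b X \<le> (\<Sum>X\<in>\<Gamma>. \<bar>b X\<bar>)"
      using member_le_sum[OF X, of "\<lambda>X. \<bar>b X\<bar>"] finite_\<Gamma> by simp
    finally show ?thesis
      using g_nonneg[OF X, of j] g0[of j] by (simp add: v_def M_def)
  qed
  obtain r u where r: "strict_mono (r :: nat \<Rightarrow> nat)"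
    and u: "\<And>X. X \<in> \<Gamma> \<Longrightarrow> (\<lambda>j. v (r j) X) \<longlonglongrightarrow> u X"
    using convergent_subsequence_finite[OF finite_\<Gamma>, of v 0 M] vM by blast
  have defect: "(\<lambda>j. (1 - t (r j)) / ?g (r j) X0) \<longlonglongrightarrow> 0"
  proof -
    have "filterlim (\<lambda>j. ?g j X0 / (1 - t j)) at_top sequentially"
      using filterlim_compose[OF gsurv_ratio_at_top[OF X0 ns] t_at] .
    then have "(\<lambda>j. inverse (?g j X0 / (1 - t j))) \<longlonglongrightarrow> 0"
      by (rule tendsto_inverse_0_at_top)
    from LIMSEQ_subseq_LIMSEQ[OF this r] show ?thesis
      by (simp add: o_def)
  qed
  have step: "v j X \<le> (1 - t j) / ?g j X0 + avg \<delta> X (\<lambda>\<alpha>. \<Sum>Y\<leftarrow>\<alpha>. v j Y)" if X: "X \<in> \<Gamma>" for j X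
  proof -
    have nn: "0 \<le> gsurv \<delta> (t j) \<alpha>" if "\<alpha> \<in> set_pmf (\<delta> X)" for \<alpha>
      using t_bounds rhs_lists[OF X that] by (intro gsurv_nonneg) auto
    have "?g j X = (1 - t j) + t j * avg \<delta> X (gsurv \<delta> (t j))"
      using gsurv_Cons[OF X, of "[]" "t j"] t_bounds[of j] by simp
    also have "t j * avg \<delta> X (gsurv \<delta> (t j)) \<le> avg \<delta> X (gsurv \<delta> (t j))"
      using t_bounds[of j] nn by (intro mult_left_le_one_le avg_nonneg) auto
    also have "\<dots> \<le> avg \<delta> X (\<lambda>\<alpha>. \<Sum>Y\<leftarrow>\<alpha>. ?g j Y)"
      using t_bounds X by (intro avg_mono gsurv_rhs_le) auto
    finally have "v j X \<le> ((1 - t j) + avg \<delta> X (\<lambda>\<alpha>. \<Sum>Y\<leftarrow>\<alpha>. ?g j Y)) / ?g j X0"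
      unfolding v_def using g0[of j] by (intro divide_right_mono) auto
    also have "avg \<delta> X (\<lambda>\<alpha>. \<Sum>Y\<leftarrow>\<alpha>. v j Y) = avg \<delta> X (\<lambda>\<alpha>. \<Sum>Y\<leftarrow>\<alpha>. ?g j Y) / ?g j X0"
      unfolding v_def divide_inverse sum_list_mult_const avg_mult_right ..
    ultimately show ?thesis
      by (simp add: add_divide_distrib)
  qed
  show thesis
  proof (rule that[OF M])
    show "0 \<le> u X" if X: "X \<in> \<Gamma>" for X
      using vM[OF X] by (intro LIMSEQ_le_const[OF u[OF X]]) auto
    show "u X \<le> M" if X: "X \<in> \<Gamma>" for X
      using vM[OF X] by (intro LIMSEQ_le_const2[OF u[OF X]]) auto
    have "v j X0 = 1" for j
      using g0[of j] by (simp add: v_def)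
    then show "u X0 = 1"
      using u[OF X0] by (simp add: LIMSEQ_const_iff)
    show "u X \<le> avg \<delta> X (\<lambda>\<alpha>. \<Sum>Y\<leftarrow>\<alpha>. u Y)" if X: "X \<in> \<Gamma>" for X
    proof (rule LIMSEQ_le[OF u[OF X]])
      have "(\<lambda>j. avg \<delta> X (\<lambda>\<alpha>. \<Sum>Y\<leftarrow>\<alpha>. v (r j) Y)) \<longlonglongrightarrow> avg \<delta> X (\<lambda>\<alpha>. \<Sum>Y\<leftarrow>\<alpha>. u Y)"
        unfolding avg_def using rhs_lists[OF X]
        by (intro tendsto_sum tendsto_mult tendsto_const tendsto_sum_list u) auto
      from tendsto_add[OF defect this]
      show "(\<lambda>j. (1 - t (r j)) / ?g (r j) X0 + avg \<delta> X (\<lambda>\<alpha>. \<Sum>Y\<leftarrow>\<alpha>. v (r j) Y))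
          \<longlonglongrightarrow> avg \<delta> X (\<lambda>\<alpha>. \<Sum>Y\<leftarrow>\<alpha>. u Y)"
        by simp
      show "\<exists>N. \<forall>j\<ge>N. v (r j) X \<le> (1 - t (r j)) / ?g (r j) X0 + avg \<delta> X (\<lambda>\<alpha>. \<Sum>Y\<leftarrow>\<alpha>. v (r j) Y)"
        using step[OF X] by blast
    qed
  qed
qed

lemma infinite_expectation_lower:
  assumes X0: "X0 \<in> \<Gamma>" and dep: "\<And>X. X \<in> \<Gamma> \<Longrightarrow> (X0, X) \<in> (direct_dep \<Gamma> \<delta>)\<^sup>*"
    and ns: "\<not> summable (\<lambda>m. surv \<delta> m [X0])" and lim: "(\<lambda>m. surv \<delta> m [X0]) \<longlonglongrightarrow> 0"
  obtains c where "0 < c" "\<And>n. 0 < n \<Longrightarrow> c / sqrt (real n) \<le> surv \<delta> n [X0]"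
proof -
  obtain u :: "'a \<Rightarrow> real" and M where u: "0 < M" "u X0 = 1"
    "\<And>X. X \<in> \<Gamma> \<Longrightarrow> 0 \<le> u X" "\<And>X. X \<in> \<Gamma> \<Longrightarrow> u X \<le> M"
    "\<And>X. X \<in> \<Gamma> \<Longrightarrow> u X \<le> avg \<delta> X (\<lambda>\<alpha>. \<Sum>Y\<leftarrow>\<alpha>. u Y)"
    using exists_subharmonic[OF X0 dep ns] by metis
  have "1 / (8 * M) / sqrt n \<le> surv \<delta> n [X0]" if "0 < n" for n
    using surv_sqrt_lower[OF u(3,4,5,1) X0 that lim] u(2) by simp
  then show ?thesis
    using that[of "1 / (8 * M)"] u(1) by simp
qed

end

section \<open>A strongly connected component\<close>

text \<open>A shortest path repeats no vertex, since a repetition could be cut out.\<close>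

lemma relpow_less_card:
  assumes fin: "finite C" and R: "R \<subseteq> C \<times> C" and xy: "(x, y) \<in> R\<^sup>*" and x: "x \<in> C"
  shows "\<exists>k<card C. (x, y) \<in> R ^^ k"
proof -
  define k where "k = (LEAST k. (x, y) \<in> R ^^ k)"
  have k: "(x, y) \<in> R ^^ k"
    unfolding k_def using rtrancl_imp_relpow[OF xy] by (metis LeastI)
  have least: "k \<le> j" if "(x, y) \<in> R ^^ j" for j
    unfolding k_def using that by (rule Least_le)
  obtain f where f: "f 0 = x" "f k = y" "\<And>i. i < k \<Longrightarrow> (f i, f (Suc i)) \<in> R"
    using k unfolding relpow_fun_conv by blast
  have seg: "(f a, f (a + b)) \<in> R ^^ b" if "a + b \<le> k" for a b
    using that by (auto simp: relpow_fun_conv intro!: exI[of _ "\<lambda>i. f (a + i)"] f(3))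
  have "f i \<noteq> f j" if "i < j" "j \<le> k" for i j
  proof
    assume eq: "f i = f j"
    have "(x, f i) \<in> R ^^ i"
      using seg[of 0 i] that f(1) by simp
    moreover have "(f j, y) \<in> R ^^ (k - j)"
      using seg[of j "k - j"] that f(2) by simp
    ultimately have "(x, y) \<in> R ^^ (i + (k - j))"
      unfolding relpow_add using eq by auto
    from least[OF this] show False
      using that by simp
  qed
  then have inj: "inj_on f {..k}"
    unfolding inj_on_def by (metis atMost_iff linorder_neqE_nat)
  have "f i \<in> C" if "i \<le> k" for i
  proof (cases i)
    case (Suc j)
    then show ?thesis
      using f(3)[of j] that R by auto
  qed (use f(1) x in simp)
  then have "card (f ` {..k}) \<le> card C"
    using fin by (intro card_mono) auto
  then have "k < card C"
    using card_image[OF inj] by simp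
  with k show ?thesis by blast
qed

text \<open>
  For a strongly connected set \<open>C\<close> of symbols, \<open>csum\<close> and \<open>cprod\<close> are the linear and the quadratic
  part, in the symbols of \<open>C\<close>, of the contribution of a right-hand side.
\<close>

definition csum :: "'a set \<Rightarrow> ('a \<Rightarrow> real) \<Rightarrow> 'a list \<Rightarrow> real" where
  "csum C f \<alpha> = (\<Sum>Y\<leftarrow>filter (\<lambda>Y. Y \<in> C) \<alpha>. f Y)"

definition cprod :: "'a set \<Rightarrow> ('a \<Rightarrow> real) \<Rightarrow> 'a list \<Rightarrow> real" where
  "cprod C f \<alpha> = (case \<alpha> of [Y, Z] \<Rightarrow> if Y \<in> C \<and> Z \<in> C then f Y * f Z else 0 | _ \<Rightarrow> 0)"

lemma csum_diff: "csum C (\<lambda>Y. f Y - h Y) \<alpha> = csum C f \<alpha> - csum C h \<alpha>"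
  by (simp add: csum_def sum_list_subtractf)

lemma csum_cmult: "csum C (\<lambda>Y. c * f Y) \<alpha> = c * csum C f \<alpha>"
  by (simp add: csum_def sum_list_const_mult)

lemma csum_mono: "(\<And>Y. Y \<in> C \<Longrightarrow> f Y \<le> h Y) \<Longrightarrow> csum C f \<alpha> \<le> csum C h \<alpha>"
  unfolding csum_def by (rule sum_list_mono) auto

lemma csum_nonneg: "(\<And>Y. Y \<in> C \<Longrightarrow> 0 \<le> f Y) \<Longrightarrow> 0 \<le> csum C f \<alpha>"
  unfolding csum_def by (rule sum_list_nonneg) auto

lemma csum_ge_mem:
  assumes "\<And>Y. Y \<in> C \<Longrightarrow> 0 \<le> f Y" "Y \<in> C" "Y \<in> set \<alpha>"
  shows "f Y \<le> csum C f \<alpha>"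
  unfolding csum_def by (rule member_le_sum_list) (use assms in auto)

lemma csum_le_length:
  assumes "\<And>Y. Y \<in> C \<Longrightarrow> f Y \<le> m" "0 \<le> m"
  shows "csum C f \<alpha> \<le> real (length \<alpha>) * m"
  using assms by (induction \<alpha>) (auto simp: csum_def algebra_simps add_increasing add_mono)

lemma cprod_nonneg: "(\<And>Y. Y \<in> C \<Longrightarrow> 0 \<le> f Y) \<Longrightarrow> 0 \<le> cprod C f \<alpha>"
  by (auto simp: cprod_def split: list.split)

text \<open>When all values are at most \<open>m\<close>, the quadratic part is an
  \<open>m\<close>-fraction of the linear part. This makes the recursion for \<open>gsurv\<close>
  nearly linear at parameters close to 1.\<close>

lemma cprod_le_csum:
  assumes "\<And>Y. Y \<in> C \<Longrightarrow> 0 \<le> f Y" "\<And>Y. Y \<in> C \<Longrightarrow> f Y \<le> m" "0 \<le> m"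
  shows "cprod C f \<alpha> \<le> m * csum C f \<alpha>"
proof (cases "\<exists>Y Z. \<alpha> = [Y, Z] \<and> Y \<in> C \<and> Z \<in> C")
  case True
  then obtain Y Z where YZ: "\<alpha> = [Y, Z]" "Y \<in> C" "Z \<in> C" by blast
  have "f Y * f Z \<le> m * f Z"
    using assms YZ by (intro mult_right_mono) auto
  moreover have "0 \<le> m * f Y"
    using assms YZ by simp
  ultimately show ?thesis
    using YZ by (simp add: cprod_def csum_def algebra_simps)
next
  case False
  then have "cprod C f \<alpha> = 0"
    by (auto simp: cprod_def split: list.split)
  then show ?thesis
    using assms csum_nonneg[of C f \<alpha>] by simp
qed

context pbpa
begin

text \<open>At most two symbols lie outside \<open>C\<close>, hence \<open>2 * \<eta>\<close>; the
  product in the formula for pairs is kept only when both symbols lie in \<open>C\<close>.\<close>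

lemma gsurv_rhs_upper:
  assumes X: "X \<in> \<Gamma>" and \<alpha>: "\<alpha> \<in> set_pmf (\<delta> X)" and s: "0 < s" "s < 1"
    and low: "\<And>Y. Y \<in> set \<alpha> \<Longrightarrow> Y \<notin> C \<Longrightarrow> gsurv \<delta> s [Y] \<le> \<eta>" and \<eta>: "0 \<le> \<eta>"
  shows "gsurv \<delta> s \<alpha> \<le> csum C (\<lambda>Y. gsurv \<delta> s [Y]) \<alpha> + 2 * \<eta> - cprod C (\<lambda>Y. gsurv \<delta> s [Y]) \<alpha>"
  using X \<alpha>
proof (cases rule: rhs_cases)
  case 1
  then show ?thesis using \<eta> by (simp add: csum_def cprod_def)
next
  case (2 Y)
  then show ?thesis using \<eta> low[of Y] by (cases "Y \<in> C") (auto simp: csum_def cprod_def)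
next
  case (3 Y Z)
  have "0 \<le> gsurv \<delta> s [Y] * gsurv \<delta> s [Z]"
    using 3 s by (intro mult_nonneg_nonneg gsurv_nonneg) auto
  then show ?thesis
    using 3 \<eta> low[of Y] low[of Z] gsurv_pair[of Y Z s] s
    by (cases "Y \<in> C"; cases "Z \<in> C") (auto simp: csum_def cprod_def)
qed

lemma gsurv_rhs_lower:
  assumes X: "X \<in> \<Gamma>" and \<alpha>: "\<alpha> \<in> set_pmf (\<delta> X)" and s: "0 < s" "s < 1"
  shows "csum C (\<lambda>Y. gsurv \<delta> s [Y]) \<alpha> - cprod C (\<lambda>Y. gsurv \<delta> s [Y]) \<alpha> \<le> gsurv \<delta> s \<alpha>"
  using X \<alpha>
proof (cases rule: rhs_cases)
  case (2 Y)
  then show ?thesis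
    using gsurv_nonneg[of "[Y]" s] s by (simp add: csum_def cprod_def)
next
  case (3 Y Z)
  then show ?thesis
    using gsurv_pair[of Y Z s] gsurv_ge_mem[of "[Y, Z]" Y s] gsurv_ge_mem[of "[Y, Z]" Z s]
      gsurv_nonneg[of "[Y, Z]" s] s
    by (simp add: csum_def cprod_def)
qed (simp add: csum_def cprod_def)

end

text \<open>Connecting paths must stay inside \<open>C\<close>, because the gap to the superharmonic
  vector is propagated along them and is controlled only on \<open>C\<close>.\<close>

locale pbpa_component = pbpa +
  fixes C :: "'a set"
  assumes C_sub: "C \<subseteq> \<Gamma>" and C_ne: "C \<noteq> {}"
    and C_conn: "\<And>X Y. X \<in> C \<Longrightarrow> Y \<in> C \<Longrightarrow> (X, Y) \<in> (direct_dep \<Gamma> \<delta> \<inter> C \<times> C)\<^sup>*"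
    and terminating: "\<And>X. X \<in> \<Gamma> \<Longrightarrow> (\<lambda>m. surv \<delta> m [X]) \<longlonglongrightarrow> 0"
begin

abbreviation N :: nat where "N \<equiv> card C"

lemma finite_C: "finite C"
  using C_sub finite_\<Gamma> finite_subset by blast

lemma N_pos: "0 < N"
  using finite_C C_ne by (simp add: card_gt_0_iff)

lemma pm_bounds: "0 < pm" "pm \<le> 1"
  using C_ne C_sub pm_pos pm_le_1 by blast+

lemma gC_nonneg: "Y \<in> C \<Longrightarrow> 0 < s \<Longrightarrow> s < 1 \<Longrightarrow> 0 \<le> gsurv \<delta> s [Y]"
  using C_sub by (intro gsurv_nonneg) auto

lemma gC_le_1: "Y \<in> C \<Longrightarrow> 0 < s \<Longrightarrow> s < 1 \<Longrightarrow> gsurv \<delta> s [Y] \<le> 1"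
  using C_sub by (intro gsurv_le_1) auto

lemma C_path:
  assumes "X \<in> C" "Y \<in> C"
  shows "\<exists>k<N. (X, Y) \<in> (direct_dep \<Gamma> \<delta> \<inter> C \<times> C) ^^ k"
  using relpow_less_card[OF finite_C _ C_conn[OF assms] assms(1)] by blast

text \<open>A Harnack inequality: inside \<open>C\<close> any symbol is reached by a path of at most
  \<open>N - 1\<close> edges, each costing a factor \<open>s * pm\<close>.\<close>

lemma gC_compare:
  assumes "X \<in> C" "Y \<in> C" "0 < s" "s < 1"
  shows "(s * pm) ^ (N - 1) * gsurv \<delta> s [Y] \<le> gsurv \<delta> s [X]"
proof -
  obtain k where k: "k < N" "(X, Y) \<in> (direct_dep \<Gamma> \<delta> \<inter> C \<times> C) ^^ k"
    using C_path[OF assms(1,2)] by blast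
  have XY: "(X, Y) \<in> direct_dep \<Gamma> \<delta> ^^ k"
    using k(2) unfolding relpow_fun_conv by blast
  have "s * pm \<le> 1"
    using assms pm_bounds by (intro mult_le_one) auto
  then have "(s * pm) ^ (N - 1) * gsurv \<delta> s [Y] \<le> (s * pm) ^ k * gsurv \<delta> s [Y]"
    using assms pm_bounds k(1) gC_nonneg by (intro mult_right_mono power_decreasing) auto
  also have "\<dots> \<le> gsurv \<delta> s [X]"
    using XY assms by (intro gsurv_relpow)
  finally show ?thesis .
qed

text \<open>
  The vector \<open>V\<close> is a multiple of \<open>\<lambda>X. gsurv \<delta> t [X]\<close> for some \<open>t\<close> close to \<open>1\<close>, scaled so that
  it touches \<open>\<lambda>X. gsurv \<delta> s [X]\<close> from above.
\<close>

lemma approximate_superharmonic: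
  assumes s: "0 < s" "s < 1" and \<theta>: "0 < \<theta>"
  obtains V X1 where "X1 \<in> C" "V X1 = gsurv \<delta> s [X1]"
    "\<And>X. X \<in> C \<Longrightarrow> gsurv \<delta> s [X] \<le> V X"
    "\<And>X. X \<in> C \<Longrightarrow> avg \<delta> X (csum C V) \<le> V X + \<theta>"
proof -
  \<comment> \<open>The Harnack constant for parameters above 1/2, times \<open>N\<close> to pass
    from single values to their sum \<open>m t\<close>.\<close>
  define B where "B = real N * (2 / pm) ^ (N - 1)"
  define m where "m t = (\<Sum>X\<in>C. gsurv \<delta> t [X])" for t
  have "((\<lambda>t. 2 * B * (1 - t * (1 - m t))) \<longlongrightarrow> 2 * B * (1 - 1 * (1 - (\<Sum>X\<in>C. 0)))) (at_left 1)"
    unfolding m_def using C_sub terminating by (intro tendsto_intros gsurv_tendsto_0) auto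
  then have "\<forall>\<^sub>F t in at_left 1. 2 * B * (1 - t * (1 - m t)) < \<theta>"
    using \<theta> by (intro order_tendstoD(2)) auto
  moreover have "\<forall>\<^sub>F t in at_left (1::real). t \<in> {1/2<..<1}"
    by (rule eventually_at_left_real) simp
  ultimately have "\<exists>t. 2 * B * (1 - t * (1 - m t)) < \<theta> \<and> t \<in> {1/2<..<1}"
    by (intro eventually_happens'[OF _ eventually_conj]) auto
  then obtain t where small: "2 * B * (1 - t * (1 - m t)) < \<theta>" and t: "1 / 2 < t" "t < 1"
    by auto
  have t0: "0 < t"
    using t by simp
  define v where "v X = gsurv \<delta> t [X]" for X
  have v_eq: "v X = (1 - t) + t * avg \<delta> X (gsurv \<delta> t)" if "X \<in> C" for X
    using gsurv_Cons[of X "[]" t] that C_sub t t0 by (auto simp: v_def)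
  have gnn: "0 \<le> gsurv \<delta> t \<alpha>" if "X \<in> C" "\<alpha> \<in> set_pmf (\<delta> X)" for X \<alpha>
    using that C_sub t t0 rhs_lists[of X \<alpha>] by (intro gsurv_nonneg) auto
  have v_pos: "0 < v X" if "X \<in> C" for X
    unfolding v_eq[OF that] using t gnn[OF that] by (intro add_pos_nonneg mult_nonneg_nonneg avg_nonneg) auto
  have v_le: "v X \<le> m t" if "X \<in> C" for X
    unfolding m_def v_def using that finite_C gC_nonneg t t0 by (intro member_le_sum) auto
  have m_nonneg: "0 \<le> m t"
    unfolding m_def using gC_nonneg t t0 by (intro sum_nonneg) auto
  have m_le: "m t \<le> B * v X" if X: "X \<in> C" for X
  proof -
    have "v Y \<le> (2 / pm) ^ (N - 1) * v X" if Y: "Y \<in> C" for Y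
    proof -
      have "(1 / 2 * pm) ^ (N - 1) * v Y \<le> (t * pm) ^ (N - 1) * v Y"
        using t pm_bounds v_pos[OF Y] by (intro mult_right_mono power_mono) auto
      also have "\<dots> \<le> v X"
        unfolding v_def using gC_compare X Y t t0 by blast
      finally have "(2 / pm) ^ (N - 1) * ((1 / 2 * pm) ^ (N - 1) * v Y) \<le> (2 / pm) ^ (N - 1) * v X"
        using pm_bounds by (intro mult_left_mono) auto
      then show ?thesis
        using pm_bounds by (simp flip: mult.assoc power_mult_distrib)
    qed
    then have "m t \<le> (\<Sum>Y\<in>C. (2 / pm) ^ (N - 1) * v X)"
      unfolding m_def v_def by (intro sum_mono)
    then show ?thesis
      by (simp add: B_def)
  qed
  define r where "r X = gsurv \<delta> s [X] / v X" for X
  have "Max (r ` C) \<in> r ` C"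
    using finite_C C_ne by (intro Max_in) auto
  then obtain X1 where X1: "X1 \<in> C" "r X1 = Max (r ` C)"
    by (metis imageE)
  then have r_le: "r X \<le> r X1" if "X \<in> C" for X
    using finite_C that by simp
  define \<kappa> where "\<kappa> = r X1"
  have \<kappa>: "0 \<le> \<kappa>"
    using v_pos[OF X1(1)] gC_nonneg[OF X1(1) s] by (simp add: \<kappa>_def r_def)
  \<comment> \<open>The scale \<open>\<kappa>\<close> may blow up as \<open>t\<close> tends to 1,
    but \<open>\<kappa> * v X1\<close> is a probability, so the scaled vector stays bounded by
    \<open>B\<close> uniformly in \<open>t\<close>.\<close>
  have \<kappa>m: "\<kappa> * m t \<le> B"
  proof -
    have B: "0 \<le> B"
      using pm_bounds by (simp add: B_def)
    have "\<kappa> * m t \<le> \<kappa> * (B * v X1)"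
      using \<kappa> m_le[OF X1(1)] by (intro mult_left_mono)
    also have "\<dots> = gsurv \<delta> s [X1] * B"
      using v_pos[OF X1(1)] by (simp add: \<kappa>_def r_def)
    also have "\<dots> \<le> B"
      using gC_le_1[OF X1(1) s] gC_nonneg[OF X1(1) s] B by (intro mult_left_le_one_le) auto
    finally show ?thesis .
  qed
  show thesis
  proof (rule that[OF X1(1), of "\<lambda>X. \<kappa> * v X"])
    show "\<kappa> * v X1 = gsurv \<delta> s [X1]"
      using v_pos[OF X1(1)] by (simp add: \<kappa>_def r_def)
    show "gsurv \<delta> s [X] \<le> \<kappa> * v X" if "X \<in> C" for X
      using r_le[OF that] v_pos[OF that] by (simp add: \<kappa>_def r_def divide_le_eq)
    show "avg \<delta> X (csum C (\<lambda>X. \<kappa> * v X)) \<le> \<kappa> * v X + \<theta>" if X: "X \<in> C" for X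
    proof -
      define W where "W = avg \<delta> X (csum C v)"
      have X\<Gamma>: "X \<in> \<Gamma>"
        using X C_sub by blast
      have v_nn: "0 \<le> v Y" if "Y \<in> C" for Y
        using v_pos[OF that] by simp
      have "(1 - m t) * W = avg \<delta> X (\<lambda>\<alpha>. csum C v \<alpha> - m t * csum C v \<alpha>)"
        by (simp add: W_def avg_diff avg_cmult algebra_simps)
      also have "\<dots> \<le> avg \<delta> X (\<lambda>\<alpha>. csum C v \<alpha> - cprod C v \<alpha>)"
        using cprod_le_csum[of C v "m t"] v_nn v_le m_nonneg by (intro avg_mono diff_left_mono) auto
      also have "\<dots> \<le> avg \<delta> X (gsurv \<delta> t)"
        unfolding v_def using gsurv_rhs_lower[OF X\<Gamma> _ t0 t(2)] by (intro avg_mono)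
      finally have "t * ((1 - m t) * W) \<le> t * avg \<delta> X (gsurv \<delta> t)"
        using t0 by (intro mult_left_mono) auto
      then have A: "t * (1 - m t) * W \<le> v X"
        unfolding v_eq[OF X] mult.assoc using t by linarith
      have W2: "W \<le> 2 * m t"
        unfolding W_def
      proof (rule avg_le_const[OF X\<Gamma>])
        fix \<alpha> assume \<alpha>: "\<alpha> \<in> set_pmf (\<delta> X)"
        have "csum C v \<alpha> \<le> real (length \<alpha>) * m t"
          using v_le m_nonneg by (rule csum_le_length)
        also have "\<dots> \<le> 2 * m t"
          using rhs_length[OF X\<Gamma> \<alpha>] m_nonneg by (intro mult_right_mono) auto
        finally show "csum C v \<alpha> \<le> 2 * m t" .
      qed
      have nn: "0 \<le> 1 - t * (1 - m t)"
      proof -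
        have "0 \<le> t * m t"
          using m_nonneg t0 by simp
        then show ?thesis
          using t unfolding right_diff_distrib by simp
      qed
      \<comment> \<open>The factor \<open>t * (1 - m t)\<close> by which \<open>v\<close> misses
        superharmonicity is moved into an additive error, where \<open>W \<le> 2 * m t\<close> makes
        it harmless after scaling by \<open>\<kappa>\<close>.\<close>
      have "W \<le> v X + (1 - t * (1 - m t)) * W"
        using A by (simp add: algebra_simps)
      also have "\<dots> \<le> v X + (1 - t * (1 - m t)) * (2 * m t)"
        using nn W2 by (intro add_left_mono mult_left_mono)
      finally have "\<kappa> * W \<le> \<kappa> * (v X + (1 - t * (1 - m t)) * (2 * m t))"
        using \<kappa> by (intro mult_left_mono)
      also have "\<dots> = \<kappa> * v X + 2 * (1 - t * (1 - m t)) * (\<kappa> * m t)"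
        by (simp add: algebra_simps)
      also have "\<dots> \<le> \<kappa> * v X + 2 * (1 - t * (1 - m t)) * B"
        using nn \<kappa>m by (intro add_left_mono mult_left_mono) auto
      also have "\<dots> \<le> \<kappa> * v X + \<theta>"
        using small by (simp add: mult_ac)
      finally show ?thesis
        unfolding W_def avg_cmult[symmetric] csum_cmult[symmetric] .
    qed
  qed
qed

context
  fixes s \<eta> :: real
  assumes s: "0 < s" "s < 1" and \<eta>: "0 \<le> \<eta>"
    and low: "\<And>X \<alpha> Y. X \<in> C \<Longrightarrow> \<alpha> \<in> set_pmf (\<delta> X) \<Longrightarrow> Y \<in> set \<alpha> \<Longrightarrow> Y \<notin> C \<Longrightarrow> gsurv \<delta> s [Y] \<le> \<eta>"
begin

abbreviation g :: "'a \<Rightarrow> real" where "g Y \<equiv> gsurv \<delta> s [Y]"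

text \<open>First-step equation with the symbols below \<open>C\<close> replaced by
  \<open>\<eta>\<close>. The factor \<open>s\<close> is dropped on the linear part, but must stay on
  the quadratic one, which enters with the opposite sign.\<close>

lemma gC_upper:
  assumes X: "X \<in> C"
  shows "g X + s * avg \<delta> X (cprod C g) \<le> (1 - s) + 2 * \<eta> + avg \<delta> X (csum C g)"
proof -
  have X\<Gamma>: "X \<in> \<Gamma>"
    using X C_sub by blast
  have "avg \<delta> X (gsurv \<delta> s) \<le> avg \<delta> X (\<lambda>\<alpha>. csum C g \<alpha> + 2 * \<eta> - cprod C g \<alpha>)"
    using gsurv_rhs_upper[OF X\<Gamma> _ s low[OF X] \<eta>] by (intro avg_mono)
  also have "\<dots> = avg \<delta> X (csum C g) + 2 * \<eta> - avg \<delta> X (cprod C g)"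
    by (simp add: avg_diff avg_add avg_const[OF X\<Gamma>])
  finally have "s * avg \<delta> X (gsurv \<delta> s) \<le> s * (avg \<delta> X (csum C g) + 2 * \<eta> - avg \<delta> X (cprod C g))"
    using s by (intro mult_left_mono) auto
  moreover have "s * (avg \<delta> X (csum C g) + 2 * \<eta>) \<le> avg \<delta> X (csum C g) + 2 * \<eta>"
    using s \<eta> gC_nonneg by (intro mult_left_le_one_le add_nonneg_nonneg avg_nonneg csum_nonneg) auto
  ultimately show ?thesis
    using gsurv_Cons[OF X\<Gamma>, of "[]" s] s by (simp add: algebra_simps)
qed

context
  fixes V :: "'a \<Rightarrow> real" and \<theta> :: real and X1 :: 'a
  assumes V_ge: "\<And>X. X \<in> C \<Longrightarrow> g X \<le> V X" and X1: "X1 \<in> C" "V X1 = g X1"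
    and V_super: "\<And>X. X \<in> C \<Longrightarrow> avg \<delta> X (csum C V) \<le> V X + \<theta>" and \<theta>: "0 \<le> \<theta>"
begin

abbreviation defect :: real where "defect \<equiv> (1 - s) + 2 * \<eta> + \<theta>"

text \<open>Subtracting the bound for \<open>g\<close> from superharmonicity of \<open>V\<close>
  turns the linear parts into the average of the gap, which is nonnegative, so the quadratic term of
  \<open>g\<close> is bounded by gap plus \<open>defect\<close>.\<close>

lemma gap_step:
  assumes X: "X \<in> C"
  shows "avg \<delta> X (csum C (\<lambda>Y. V Y - g Y)) + s * avg \<delta> X (cprod C g) \<le> V X - g X + defect"
proof -
  have "avg \<delta> X (csum C (\<lambda>Y. V Y - g Y)) = avg \<delta> X (csum C V) - avg \<delta> X (csum C g)"
    unfolding avg_diff[symmetric] csum_diff[symmetric] ..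
  then show ?thesis
    using V_super[OF X] gC_upper[OF X] by linarith
qed

text \<open>The gap is 0 at the touching symbol \<open>X1\<close>. One edge adds
  \<open>defect\<close> and divides by at least \<open>pm\<close>, because the average of the gap
  dominates \<open>pm\<close> times its value at the successor.\<close>

lemma gap_relpow:
  "(X1, X) \<in> (direct_dep \<Gamma> \<delta> \<inter> C \<times> C) ^^ k \<Longrightarrow> V X - g X \<le> real k * defect / pm ^ k"
proof (induction k arbitrary: X)
  case 0
  then show ?case using X1 by simp
next
  case (Suc k)
  then obtain Z where Z: "(X1, Z) \<in> (direct_dep \<Gamma> \<delta> \<inter> C \<times> C) ^^ k" "(Z, X) \<in> direct_dep \<Gamma> \<delta>" "Z \<in> C" "X \<in> C"
    by auto
  then obtain \<alpha> where \<alpha>: "Z \<in> \<Gamma>" "\<alpha> \<in> set_pmf (\<delta> Z)" "X \<in> set \<alpha>"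
    by (auto simp: direct_dep_def rules_def)
  have nn: "0 \<le> V Y - g Y" if "Y \<in> C" for Y
    using V_ge[OF that] by simp
  have "pm * (V X - g X) \<le> pm * csum C (\<lambda>Y. V Y - g Y) \<alpha>"
    using pm_bounds csum_ge_mem[of C "\<lambda>Y. V Y - g Y" X \<alpha>] nn Z(4) \<alpha>(3) by (intro mult_left_mono) auto
  also have "\<dots> \<le> avg \<delta> Z (csum C (\<lambda>Y. V Y - g Y))"
    using \<alpha> nn by (intro avg_ge_pm csum_nonneg) auto
  also have "\<dots> \<le> V Z - g Z + defect"
  proof -
    have "0 \<le> s * avg \<delta> Z (cprod C g)"
      using s gC_nonneg by (intro mult_nonneg_nonneg avg_nonneg cprod_nonneg) auto
    then show ?thesis using gap_step[OF Z(3)] by linarith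
  qed
  also have "\<dots> \<le> real k * defect / pm ^ k + defect / pm ^ k"
  proof (rule add_mono)
    show "V Z - g Z \<le> real k * defect / pm ^ k"
      by (rule Suc.IH[OF Z(1)])
    have "defect * pm ^ k \<le> defect * 1"
      using s \<eta> \<theta> pm_bounds by (intro mult_left_mono power_le_one) auto
    then show "defect \<le> defect / pm ^ k"
      using pm_bounds by (simp add: le_divide_eq)
  qed
  also have "\<dots> = real (Suc k) * defect / pm ^ k"
    by (simp only: of_nat_Suc distrib_right mult_1 add_divide_distrib add.commute)
  finally show ?case
    using pm_bounds by (simp add: field_simps)
qed

lemma gap_bound:
  assumes X: "X \<in> C"
  shows "V X - g X + defect \<le> real N * defect / pm ^ N"
proof -
  obtain k where k: "k < N" "(X1, X) \<in> (direct_dep \<Gamma> \<delta> \<inter> C \<times> C) ^^ k"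
    using C_path[OF X1(1) X] by blast
  have d: "0 \<le> defect"
    using s \<eta> \<theta> by simp
  have p: "pm ^ N \<le> pm ^ k" "pm ^ N \<le> 1" "0 < pm ^ N" "0 < pm ^ k"
    using k(1) pm_bounds by (auto intro: power_decreasing power_le_one)
  have "V X - g X \<le> real k * defect / pm ^ k"
    by (rule gap_relpow[OF k(2)])
  also have "\<dots> \<le> real k * defect / pm ^ N"
    using p d by (intro divide_left_mono) auto
  finally have "V X - g X + defect \<le> real k * defect / pm ^ N + defect / pm ^ N"
    using p d mult_left_mono[OF p(2) d] by (intro add_mono) (auto simp: le_divide_eq)
  also have "\<dots> = real (Suc k) * defect / pm ^ N"
    by (simp only: of_nat_Suc distrib_right mult_1 add_divide_distrib add.commute)
  also have "\<dots> \<le> real N * defect / pm ^ N"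
    using k(1) p d by (intro divide_right_mono mult_right_mono) auto
  finally show ?thesis .
qed

end

text \<open>The rule for \<open>Z\<close> bounds the quadratic term there from below by
  \<open>pm * g Y1 * g Y2\<close>, and \<open>gC_compare\<close> replaces both values by
  \<open>g X\<close>: a power \<open>1 + 2 * (N - 1)\<close>, rounded up to
  \<open>2 * N\<close>.\<close>

lemma component_bound_binary:
  assumes Z: "Z \<in> C" "[Y1, Y2] \<in> set_pmf (\<delta> Z)" "Y1 \<in> C" "Y2 \<in> C" and X: "X \<in> C"
  shows "(s * pm) ^ (2 * N) * (g X)\<^sup>2 \<le> real N * (2 * (1 - s) + 2 * \<eta>) / pm ^ N"
proof -
  \<comment> \<open>The error \<open>1 - s\<close> has the size of the killing term already present,
    so \<open>defect\<close> becomes \<open>2 * (1 - s) + 2 * \<eta>\<close>.\<close>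
  obtain V X1 where V: "X1 \<in> C" "V X1 = g X1" "\<And>X. X \<in> C \<Longrightarrow> g X \<le> V X"
    "\<And>X. X \<in> C \<Longrightarrow> avg \<delta> X (csum C V) \<le> V X + (1 - s)"
    using approximate_superharmonic[OF s, of "1 - s"] s(2) by (metis diff_gt_0_iff_gt)
  have Z\<Gamma>: "Z \<in> \<Gamma>"
    using Z(1) C_sub by blast
  let ?q = "s * pm"
  have q: "0 < ?q" "?q \<le> 1"
    using s pm_bounds by (auto intro: mult_le_one)
  have gX: "0 \<le> g X"
    using gC_nonneg[OF X s] .
  have "?q ^ (2 * N) * (g X)\<^sup>2 \<le> ?q ^ (1 + (N - 1) + (N - 1)) * (g X)\<^sup>2"
    using q N_pos by (intro mult_right_mono power_decreasing) auto
  also have "\<dots> = ?q * ((?q ^ (N - 1) * g X) * (?q ^ (N - 1) * g X))"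
    by (simp add: power_add power2_eq_square)
  also have "\<dots> \<le> ?q * (g Y1 * g Y2)"
    using q gX gC_compare[OF Z(3) X s] gC_compare[OF Z(4) X s] gC_nonneg[OF Z(3) s]
    by (intro mult_left_mono mult_mono) auto
  also have "\<dots> = s * (pm * cprod C g [Y1, Y2])"
    using Z by (simp add: cprod_def)
  also have "\<dots> \<le> s * avg \<delta> Z (cprod C g)"
    using s Z\<Gamma> Z(2) gC_nonneg by (intro mult_left_mono avg_ge_pm cprod_nonneg) auto
  also have "\<dots> \<le> V Z - g Z + ((1 - s) + 2 * \<eta> + (1 - s))"
  proof -
    have "0 \<le> avg \<delta> Z (csum C (\<lambda>Y. V Y - g Y))"
      using V(3) by (intro avg_nonneg csum_nonneg) simp
    then show ?thesis
      using gap_step[OF V(3,1,2,4) _ Z(1)] s by simp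
  qed
  also have "\<dots> \<le> real N * ((1 - s) + 2 * \<eta> + (1 - s)) / pm ^ N"
    using gap_bound[OF V(3,1,2,4) _ Z(1)] s by simp
  finally show ?thesis
    by (simp add: algebra_simps)
qed

text \<open>Otherwise every rule of a symbol of \<open>C\<close> keeps some symbol of
  \<open>C\<close> on the stack, and a run starting in \<open>C\<close> never terminates.\<close>

lemma component_exit:
  obtains Z \<alpha> where "Z \<in> C" "\<alpha> \<in> set_pmf (\<delta> Z)" "set \<alpha> \<inter> C = {}"
proof (rule ccontr)
  assume no: "\<not> thesis"
  have *: "set \<alpha> \<inter> C \<noteq> {}" if "Z \<in> C" "\<alpha> \<in> set_pmf (\<delta> Z)" for Z \<alpha>
    using no that \<open>\<And>Z \<alpha>. Z \<in> C \<Longrightarrow> \<alpha> \<in> set_pmf (\<delta> Z) \<Longrightarrow> set \<alpha> \<inter> C = {} \<Longrightarrow> thesis\<close> by blast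
  have alive: "1 \<le> surv \<delta> n \<alpha>" if "\<alpha> \<in> lists \<Gamma>" "set \<alpha> \<inter> C \<noteq> {}" for n \<alpha>
    using that
  proof (induction n arbitrary: \<alpha>)
    case (Suc n)
    then obtain X \<beta> where \<alpha>: "\<alpha> = X # \<beta>"
      by (cases \<alpha>) auto
    with Suc.prems have X: "X \<in> \<Gamma>" and \<beta>: "\<beta> \<in> lists \<Gamma>" by auto
    have "1 \<le> avg \<delta> X (\<lambda>\<gamma>. surv \<delta> n (\<gamma> @ \<beta>))"
    proof (intro avg_ge_const[OF X] Suc.IH app_lists[OF X _ \<beta>])
      show "set (\<gamma> @ \<beta>) \<inter> C \<noteq> {}" if "\<gamma> \<in> set_pmf (\<delta> X)" for \<gamma>
        using *[of X \<gamma>] that Suc.prems(2) \<alpha> by auto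
    qed
    then show ?case
      by (simp add: \<alpha>)
  qed auto
  obtain X where X: "X \<in> C"
    using C_ne by blast
  then have "1 \<le> surv \<delta> n [X]" for n
    using alive[of "[X]" n] C_sub by auto
  moreover have "(\<lambda>n. surv \<delta> n [X]) \<longlonglongrightarrow> 0"
    using terminating X C_sub by blast
  ultimately have "(1::real) \<le> 0"
    by (intro LIMSEQ_le_const[of "\<lambda>n. surv \<delta> n [X]"]) auto
  then show False by simp
qed

text \<open>With at most one symbol of \<open>C\<close> per right-hand side, the constant vector
  \<open>\<kappa>\<close> is superharmonic and touches \<open>g\<close> at its maximum. At an exit
  rule it loses \<open>pm * \<kappa>\<close>, which replaces the quadratic term. The resulting
  linear bound is weakened by \<open>(g X)\<^sup>2 \<le> \<kappa>\<close> to the common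
  form.\<close>

lemma component_bound_linear:
  assumes lin: "\<And>Z Y1 Y2. Z \<in> C \<Longrightarrow> [Y1, Y2] \<in> set_pmf (\<delta> Z) \<Longrightarrow> \<not> (Y1 \<in> C \<and> Y2 \<in> C)" and X: "X \<in> C"
  shows "(s * pm) ^ (2 * N) * (g X)\<^sup>2 \<le> real N * (2 * (1 - s) + 2 * \<eta>) / pm ^ N"
proof -
  define \<kappa> where "\<kappa> = Max (g ` C)"
  have "\<kappa> \<in> g ` C"
    unfolding \<kappa>_def using finite_C C_ne by (intro Max_in) auto
  then obtain X1 where X1: "X1 \<in> C" "\<kappa> = g X1"
    by blast
  have g_le: "g Y \<le> \<kappa>" if "Y \<in> C" for Y
    unfolding \<kappa>_def using finite_C that by (intro Max_ge) auto
  have \<kappa>: "0 \<le> \<kappa>"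
    using X1 gC_nonneg s by simp
  have csum_le: "csum C (\<lambda>_. \<kappa>) \<alpha> \<le> \<kappa>" if Z: "Z \<in> C" "\<alpha> \<in> set_pmf (\<delta> Z)" for Z \<alpha>
  proof -
    have "Z \<in> \<Gamma>"
      using Z(1) C_sub by blast
    then show ?thesis
      using Z(2)
    proof (cases rule: rhs_cases)
      case (3 Y1 Y2)
      then have "\<not> (Y1 \<in> C \<and> Y2 \<in> C)"
        using lin Z by blast
      with 3 \<kappa> show ?thesis by (auto simp: csum_def)
    qed (use \<kappa> in \<open>auto simp: csum_def\<close>)
  qed
  have super: "avg \<delta> Z (csum C (\<lambda>_. \<kappa>)) \<le> \<kappa> + (1 - s)" if "Z \<in> C" for Z
  proof -
    have "avg \<delta> Z (csum C (\<lambda>_. \<kappa>)) \<le> \<kappa>"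
      using that C_sub csum_le by (intro avg_le_const) auto
    then show ?thesis using s by simp
  qed
  obtain Z \<alpha> where Z: "Z \<in> C" "\<alpha> \<in> set_pmf (\<delta> Z)" "set \<alpha> \<inter> C = {}"
    by (rule component_exit)
  have Z\<Gamma>: "Z \<in> \<Gamma>"
    using Z(1) C_sub by blast
  have "filter (\<lambda>Y. Y \<in> C) \<alpha> = []"
    using Z(3) by (auto simp: filter_empty_conv)
  then have "pm * \<kappa> = pm * (\<kappa> - csum C (\<lambda>_. \<kappa>) \<alpha>)"
    by (simp add: csum_def)
  also have "\<dots> \<le> avg \<delta> Z (\<lambda>\<alpha>. \<kappa> - csum C (\<lambda>_. \<kappa>) \<alpha>)"
    using csum_le[OF Z(1)] by (intro avg_ge_pm[OF Z\<Gamma> Z(2), of "\<lambda>\<alpha>. \<kappa> - csum C (\<lambda>_. \<kappa>) \<alpha>"]) simp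
  also have "\<dots> = \<kappa> - avg \<delta> Z (csum C (\<lambda>_. \<kappa>))"
    by (simp add: avg_diff avg_const[OF Z\<Gamma>])
  also have "\<dots> \<le> \<kappa> - avg \<delta> Z (csum C g)"
    using g_le by (intro diff_left_mono avg_mono csum_mono)
  also have "\<dots> \<le> \<kappa> - g Z + ((1 - s) + 2 * \<eta> + (1 - s))"
  proof -
    have "0 \<le> s * avg \<delta> Z (cprod C g)"
      using s gC_nonneg by (intro mult_nonneg_nonneg avg_nonneg cprod_nonneg) auto
    then show ?thesis
      using gC_upper[OF Z(1)] s by simp
  qed
  also have "\<dots> \<le> real N * ((1 - s) + 2 * \<eta> + (1 - s)) / pm ^ N"
    using gap_bound[of "\<lambda>_. \<kappa>" X1 "1 - s" Z, OF g_le X1 super _ Z(1)] s by simp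
  finally have bound: "pm * \<kappa> \<le> real N * (2 * (1 - s) + 2 * \<eta>) / pm ^ N"
    by (simp add: algebra_simps)
  have q: "0 \<le> s * pm" "s * pm \<le> 1" "s * pm \<le> pm"
    using s pm_bounds by (auto intro: mult_le_one)
  have "(s * pm) ^ (2 * N) \<le> (s * pm) ^ 1"
    using q N_pos by (intro power_decreasing) auto
  then have "(s * pm) ^ (2 * N) \<le> pm"
    using q by simp
  moreover have "(g X)\<^sup>2 \<le> \<kappa>"
    using g_le[OF X] gC_nonneg[OF X s] gC_le_1[OF X s] mult_left_le[of "g X" "g X"]
    by (simp add: power2_eq_square)
  ultimately have "(s * pm) ^ (2 * N) * (g X)\<^sup>2 \<le> pm * \<kappa>"
    using pm_bounds by (intro mult_mono) auto
  with bound show ?thesis by simp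
qed

lemma component_bound:
  assumes X: "X \<in> C"
  shows "(s * pm) ^ (2 * N) * (g X)\<^sup>2 \<le> real N * (2 * (1 - s) + 2 * \<eta>) / pm ^ N"
proof (cases "\<exists>Z\<in>C. \<exists>Y1\<in>C. \<exists>Y2\<in>C. [Y1, Y2] \<in> set_pmf (\<delta> Z)")
  case True
  then show ?thesis
    using component_bound_binary X by blast
next
  case False
  show ?thesis
    by (rule component_bound_linear[OF _ X]) (use False in blast)
qed

end

end

section \<open>The tower of components\<close>

context pbpa
begin

definition scc :: "'a \<Rightarrow> 'a set" where
  "scc X = {Y \<in> \<Gamma>. (X, Y) \<in> (direct_dep \<Gamma> \<delta>)\<^sup>* \<and> (Y, X) \<in> (direct_dep \<Gamma> \<delta>)\<^sup>*}"

lemma mem_scc_self: "X \<in> \<Gamma> \<Longrightarrow> X \<in> scc X"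
  by (simp add: scc_def)

lemma scc_eq: "Y \<in> scc X \<Longrightarrow> scc Y = scc X"
  unfolding scc_def by (blast intro: rtrancl_trans)

lemma sccs_eq: "sccs \<Gamma> \<delta> = scc ` \<Gamma>"
  unfolding sccs_def quotient_def scc_def by auto

text \<open>Every symbol on a path between two members both reaches and is reached from the
  component, so the path never leaves it.\<close>

lemma scc_conn:
  assumes "Y \<in> scc X" "Z \<in> scc X"
  shows "(Y, Z) \<in> (direct_dep \<Gamma> \<delta> \<inter> scc X \<times> scc X)\<^sup>*"
proof -
  let ?R = "direct_dep \<Gamma> \<delta>"
  have "(Y, Z) \<in> ?R\<^sup>*"
    using assms unfolding scc_def by (blast intro: rtrancl_trans)
  moreover have "(W, Z) \<in> ?R\<^sup>* \<longrightarrow> (Y, W) \<in> (?R \<inter> scc X \<times> scc X)\<^sup>*" if "(Y, W) \<in> ?R\<^sup>*" for W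
    using that
  proof (induction rule: rtrancl_induct)
    case (step W W')
    show ?case
    proof
      assume W'Z: "(W', Z) \<in> ?R\<^sup>*"
      then have WZ: "(W, Z) \<in> ?R\<^sup>*"
        using step.hyps(2) by (rule converse_rtrancl_into_rtrancl[rotated])
      have YW': "(Y, W') \<in> ?R\<^sup>*"
        using step.hyps by (rule rtrancl_into_rtrancl)
      have "W \<in> scc X" "W' \<in> scc X"
        using assms WZ W'Z step.hyps(1) YW' direct_dep_\<Gamma>[OF step.hyps(2)] unfolding scc_def
        by (blast intro: rtrancl_trans)+
      then show "(Y, W') \<in> (?R \<inter> scc X \<times> scc X)\<^sup>*"
        using step WZ by (meson IntI SigmaI rtrancl_into_rtrancl)
    qed
  qed simp
  ultimately show ?thesis by blast
qed

lemma scc_edge_rhs: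
  assumes "X \<in> \<Gamma>" "Z \<in> scc X" "\<alpha> \<in> set_pmf (\<delta> Z)" "Y \<in> set \<alpha>" "Y \<notin> scc X"
  shows "Y \<in> \<Gamma>" "(scc X, scc Y) \<in> scc_edge \<Gamma> \<delta>"
proof -
  have ZY: "(Z, Y) \<in> direct_dep \<Gamma> \<delta>"
    using assms by (auto simp: direct_dep_def rules_def scc_def)
  then show Y: "Y \<in> \<Gamma>"
    using direct_dep_\<Gamma> by blast
  then have "Y \<in> scc Y"
    by (rule mem_scc_self)
  with assms Y ZY show "(scc X, scc Y) \<in> scc_edge \<Gamma> \<delta>"
    unfolding scc_edge_def sccs_eq by auto
qed

text \<open>A natural number that drops strictly along component edges: it witnesses acyclicity,
  bounds path lengths and drives the induction towards bottom components.\<close>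

definition rank :: "'a set \<Rightarrow> nat" where
  "rank C = card {Y \<in> \<Gamma>. \<exists>X\<in>C. (X, Y) \<in> (direct_dep \<Gamma> \<delta>)\<^sup>*}"

lemma rank_edge:
  assumes "(C, D) \<in> scc_edge \<Gamma> \<delta>"
  shows "rank D < rank C"
proof -
  let ?R = "direct_dep \<Gamma> \<delta>"
  obtain X Y where X: "X \<in> \<Gamma>" "C = scc X" and Y: "Y \<in> \<Gamma>" "D = scc Y" and ne: "C \<noteq> D"
    using assms unfolding scc_edge_def sccs_eq by auto
  obtain U W where UW: "U \<in> C" "W \<in> D" "(U, W) \<in> ?R"
    using assms unfolding scc_edge_def by auto
  have CD: "(X', Y') \<in> ?R\<^sup>*" if "X' \<in> C" "Y' \<in> D" for X' Y'
  proof -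
    have "(X', U) \<in> ?R\<^sup>*" "(W, Y') \<in> ?R\<^sup>*"
      using that UW X Y unfolding scc_def by (blast intro: rtrancl_trans)+
    then show ?thesis
      using UW(3) by (meson converse_rtrancl_into_rtrancl rtrancl_trans)
  qed
  have DC: "(Y', X) \<notin> ?R\<^sup>*" if "Y' \<in> D" for Y'
  proof
    assume "(Y', X) \<in> ?R\<^sup>*"
    moreover have "(X, Y') \<in> ?R\<^sup>*"
      using CD[of X Y'] that mem_scc_self X by blast
    moreover have "Y' \<in> \<Gamma>"
      using that Y by (simp add: scc_def)
    ultimately have "Y' \<in> scc X"
      by (simp add: scc_def)
    then show False
      using scc_eq[of Y' X] scc_eq[of Y' Y] that X(2) Y(2) ne by simp
  qed
  have "{Z \<in> \<Gamma>. \<exists>Y\<in>D. (Y, Z) \<in> ?R\<^sup>*} \<subset> {Z \<in> \<Gamma>. \<exists>X\<in>C. (X, Z) \<in> ?R\<^sup>*}"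
  proof
    show "{Z \<in> \<Gamma>. \<exists>Y\<in>D. (Y, Z) \<in> ?R\<^sup>*} \<subseteq> {Z \<in> \<Gamma>. \<exists>X\<in>C. (X, Z) \<in> ?R\<^sup>*}"
      using CD UW(1) by (blast intro: rtrancl_trans)
    have "X \<in> {Z \<in> \<Gamma>. \<exists>X\<in>C. (X, Z) \<in> ?R\<^sup>*}"
      using X mem_scc_self by auto
    moreover have "X \<notin> {Z \<in> \<Gamma>. \<exists>Y\<in>D. (Y, Z) \<in> ?R\<^sup>*}"
      using DC by blast
    ultimately show "{Z \<in> \<Gamma>. \<exists>Y\<in>D. (Y, Z) \<in> ?R\<^sup>*} \<noteq> {Z \<in> \<Gamma>. \<exists>X\<in>C. (X, Z) \<in> ?R\<^sup>*}"
      by blast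
  qed
  then show ?thesis
    unfolding rank_def using finite_\<Gamma> by (intro psubset_card_mono) auto
qed

lemma rank_relpow: "(C, D) \<in> scc_edge \<Gamma> \<delta> ^^ k \<Longrightarrow> rank D + k \<le> rank C"
proof (induction k arbitrary: D)
  case (Suc k)
  then obtain E where "(C, E) \<in> scc_edge \<Gamma> \<delta> ^^ k" "(E, D) \<in> scc_edge \<Gamma> \<delta>"
    by auto
  then show ?case
    using Suc.IH[of E] rank_edge[of E D] by simp
qed simp

lemma reach_bottom:
  "C \<in> sccs \<Gamma> \<delta> \<Longrightarrow> \<exists>D j. bottom_scc \<Gamma> \<delta> D \<and> (C, D) \<in> scc_edge \<Gamma> \<delta> ^^ j"
proof (induction "rank C" arbitrary: C rule: less_induct)
  case less
  show ?case
  proof (cases "\<exists>D. (C, D) \<in> scc_edge \<Gamma> \<delta>")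
    case True
    then obtain D where D: "(C, D) \<in> scc_edge \<Gamma> \<delta>" by blast
    then have "D \<in> sccs \<Gamma> \<delta>"
      by (simp add: scc_edge_def)
    then obtain E j where "bottom_scc \<Gamma> \<delta> E" "(D, E) \<in> scc_edge \<Gamma> \<delta> ^^ j"
      using less.hyps rank_edge[OF D] by blast
    then show ?thesis
      using D by (meson relpow_Suc_I2)
  next
    case False
    then have "bottom_scc \<Gamma> \<delta> C" "(C, C) \<in> scc_edge \<Gamma> \<delta> ^^ 0"
      using less.prems by (auto simp: bottom_scc_def)
    then show ?thesis by blast
  qed
qed

text \<open>The component of \<open>X0\<close> is top, and any path from it extends to a bottom
  component. A path with as many edges as the height would therefore exceed the maximum defining the
  height.\<close>

lemma no_scc_path_of_height:
  assumes X0: "X0 \<in> \<Gamma>" and dep: "\<And>X. X \<in> \<Gamma> \<Longrightarrow> (X0, X) \<in> (direct_dep \<Gamma> \<delta>)\<^sup>*"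
  shows "(scc X0, D) \<notin> scc_edge \<Gamma> \<delta> ^^ scc_height \<Gamma> \<delta>"
proof
  let ?E = "scc_edge \<Gamma> \<delta>" and ?h = "scc_height \<Gamma> \<delta>"
  let ?S = "{k. \<exists>C D. top_scc \<Gamma> \<delta> C \<and> bottom_scc \<Gamma> \<delta> D \<and> (C, D) \<in> ?E ^^ k}"
  assume D: "(scc X0, D) \<in> ?E ^^ ?h"
  have "k \<le> card \<Gamma>" if "(C, D) \<in> ?E ^^ k" for C D k
  proof -
    have "rank C \<le> card \<Gamma>"
      unfolding rank_def by (intro card_mono finite_\<Gamma>) auto
    then show ?thesis
      using rank_relpow[OF that] by simp
  qed
  then have "?S \<subseteq> {..card \<Gamma>}"
    by auto
  then have fin: "finite ?S"
    using finite_subset by blast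
  \<comment> \<open>The height is positive, so the path has a last edge and \<open>D\<close> is
    indeed a component.\<close>
  have "?h = Suc (?h - 1)"
    by (simp add: scc_height_def)
  then obtain D' where "(D', D) \<in> ?E"
    using D by (metis relpow_Suc_E)
  then have "D \<in> sccs \<Gamma> \<delta>"
    by (simp add: scc_edge_def)
  then obtain B j where B: "bottom_scc \<Gamma> \<delta> B" "(D, B) \<in> ?E ^^ j"
    using reach_bottom by blast
  have "top_scc \<Gamma> \<delta> (scc X0)"
    unfolding top_scc_def
  proof (intro conjI notI)
    show "scc X0 \<in> sccs \<Gamma> \<delta>"
      using X0 by (simp add: sccs_eq)
    assume "\<exists>D. (D, scc X0) \<in> ?E"
    then obtain C where C: "(C, scc X0) \<in> ?E" by blast
    then obtain Y where Y: "Y \<in> \<Gamma>" "C = scc Y" "scc Y \<noteq> scc X0"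
      unfolding scc_edge_def sccs_eq by auto
    obtain U W where "U \<in> scc Y" "W \<in> scc X0" "(U, W) \<in> direct_dep \<Gamma> \<delta>"
      using C Y(2) unfolding scc_edge_def by auto
    then have "(Y, X0) \<in> (direct_dep \<Gamma> \<delta>)\<^sup>*"
      unfolding scc_def by (blast intro: rtrancl_trans r_into_rtrancl)
    then have "Y \<in> scc X0"
      using Y(1) dep by (simp add: scc_def)
    then show False
      using scc_eq Y(3) by blast
  qed
  moreover have "(scc X0, B) \<in> ?E ^^ (?h + j)"
    using D B(2) by (auto simp: relpow_add)
  ultimately have "?h + j \<in> ?S"
    using B(1) by blast
  then have "?h + j \<le> Max ?S"
    using fin by (rule Max_ge[rotated])
  then show False
    by (simp add: scc_height_def)
qed

section \<open>Upper tail bounds for almost surely terminating systems\<close>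

context
  assumes ast: "as_terminating \<Gamma> \<delta>"
begin

lemma scc_component: "X \<in> \<Gamma> \<Longrightarrow> pbpa_component \<Gamma> \<delta> (scc X)"
  using mem_scc_self scc_conn surv_tendsto_0[OF ast]
  by unfold_locales (auto simp: scc_def)

text \<open>Dropping the first edge of a path gives the hypothesis for the symbols below with
  \<open>k\<close> in place of \<open>Suc k\<close>. Their bound serves as \<eta>, and solving the
  quadratic estimate for \<open>gsurv\<close> halves the exponent.\<close>

lemma gsurv_scc_tower:
  assumes "X \<in> \<Gamma>" "\<And>D. (scc X, D) \<notin> scc_edge \<Gamma> \<delta> ^^ k"
  shows "\<exists>K\<ge>0. \<forall>s. 1 / 2 \<le> s \<longrightarrow> s < 1 \<longrightarrow> gsurv \<delta> s [X] \<le> K * (1 - s) powr (1 / 2 ^ k)"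
  using assms
proof (induction k arbitrary: X)
  case 0
  then show ?case by auto
next
  case (Suc k)
  let ?L = "{Y \<in> \<Gamma>. (scc X, scc Y) \<in> scc_edge \<Gamma> \<delta>}" and ?e = "1 / 2 ^ k :: real"
  interpret pbpa_component \<Gamma> \<delta> "scc X"
    using Suc.prems(1) by (rule scc_component)
  have "\<exists>K\<ge>0. \<forall>s. 1 / 2 \<le> s \<longrightarrow> s < 1 \<longrightarrow> gsurv \<delta> s [Y] \<le> K * (1 - s) powr ?e" if "Y \<in> ?L" for Y
  proof (rule Suc.IH)
    show "(scc Y, D) \<notin> scc_edge \<Gamma> \<delta> ^^ k" for D
      using that Suc.prems(2)[of D] by (auto dest: relpow_Suc_I2)
  qed (use that in simp)
  then have "\<forall>Y\<in>?L. \<exists>K. 0 \<le> K \<and> (\<forall>s. 1 / 2 \<le> s \<longrightarrow> s < 1 \<longrightarrow> gsurv \<delta> s [Y] \<le> K * (1 - s) powr ?e)"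
    by blast
  from bchoice[OF this] obtain f where f: "\<And>Y. Y \<in> ?L \<Longrightarrow> 0 \<le> f Y"
    "\<And>Y s. Y \<in> ?L \<Longrightarrow> 1 / 2 \<le> s \<Longrightarrow> s < 1 \<Longrightarrow> gsurv \<delta> s [Y] \<le> f Y * (1 - s) powr ?e"
    by blast
  define K where "K = sum f ?L"
  have finL: "finite ?L"
    using finite_\<Gamma> by simp
  have K: "0 \<le> K"
    unfolding K_def using f(1) by (rule sum_nonneg)
  define n where "n = card (scc X)"
  define A where "A = real n * (2 + 2 * K) / pm ^ n / (pm / 2) ^ (2 * n)"
  have A: "0 \<le> A"
    using pm_bounds K by (simp add: A_def)
  have "gsurv \<delta> s [X] \<le> sqrt A * (1 - s) powr (1 / 2 ^ Suc k)" if s: "1 / 2 \<le> s" "s < 1" for s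
  proof -
    have s0: "0 < s"
      using s by simp
    let ?\<eta> = "K * (1 - s) powr ?e"
    have low: "gsurv \<delta> s [Y] \<le> ?\<eta>"
      if Z: "Z \<in> scc X" "\<alpha> \<in> set_pmf (\<delta> Z)" "Y \<in> set \<alpha>" "Y \<notin> scc X" for Z \<alpha> Y
    proof -
      have Y: "Y \<in> ?L"
        using scc_edge_rhs[OF Suc.prems(1) Z] by simp
      have "f Y \<le> K"
        unfolding K_def using f(1) finL Y by (intro member_le_sum) auto
      then have "f Y * (1 - s) powr ?e \<le> ?\<eta>"
        by (intro mult_right_mono) auto
      then show ?thesis
        using f(2)[OF Y s] by simp
    qed
    have "(s * pm) ^ (2 * n) * (gsurv \<delta> s [X])\<^sup>2 \<le> real n * (2 * (1 - s) + 2 * ?\<eta>) / pm ^ n"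
      unfolding n_def using K mem_scc_self[OF Suc.prems(1)] low by (intro component_bound[OF s0 s(2)]) auto
    also have "\<dots> \<le> real n * ((2 + 2 * K) * (1 - s) powr ?e) / pm ^ n"
    proof -
      \<comment> \<open>The killing term is dominated by the contribution from below, whose exponent
        is at most 1.\<close>
      have "(1 - s) powr 1 \<le> (1 - s) powr ?e"
        using s by (intro powr_mono') auto
      then have "2 * (1 - s) + 2 * ?\<eta> \<le> (2 + 2 * K) * (1 - s) powr ?e"
        using s by (simp add: algebra_simps)
      then show ?thesis
        using pm_bounds by (intro divide_right_mono mult_left_mono) auto
    qed
    finally have up: "(s * pm) ^ (2 * n) * (gsurv \<delta> s [X])\<^sup>2
        \<le> real n * ((2 + 2 * K) * (1 - s) powr ?e) / pm ^ n" .
    have "(pm / 2) ^ (2 * n) * (gsurv \<delta> s [X])\<^sup>2 \<le> (s * pm) ^ (2 * n) * (gsurv \<delta> s [X])\<^sup>2"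
      using s pm_bounds by (intro mult_right_mono power_mono) auto
    with up have "(gsurv \<delta> s [X])\<^sup>2 * (pm / 2) ^ (2 * n)
        \<le> real n * ((2 + 2 * K) * (1 - s) powr ?e) / pm ^ n"
      by (simp add: mult.commute)
    then have "(gsurv \<delta> s [X])\<^sup>2 \<le> real n * ((2 + 2 * K) * (1 - s) powr ?e) / pm ^ n / (pm / 2) ^ (2 * n)"
      using pm_bounds by (subst pos_le_divide_eq) auto
    also have "\<dots> = A * (1 - s) powr ?e"
      by (simp add: A_def)
    finally have "gsurv \<delta> s [X] \<le> sqrt (A * (1 - s) powr ?e)"
      by (rule real_le_rsqrt)
    also have "\<dots> = sqrt A * (1 - s) powr (1 / 2 ^ Suc k)"
      by (simp add: real_sqrt_mult powr_powr mult.commute flip: powr_half_sqrt)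
    finally show ?thesis .
  qed
  then show ?case
    using A by (intro exI[of _ "sqrt A"]) auto
qed

text \<open>For this parameter the clock rings within \<open>n\<close> ticks with probability at
  least \<open>1 - exp (- 1)\<close>, hence at least 1/2.\<close>

lemma surv_le_2_gsurv:
  assumes X: "X \<in> \<Gamma>" and n: "2 \<le> n"
  shows "surv \<delta> (n - 1) [X] \<le> 2 * gsurv \<delta> (1 - 1 / real n) [X]"
proof -
  let ?s = "1 - 1 / real n"
  have s: "0 < ?s" "?s < 1"
    using n by auto
  have "?s ^ n \<le> exp (- (1 / real n)) ^ n"
    using s exp_ge_add_one_self[of "- (1 / real n)"] by (intro power_mono) auto
  also have "\<dots> = exp (- 1)"
    using n by (simp flip: exp_of_nat_mult)
  also have "exp (- 1 :: real) \<le> 1 / 2"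
    using exp_ge_add_one_self[of 1] by (simp add: exp_minus field_simps)
  finally have "surv \<delta> (n - 1) [X] * (1 / 2) \<le> surv \<delta> (n - 1) [X] * (1 - ?s ^ Suc (n - 1))"
    using n by (intro mult_left_mono surv_nonneg) auto
  also have "\<dots> \<le> gsurv \<delta> ?s [X]"
    using X s by (intro surv_le_gsurv) auto
  finally show ?thesis by simp
qed

text \<open>Nothing lies below the component, so \<eta> is 0. Explicit constants are kept because
  for height 1 there is no surplus in the exponent to absorb them.\<close>

lemma gsurv_bottom_scc:
  assumes X: "X \<in> \<Gamma>" and no: "\<And>D. (scc X, D) \<notin> scc_edge \<Gamma> \<delta>" and n: "4 * card \<Gamma> \<le> n"
  shows "gsurv \<delta> (1 - 1 / real n) [X] \<le> 2 * real (card \<Gamma>) / pm ^ (3 * card \<Gamma>) / sqrt (real n)"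
proof -
  interpret pbpa_component \<Gamma> \<delta> "scc X"
    using X by (rule scc_component)
  let ?s = "1 - 1 / real n" and ?N = "card (scc X)"
  have N: "0 < ?N" "?N \<le> card \<Gamma>"
    using N_pos C_sub finite_\<Gamma> by (auto intro: card_mono)
  have n4: "4 \<le> n" "4 * ?N \<le> n"
    using N n by linarith+
  have s: "0 < ?s" "?s < 1"
    using n4 by auto
  have "(?s * pm) ^ (2 * ?N) * (gsurv \<delta> ?s [X])\<^sup>2 \<le> real ?N * (2 * (1 - ?s) + 2 * 0) / pm ^ ?N"
    using scc_edge_rhs(2)[OF X] no mem_scc_self[OF X] s by (intro component_bound) blast+
  then have up: "?s ^ (2 * ?N) * (pm ^ (2 * ?N) * (gsurv \<delta> ?s [X])\<^sup>2) \<le> 2 * real ?N / real n / pm ^ ?N"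
    by (simp add: power_mult_distrib mult_ac)
  \<comment> \<open>Bernoulli and \<open>n \<ge> 4 * ?N\<close> keep \<open>?s ^ (2 * ?N)\<close>
    above 1/2, avoiding the factor \<open>2 ^ (2 * ?N)\<close> that \<open>?s \<ge> 1 / 2\<close>
    alone would cost.\<close>
  have "1 / 2 \<le> 1 + real (2 * ?N) * (- (1 / real n))"
  proof -
    have "real (2 * ?N) / real n \<le> 1 / 2"
      using n4 by (simp add: divide_le_eq)
    then show ?thesis by simp
  qed
  also have "\<dots> \<le> (1 + (- (1 / real n))) ^ (2 * ?N)"
    using n4 by (intro Bernoulli_inequality) auto
  finally have "1 / 2 * (pm ^ (2 * ?N) * (gsurv \<delta> ?s [X])\<^sup>2) \<le> ?s ^ (2 * ?N) * (pm ^ (2 * ?N) * (gsurv \<delta> ?s [X])\<^sup>2)"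
    using pm_bounds by (intro mult_right_mono) auto
  with up have "1 / 2 * (pm ^ (2 * ?N) * (gsurv \<delta> ?s [X])\<^sup>2) \<le> 2 * real ?N / real n / pm ^ ?N"
    by (rule order_trans[rotated])
  then have "(gsurv \<delta> ?s [X])\<^sup>2 * pm ^ (2 * ?N) \<le> 4 * real ?N / real n / pm ^ ?N"
    by (simp add: mult.commute)
  then have "(gsurv \<delta> ?s [X])\<^sup>2 \<le> 4 * real ?N / real n / pm ^ ?N / pm ^ (2 * ?N)"
    using pm_bounds by (subst pos_le_divide_eq) auto
  also have "\<dots> = 4 * (real ?N / pm ^ (3 * ?N)) / real n"
    by (simp add: numeral_3_eq_3 numeral_2_eq_2 power_add)
  also have "\<dots> \<le> 4 * (real (card \<Gamma>) / pm ^ (3 * card \<Gamma>)) / real n"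
    using N pm_bounds by (intro divide_right_mono mult_left_mono frac_le power_decreasing) auto
  finally have "gsurv \<delta> ?s [X] \<le> sqrt (4 * (real (card \<Gamma>) / pm ^ (3 * card \<Gamma>)) / real n)"
    by (rule real_le_rsqrt)
  also have "\<dots> = 2 * sqrt (real (card \<Gamma>) / pm ^ (3 * card \<Gamma>)) / sqrt (real n)"
    by (simp add: real_sqrt_mult real_sqrt_divide)
  also have "\<dots> \<le> 2 * (real (card \<Gamma>) / pm ^ (3 * card \<Gamma>)) / sqrt (real n)"
  proof -
    have "pm ^ (3 * card \<Gamma>) \<le> 1"
      using pm_bounds by (intro power_le_one) auto
    then have "1 \<le> real (card \<Gamma>) / pm ^ (3 * card \<Gamma>)"
      using N pm_bounds by (subst pos_le_divide_eq) auto
    then have "sqrt (real (card \<Gamma>) / pm ^ (3 * card \<Gamma>)) \<le> real (card \<Gamma>) / pm ^ (3 * card \<Gamma>)"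
      by (intro real_le_lsqrt self_le_power) auto
    then show ?thesis
      by (intro divide_right_mono mult_left_mono) auto
  qed
  finally show ?thesis by simp
qed

lemma surv_upper:
  assumes X0: "X0 \<in> \<Gamma>" and dep: "\<And>X. X \<in> \<Gamma> \<Longrightarrow> (X0, X) \<in> (direct_dep \<Gamma> \<delta>)\<^sup>*"
  shows "\<forall>\<^sub>F n in sequentially. surv \<delta> (n - 1) [X0]
    \<le> (18 * real (scc_height \<Gamma> \<delta>) * real (card \<Gamma>) / pm ^ (3 * card \<Gamma>))
        / real n powr (1 / (2 ^ (scc_height \<Gamma> \<delta> + 1) - 2))"
proof -
  define h where "h = scc_height \<Gamma> \<delta>"
  define d where "d = 18 * real h * real (card \<Gamma>) / pm ^ (3 * card \<Gamma>)"
  have G: "0 < card \<Gamma>"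
    using X0 finite_\<Gamma> card_gt_0_iff by blast
  have p: "0 < pm"
    using X0 by (rule pm_pos)
  have h: "1 \<le> h"
    by (simp add: h_def scc_height_def)
  have d: "0 < d"
    using G h p by (simp add: d_def)
  have path: "(scc X0, D) \<notin> scc_edge \<Gamma> \<delta> ^^ h" for D
    unfolding h_def using X0 dep by (rule no_scc_path_of_height)
  have "\<forall>\<^sub>F n in sequentially. surv \<delta> (n - 1) [X0] \<le> d / real n powr (1 / (2 ^ (h + 1) - 2))"
  proof (cases "h = 1")
    case True
    have "\<forall>\<^sub>F n in sequentially. 4 * card \<Gamma> \<le> n"
      by (rule eventually_ge_at_top)
    then show ?thesis
    proof eventually_elim
      case (elim n)
      have "surv \<delta> (n - 1) [X0] \<le> 2 * gsurv \<delta> (1 - 1 / real n) [X0]"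
        using elim G by (intro surv_le_2_gsurv X0) linarith
      also have "\<dots> \<le> 2 * (2 * real (card \<Gamma>) / pm ^ (3 * card \<Gamma>) / sqrt (real n))"
        using path True elim by (intro mult_left_mono gsurv_bottom_scc X0) auto
      also have "\<dots> \<le> 18 * (real (card \<Gamma>) / pm ^ (3 * card \<Gamma>) / sqrt (real n))"
      proof -
        have "0 \<le> real (card \<Gamma>) / pm ^ (3 * card \<Gamma>) / sqrt (real n)"
          using p by (intro divide_nonneg_nonneg) auto
        then show ?thesis by simp
      qed
      also have "\<dots> = d / real n powr (1 / (2 ^ (h + 1) - 2))"
        using True by (simp add: d_def powr_half_sqrt)
      finally show ?case .
    qed
  next
    case False
    then have h2: "2 \<le> h"
      using h by simp
    obtain K where K: "0 \<le> K" "\<And>s. 1 / 2 \<le> s \<Longrightarrow> s < 1 \<Longrightarrow> gsurv \<delta> s [X0] \<le> K * (1 - s) powr (1 / 2 ^ h)"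
      using gsurv_scc_tower[OF X0 path] by blast
    define e :: real where "e = 1 / 2 ^ h - 1 / (2 ^ (h + 1) - 2)"
    have "(2::real) ^ 2 \<le> 2 ^ h"
      using h2 by (intro power_increasing) auto
    then have e: "0 < e"
      by (auto simp: e_def intro!: divide_strict_left_mono)
    \<comment> \<open>The surplus power eventually exceeds the uncontrolled constant
      \<open>2 * K / d\<close>.\<close>
    have "filterlim (\<lambda>n. real n powr e) at_top sequentially"
      using e by real_asymp
    then have "\<forall>\<^sub>F n in sequentially. 2 * K / d \<le> real n powr e"
      by (simp add: filterlim_at_top)
    then show ?thesis
      using eventually_ge_at_top[of 2]
    proof eventually_elim
      case (elim n)
      have half: "1 / 2 \<le> 1 - 1 / real n" "1 - 1 / real n < 1"
        using elim(2) by (auto simp: field_simps)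
      have "surv \<delta> (n - 1) [X0] \<le> 2 * gsurv \<delta> (1 - 1 / real n) [X0]"
        using elim(2) X0 by (rule surv_le_2_gsurv[rotated])
      also have "\<dots> \<le> 2 * (K * (1 - (1 - 1 / real n)) powr (1 / 2 ^ h))"
        using K(2)[OF half] by simp
      also have "\<dots> = 2 * K / real n powr (1 / 2 ^ h)"
        by (simp add: powr_divide)
      also have "\<dots> \<le> d * real n powr e / real n powr (1 / 2 ^ h)"
        using elim(1) d by (intro divide_right_mono) (auto simp: divide_le_eq mult.commute)
      also have "\<dots> = d / real n powr (1 / (2 ^ (h + 1) - 2))"
        using elim(2) by (simp add: e_def powr_diff)
      finally show ?case .
    qed
  qed
  then show ?thesis
    by (simp add: d_def h_def)
qed

end

end

section \<open>The three cases combined\<close>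

theorem theorem1:
  fixes \<Gamma> :: "'a set" and \<delta> :: "'a \<Rightarrow> 'a list pmf" and X0 :: 'a
  assumes "pBPA \<Gamma> \<delta>"
    and "as_terminating \<Gamma> \<delta>"
    and "X0 \<in> \<Gamma>"
    and "\<forall>X\<in>\<Gamma> - {X0}. (X0, X) \<in> depends_on \<Gamma> \<delta>"
  shows
    "prob_term_ge \<delta> [X0] (2 ^ card \<Gamma>) = 0
     \<or> expected_time \<delta> [X0] < \<infinity> \<and>
       (\<forall>n::nat. 2 * expected_time \<delta> [X0] \<le> of_nat n \<longrightarrow>
          p_min \<Gamma> \<delta> ^ n \<le> prob_term_ge \<delta> [X0] n \<and>
          prob_term_ge \<delta> [X0] n \<le> exp (1 - real n / (8 * (enn2real (E_max \<Gamma> \<delta>))\<^sup>2)))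
     \<or> expected_time \<delta> [X0] = \<infinity> \<and>
       (\<exists>(n0::nat) (c::real). c > 0 \<and>
          (\<forall>n\<ge>n0.
             c / real n powr (1 / 2) \<le> prob_term_ge \<delta> [X0] n \<and>
             prob_term_ge \<delta> [X0] n
               \<le> (18 * real (scc_height \<Gamma> \<delta>) * real (card \<Gamma>) / p_min \<Gamma> \<delta> ^ (3 * card \<Gamma>))
                  / real n powr (1 / (2 ^ (scc_height \<Gamma> \<delta> + 1) - 2))))"
proof -
  interpret pbpa \<Gamma> \<delta>
    using assms(1) by unfold_locales
  have X0: "[X0] \<in> lists \<Gamma>"
    using assms(3) by simp
  have dep: "(X0, X) \<in> (direct_dep \<Gamma> \<delta>)\<^sup>*" if "X \<in> \<Gamma>" for X
    using that assms(4) unfolding depends_on_def by (cases "X = X0") (auto intro: trancl_into_rtrancl)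
  have prob: "prob_term_ge \<delta> [X0] n = surv \<delta> (n - 1) [X0]" if "0 < n" for n
    using X0 that by (rule prob_term_ge_eq)
  consider (bounded) "prob_term_ge \<delta> [X0] (2 ^ card \<Gamma>) = 0"
    | (finite) "prob_term_ge \<delta> [X0] (2 ^ card \<Gamma>) \<noteq> 0" "expected_time \<delta> [X0] < \<infinity>"
    | (infinite) "expected_time \<delta> [X0] = \<infinity>"
    using less_top by fastforce
  then show ?thesis
  proof cases
    case finite
    have fin: "summable (\<lambda>n. surv \<delta> n [X])" if "X \<in> \<Gamma>" for X
      using dep[OF that] expected_time_finite[OF assms(3) finite(2)] by (rule summable_surv_dep)
    have "surv \<delta> (2 ^ card \<Gamma> - 1) [X0] \<noteq> 0"
      using finite(1) prob by simp
    note low = surv_ge_power[OF assms(3) this]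
    have "p_min \<Gamma> \<delta> ^ n \<le> prob_term_ge \<delta> [X0] n \<and>
        prob_term_ge \<delta> [X0] n \<le> exp (1 - real n / (8 * (enn2real (E_max \<Gamma> \<delta>))\<^sup>2))"
      if n: "2 * expected_time \<delta> [X0] \<le> of_nat n" for n
    \<comment> \<open>At 0 the shift to \<open>n - 1\<close> is invalid, but both sides are direct:
      the probability is 1 and lies between \<open>p_min \<Gamma> \<delta> ^ 0\<close> and
      \<open>exp 1\<close>.\<close>
    proof (cases "n = 0")
      case True
      then show ?thesis
        by (simp add: prob_term_ge_0)
    next
      case False
      have "p_min \<Gamma> \<delta> ^ n \<le> p_min \<Gamma> \<delta> ^ (n - 1)"
        using pm_pos[OF assms(3)] pm_le_1[OF assms(3)] by (intro power_decreasing) auto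
      with low[of "n - 1"] finite_expectation_upper[OF fin assms(3) _ n] False show ?thesis
        by (simp add: prob)
    qed
    with finite(2) show ?thesis by blast
  next
    case infinite
    have ns: "\<not> summable (\<lambda>n. surv \<delta> n [X0])"
      using expected_time_suminf[OF assms(3)] infinite by auto
    obtain c where c: "0 < c" "\<And>n. 0 < n \<Longrightarrow> c / sqrt (real n) \<le> surv \<delta> n [X0]"
      using infinite_expectation_lower[OF assms(3) dep ns surv_tendsto_0[OF assms(2,3)]] by blast
    obtain m where m: "\<And>n. m \<le> n \<Longrightarrow> surv \<delta> (n - 1) [X0]
        \<le> (18 * real (scc_height \<Gamma> \<delta>) * real (card \<Gamma>) / p_min \<Gamma> \<delta> ^ (3 * card \<Gamma>))
            / real n powr (1 / (2 ^ (scc_height \<Gamma> \<delta> + 1) - 2))"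
      using surv_upper[OF assms(2,3) dep] unfolding eventually_sequentially by blast
    have "c / real n powr (1 / 2) \<le> prob_term_ge \<delta> [X0] n \<and>
        prob_term_ge \<delta> [X0] n
          \<le> (18 * real (scc_height \<Gamma> \<delta>) * real (card \<Gamma>) / p_min \<Gamma> \<delta> ^ (3 * card \<Gamma>))
             / real n powr (1 / (2 ^ (scc_height \<Gamma> \<delta> + 1) - 2))" if "max 1 m \<le> n" for n
    proof -
      have n: "0 < n" "m \<le> n"
        using that by auto
      have "c / real n powr (1 / 2) \<le> surv \<delta> n [X0]"
        using c(2)[OF n(1)] by (simp add: powr_half_sqrt)
      also have "\<dots> \<le> surv \<delta> (n - 1) [X0]"
        using X0 by (intro surv_antimono) auto
      finally show ?thesis
        using m[OF n(2)] prob[OF n(1)] by simp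
    qed
    with c(1) infinite show ?thesis by blast
  qed blast
qed

end
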